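(* Let $1\le p<\gamma\le 2$, let $T>0$, and let $x:[0,T]\to\mathbb{R}^d$ be a continuous path of finite $p$-variation (in the sense given in the context). Let $f=(f^i_j)\in C^{\gamma}$ and $y_0\in\mathbb{R}^n$. Let $0<\tau\le T$ and let $y$ be a solution for $0\le t<\tau$ of $$dy^i=\sum_{j=1}^d f^i_j(y)\,dx^j,\qquad y^i(0)=y^i_0,\quad i=1,\dots,n,$$ such that if $\tau<T$ then $|y(t)|\to\infty$ as $t\to\tau$ (such $\tau$ and $y$ exist). Then $y$ is unique in the sense that if $t<\tau$ and $\tilde y$ is another solution of the equation on $[0,t]$ (with the same initial value $y_0$), then $\tilde y=y$ on $[0,t]$. Moreover, if $t<\tau$ and $\epsilon>0$, there is $\delta>0$ such that whenever $0=t_0<t_1<\dots<t_K=t$ with $t_k-t_{k-1}<\delta$ for each $k$, we have $|y_k-y(t_k)|<\epsilon$ for each $k=0,\dots,K$, where $y_k$ is defined, starting from the given $y_0$, by the Euler recurrence $$y^i_{k+1}=y^i_k+\sum_j f^i_j(y_k)\,(x^j(t_{k+1})-x^j(t_k)).$$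
   Context: $n,d$ are positive integers. For $\rho=N+\alpha$ with $N$ a positive integer and $0<\alpha\le 1$, $C^\rho$ is the set of $f=(f^i_j)_{1\le i\le n,\,1\le j\le d}$ such that each $f^i_j:\mathbb{R}^n\to\mathbb{R}$ has derivatives up to order $N$, all of which satisfy locally a Hölder condition of exponent $\alpha$ (so $C^2$ means that first derivatives exist and are locally Lipschitz). Finite $p$-variation: there is a continuous increasing function $\omega$ on $[0,T]$ with $|x(t)-x(s)|^p\le\omega(t)-\omega(s)$ for $0\le s\le t\le T$. Solution: $y:[0,t_1]\to\mathbb{R}^n$ is a solution on $[0,t_1]$ if $y(0)=y_0$ and there exist a continuous increasing function $\tilde\omega$ on $[0,t_1]$ and a non-negative function $\theta$ on $[0,\infty)$ with $\theta(\delta)=o(\delta)$ as $\delta\to0$ such that for all $i$ and all $0\le s<t\le t_1$ $$\Big|y^i(t)-y^i(s)-\sum_j f^i_j(y(s))(x^j(t)-x^j(s))\Big|\le\theta(\tilde\omega(t)-\tilde\omega(s)).$$ A solution for $0\le t<\tau$ is a function on $[0,\tau)$ whose restriction to $[0,t_1]$ is a solution on $[0,t_1]$ for every $t_1<\tau$. *)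

theory Defs
  imports "HOL-Analysis.Analysis" "HOL-Library.Landau_Symbols"
begin

definition locally_Hoelder :: "real \<Rightarrow> ('a::metric_space \<Rightarrow> real) \<Rightarrow> bool" where
  "locally_Hoelder \<alpha> g \<longleftrightarrow>
     (\<forall>z. \<exists>r>0. \<exists>C. \<forall>u\<in>ball z r. \<forall>v\<in>ball z r. \<bar>g u - g v\<bar> \<le> C * dist u v powr \<alpha>)"

(* D k is the k-th partial derivative of g. *)
fun Hoelder_derivs :: "nat \<Rightarrow> real \<Rightarrow> (real ^ 'n \<Rightarrow> real) \<Rightarrow> bool" where
  "Hoelder_derivs 0 \<alpha> g \<longleftrightarrow> locally_Hoelder \<alpha> g"
| "Hoelder_derivs (Suc N) \<alpha> g \<longleftrightarrow>
     locally_Hoelder \<alpha> g \<and>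
     (\<exists>D. (\<forall>z. (g has_derivative (\<lambda>h. \<Sum>k\<in>UNIV. D k z * h $ k)) (at z)) \<and>
          (\<forall>k. Hoelder_derivs N \<alpha> (D k)))"

(* The family of functions f i j is encoded as a matrix-valued map, so that f z *v h is the vector
   with i-th component (\<Sum>j. f z $ i $ j * h $ j). N and \<alpha> are determined by \<rho>; an integer \<rho> has
   \<alpha> = 1, so for instance \<rho> = 2 asks for locally Lipschitz first derivatives. *)
definition C_rho :: "real \<Rightarrow> (real ^ 'n \<Rightarrow> real ^ 'd ^ 'n) \<Rightarrow> bool" where
  "C_rho \<rho> f \<longleftrightarrow>
     (\<exists>N \<alpha>. 0 < N \<and> 0 < \<alpha> \<and> \<alpha> \<le> 1 \<and> \<rho> = real N + \<alpha> \<and>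
        (\<forall>i j. Hoelder_derivs N \<alpha> (\<lambda>z. f z $ i $ j)))"

definition finite_p_variation :: "real \<Rightarrow> real \<Rightarrow> (real \<Rightarrow> real ^ 'd) \<Rightarrow> bool" where
  "finite_p_variation p T x \<longleftrightarrow>
     (\<exists>\<omega>::real \<Rightarrow> real. continuous_on {0..T} \<omega> \<and> mono_on {0..T} \<omega> \<and>
        (\<forall>s t. 0 \<le> s \<and> s \<le> t \<and> t \<le> T \<longrightarrow> norm (x t - x s) powr p \<le> \<omega> t - \<omega> s))"

(* Increasing is read in the weak sense, so \<omega> may be constant on an interval and \<theta> is then evaluated
   at 0. The condition \<theta> 0 = 0 is the estimate \<theta>(\<delta>) = o(\<delta>) at the point \<delta> = 0 itself, which the
   punctured filter at_right 0 does not see; without it, a constant \<omega> and a large value \<theta> 0 would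
   admit arbitrary bounded paths as solutions. *)
definition solution_on ::
  "(real ^ 'n \<Rightarrow> real ^ 'd ^ 'n) \<Rightarrow> (real \<Rightarrow> real ^ 'd) \<Rightarrow> real ^ 'n \<Rightarrow> real \<Rightarrow> (real \<Rightarrow> real ^ 'n) \<Rightarrow> bool"
where
  "solution_on f x y0 t1 y \<longleftrightarrow>
     y 0 = y0 \<and>
     (\<exists>(\<omega>::real \<Rightarrow> real) (\<theta>::real \<Rightarrow> real).
        continuous_on {0..t1} \<omega> \<and> mono_on {0..t1} \<omega> \<and>
        (\<forall>\<delta>\<ge>0. 0 \<le> \<theta> \<delta>) \<and> \<theta> 0 = 0 \<and> \<theta> \<in> o[at_right 0](\<lambda>\<delta>. \<delta>) \<and>
        (\<forall>i s t. 0 \<le> s \<and> s < t \<and> t \<le> t1 \<longrightarrow>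
           \<bar>(y t - y s - f (y s) *v (x t - x s)) $ i\<bar> \<le> \<theta> (\<omega> t - \<omega> s)))"

definition solution_before ::
  "(real ^ 'n \<Rightarrow> real ^ 'd ^ 'n) \<Rightarrow> (real \<Rightarrow> real ^ 'd) \<Rightarrow> real ^ 'n \<Rightarrow> real \<Rightarrow> (real \<Rightarrow> real ^ 'n) \<Rightarrow> bool"
where
  "solution_before f x y0 \<tau> y \<longleftrightarrow> (\<forall>t1. 0 \<le> t1 \<and> t1 < \<tau> \<longrightarrow> solution_on f x y0 t1 y)"

definition maximal_solution ::
  "(real ^ 'n \<Rightarrow> real ^ 'd ^ 'n) \<Rightarrow> (real \<Rightarrow> real ^ 'd) \<Rightarrow> real ^ 'n \<Rightarrow> real \<Rightarrow> real \<Rightarrow> (real \<Rightarrow> real ^ 'n) \<Rightarrow> bool"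
where
  "maximal_solution f x y0 T \<tau> y \<longleftrightarrow>
     0 < \<tau> \<and> \<tau> \<le> T \<and> solution_before f x y0 \<tau> y \<and>
     (\<tau> < T \<longrightarrow> filterlim (\<lambda>t. norm (y t)) at_top (at_left \<tau>))"

primrec euler ::
  "(real ^ 'n \<Rightarrow> real ^ 'd ^ 'n) \<Rightarrow> (real \<Rightarrow> real ^ 'd) \<Rightarrow> real ^ 'n \<Rightarrow> (nat \<Rightarrow> real) \<Rightarrow> nat \<Rightarrow> real ^ 'n"
where
  "euler f x y0 u 0 = y0"
| "euler f x y0 u (Suc k) =
     euler f x y0 u k + f (euler f x y0 u k) *v (x (u (Suc k)) - x (u k))"

end

theory Submission
  imports Defs "HOL-Complex_Analysis.Great_Picard"
begin

text \<open>The argument is a discrete form of Young integration. For a sequence \<open>y\<close> following the equation along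
  a grid, with one-step errors \<open>e\<close>, the defect
  \<open>J s t = y t - y s - f (y s) *v (x t - x s)\<close> satisfies
  \<open>J s t - J s r - J r t = (f (y r) - f (y s)) *v (x t - x r)\<close>, which is of size \<open>w powr (2 / p)\<close> with
  \<open>w = \<omega> t - \<omega> s\<close> and \<open>2 / p > 1\<close>; halving \<open>w\<close> recursively gives
  \<open>norm (J s t) \<le> L * w powr (2 / p) + 2 * sum e\<close>. Applied to Euler schemes, this estimate and the
  Arzela-Ascoli theorem produce solutions; applied to a solution on finer and finer grids, it bounds
  the defect of every solution. The same recursion for the difference of two sequences, where
  \<open>f \<in> C\<^sup>\<gamma>\<close> gives the exponent \<open>\<gamma> / p > 1\<close>, shows that their distance is at most a constant times
  the sum of their one-step errors. For two solutions, and for a solution and the Euler scheme,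
  that sum tends to 0 with the mesh.\<close>

text \<open>For \<open>p\<close> > 1 the increments of \<open>x\<close> need not be summable over
  ever finer grids, so one-step errors cannot be propagated by a Gronwall argument in the norm of
  these increments. What can be summed is a power greater than 1 of the control, with constants that
  do not depend on the grid. Two features obstruct a plain halving argument. A grid need not contain
  a point that halves \<open>w\<close>, so each splitting leaves out one grid step, which is how the
  errors \<open>e\<close> enter. And the increment of \<open>y\<close> inside
  \<open>f (y r) - f (y s)\<close> contains the defect \<open>J s r\<close> itself; the recursion
  closes where \<open>w\<close> is small, as the defect is then multiplied by a small power of
  \<open>w\<close>. The hypotheses on \<open>f\<close> are local, so the constants belong to a ball
  that the sequences must not leave. For existence, \<open>f\<close> is composed with the projection
  onto a ball. The composition is Lipschitz but in general not of the class of \<open>f\<close>, so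
  local solutions are built from Lipschitz bounds, while two sequences are compared with the
  four-point bound for \<open>f\<close> on a ball containing both.\<close>

subsection \<open>Vector fields of class \<open>C_rho\<close> on balls\<close>

text \<open>A Lebesgue number \<open>\<epsilon>\<close> of a finite cover by the local balls splits
  the pairs: points closer than \<open>\<epsilon>\<close> lie in a common ball, and for the others
  the difference is at most \<open>2 * \<bar>B\<bar>\<close>, hence at most
  \<open>2 * \<bar>B\<bar> / \<epsilon> powr \<alpha>\<close> times
  \<open>dist u v powr \<alpha>\<close>.\<close>

lemma locally_Hoelder_compact:
  fixes g :: "'a::metric_space \<Rightarrow> real"
  assumes g: "locally_Hoelder \<alpha> g" and S: "compact S" and \<alpha>: "0 < \<alpha>"
  obtains B C where "0 \<le> C" "\<And>u. u \<in> S \<Longrightarrow> \<bar>g u\<bar> \<le> B"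
    "\<And>u v. u \<in> S \<Longrightarrow> v \<in> S \<Longrightarrow> \<bar>g u - g v\<bar> \<le> C * dist u v powr \<alpha>"
proof -
  define P where "P z r C \<longleftrightarrow> 0 < r \<and> (\<forall>u\<in>ball z r. \<forall>v\<in>ball z r. \<bar>g u - g v\<bar> \<le> C * dist u v powr \<alpha>)" for z r C
  have "\<forall>z. \<exists>r C. P z r C" using g unfolding locally_Hoelder_def P_def by blast
  then obtain r D where P: "\<And>z. P z (r z) (D z)" by metis
  have r: "\<And>z. 0 < r z"
    and D: "\<And>z u v. u \<in> ball z (r z) \<Longrightarrow> v \<in> ball z (r z) \<Longrightarrow> \<bar>g u - g v\<bar> \<le> D z * dist u v powr \<alpha>"
    using P unfolding P_def by blast+
  have "S \<subseteq> (\<Union>z\<in>S. ball z (r z))" using r by force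
  then obtain S' where S': "S' \<subseteq> S" "finite S'" "S \<subseteq> (\<Union>z\<in>S'. ball z (r z))"
    using compactE_image[OF S, of S "\<lambda>z. ball z (r z)"] by auto
  obtain \<epsilon> where \<epsilon>: "0 < \<epsilon>" "\<And>u. u \<in> S \<Longrightarrow> \<exists>G \<in> (\<lambda>z. ball z (r z)) ` S'. ball u \<epsilon> \<subseteq> G"
    by (rule Heine_Borel_lemma[OF S S'(3)]) auto
  define C1 where "C1 = (\<Sum>z\<in>S'. \<bar>D z\<bar>)"
  define B where "B = (\<Sum>z\<in>S'. \<bar>g z\<bar> + \<bar>D z\<bar> * r z powr \<alpha>)"
  have C1: "\<bar>D z\<bar> \<le> C1" if "z \<in> S'" for z
    unfolding C1_def using that S'(2) by (intro member_le_sum) auto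
  have C1_0: "0 \<le> C1" unfolding C1_def by (intro sum_nonneg) auto
  have B: "\<bar>g u\<bar> \<le> B" if u: "u \<in> S" for u
  proof -
    obtain z where z: "z \<in> S'" "u \<in> ball z (r z)" using u S' by auto
    have "\<bar>g u - g z\<bar> \<le> D z * dist u z powr \<alpha>"
      using D[of u z z] z r by auto
    also have "\<dots> \<le> \<bar>D z\<bar> * r z powr \<alpha>"
      using z \<alpha> by (intro mult_mono powr_mono2) (auto simp: dist_commute)
    finally have "\<bar>g u\<bar> \<le> \<bar>g z\<bar> + \<bar>D z\<bar> * r z powr \<alpha>" by linarith
    also have "\<dots> \<le> B" unfolding B_def using z S'(2)
      by (intro member_le_sum[where f="\<lambda>z. \<bar>g z\<bar> + \<bar>D z\<bar> * r z powr \<alpha>"]) auto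
    finally show ?thesis .
  qed
  define C where "C = C1 + 2 * \<bar>B\<bar> / \<epsilon> powr \<alpha>"
  have e0: "0 < \<epsilon> powr \<alpha>" using \<epsilon> by simp
  have C: "\<bar>g u - g v\<bar> \<le> C * dist u v powr \<alpha>" if u: "u \<in> S" and v: "v \<in> S" for u v
  proof (cases "dist u v < \<epsilon>")
    case True
    obtain z where z: "z \<in> S'" "ball u \<epsilon> \<subseteq> ball z (r z)" using \<epsilon>(2)[OF u] by auto
    have "\<bar>g u - g v\<bar> \<le> D z * dist u v powr \<alpha>"
      using z True \<epsilon>(1) by (intro D) (auto simp: subset_eq)
    also have "\<dots> \<le> C * dist u v powr \<alpha>"
      using C1[OF z(1)] e0 by (intro mult_right_mono) (auto simp: C_def intro: add_increasing2)
    finally show ?thesis .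
  next
    case False
    have "\<bar>g u - g v\<bar> \<le> 2 * \<bar>B\<bar>" using B[OF u] B[OF v] by linarith
    also have "\<dots> = 2 * \<bar>B\<bar> / \<epsilon> powr \<alpha> * \<epsilon> powr \<alpha>" using e0 by simp
    also have "\<dots> \<le> C * dist u v powr \<alpha>"
      using False \<epsilon> \<alpha> C1_0 by (intro mult_mono powr_mono2) (auto simp: C_def)
    finally show ?thesis .
  qed
  have "0 \<le> C" using C1_0 e0 by (simp add: C_def)
  then show thesis using that B C by blast
qed

lemma add_powr_le_of_convex:
  fixes a b \<xi> :: real
  assumes "0 \<le> a" "0 \<le> b" "0 \<le> \<xi>" "\<xi> \<le> 1" "0 < \<alpha>"
  shows "((1 - \<xi>) * b + \<xi> * a) powr \<alpha> \<le> a powr \<alpha> + b powr \<alpha>"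
proof -
  have "((1 - \<xi>) * b + \<xi> * a) powr \<alpha> \<le> (max a b) powr \<alpha>"
    using assms by (intro powr_mono2 convex_bound_le) auto
  also have "\<dots> \<le> a powr \<alpha> + b powr \<alpha>" by (auto simp: max_def)
  finally show ?thesis .
qed

text \<open>The mean value theorem is applied to \<open>g (P t) - g (Q t)\<close>, where
  \<open>P\<close> and \<open>Q\<close> run along the segments from \<open>b\<close> to
  \<open>a\<close> and from \<open>d\<close> to \<open>c\<close> with the same parameter. The common
  intermediate value \<open>\<xi>\<close> makes the gradients comparable:
  \<open>P \<xi> - Q \<xi>\<close> is a convex combination of \<open>a - c\<close> and
  \<open>b - d\<close>. Separate mean values on the two segments would give gradients at unrelated
  points.\<close>

lemma four_point_estimate:
  fixes g :: "real ^ 'n \<Rightarrow> real"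
  assumes der: "\<And>z. (g has_derivative (\<lambda>h. \<Sum>k\<in>UNIV. D k z * h $ k)) (at z)"
    and S: "convex S" and \<alpha>: "0 < \<alpha>"
    and \<Lambda>: "\<And>k z. z \<in> S \<Longrightarrow> \<bar>D k z\<bar> \<le> \<Lambda> k"
    and H: "\<And>k u v. u \<in> S \<Longrightarrow> v \<in> S \<Longrightarrow> \<bar>D k u - D k v\<bar> \<le> H k * dist u v powr \<alpha>"
    and H0: "\<And>k. 0 \<le> H k"
    and mem: "a \<in> S" "b \<in> S" "c \<in> S" "d \<in> S"
  shows "\<bar>g a - g b - (g c - g d)\<bar> \<le> (\<Sum>k\<in>UNIV. \<Lambda> k) * norm (a - b - (c - d))
    + (\<Sum>k\<in>UNIV. H k) * norm (c - d) * (norm (a - c) powr \<alpha> + norm (b - d) powr \<alpha>)"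
proof -
  define P where "P t = b + t *\<^sub>R (a - b)" for t
  define Q where "Q t = d + t *\<^sub>R (c - d)" for t
  define psi where "psi t = g (P t) - g (Q t)" for t
  define psi' where "psi' t = (\<Sum>k\<in>UNIV. D k (P t) * (a - b) $ k) - (\<Sum>k\<in>UNIV. D k (Q t) * (c - d) $ k)" for t
  have dP: "(P has_derivative (\<lambda>s. s *\<^sub>R (a - b))) (at t)" for t
    unfolding P_def by (auto intro!: derivative_eq_intros)
  have dQ: "(Q has_derivative (\<lambda>s. s *\<^sub>R (c - d))) (at t)" for t
    unfolding Q_def by (auto intro!: derivative_eq_intros)
  have "DERIV psi t :> psi' t" for t
  proof -
    have "((\<lambda>t. g (P t) - g (Q t)) has_derivative
      (\<lambda>s. (\<Sum>k\<in>UNIV. D k (P t) * (s *\<^sub>R (a - b)) $ k) - (\<Sum>k\<in>UNIV. D k (Q t) * (s *\<^sub>R (c - d)) $ k))) (at t)"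
      by (intro has_derivative_diff has_derivative_compose[OF dP der] has_derivative_compose[OF dQ der])
    moreover have "(\<lambda>s. (\<Sum>k\<in>UNIV. D k (P t) * (s *\<^sub>R (a - b)) $ k) - (\<Sum>k\<in>UNIV. D k (Q t) * (s *\<^sub>R (c - d)) $ k))
       = (*) (psi' t)"
      by (auto simp: fun_eq_iff psi'_def sum_distrib_left sum_distrib_right algebra_simps)
    ultimately show ?thesis
      unfolding has_field_derivative_def psi_def by simp
  qed
  then obtain \<xi> where \<xi>: "0 < \<xi>" "\<xi> < 1" "psi 1 - psi 0 = psi' \<xi>"
    using MVT2[of 0 1 psi psi'] by auto
  have PS: "P \<xi> \<in> S"
    using convexD_alt[OF S mem(2,1), of \<xi>] \<xi> by (simp add: P_def algebra_simps)
  have QS: "Q \<xi> \<in> S"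
    using convexD_alt[OF S mem(4,3), of \<xi>] \<xi> by (simp add: Q_def algebra_simps)
  have "dist (P \<xi>) (Q \<xi>) = norm ((1 - \<xi>) *\<^sub>R (b - d) + \<xi> *\<^sub>R (a - c))"
    unfolding dist_norm P_def Q_def by (simp add: algebra_simps)
  also have "\<dots> \<le> (1 - \<xi>) * norm (b - d) + \<xi> * norm (a - c)"
    using \<xi> norm_triangle_ineq[of "(1 - \<xi>) *\<^sub>R (b - d)" "\<xi> *\<^sub>R (a - c)"] by simp
  finally have "dist (P \<xi>) (Q \<xi>) powr \<alpha> \<le> ((1 - \<xi>) * norm (b - d) + \<xi> * norm (a - c)) powr \<alpha>"
    using \<alpha> by (intro powr_mono2) auto
  also have "\<dots> \<le> norm (a - c) powr \<alpha> + norm (b - d) powr \<alpha>"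
    using \<xi> \<alpha> by (intro add_powr_le_of_convex) auto
  finally have dPQ: "dist (P \<xi>) (Q \<xi>) powr \<alpha> \<le> norm (a - c) powr \<alpha> + norm (b - d) powr \<alpha>" (is "_ \<le> ?w") .
  have eq: "g a - g b - (g c - g d) = (\<Sum>k\<in>UNIV. D k (P \<xi>) * (a - b - (c - d)) $ k + (D k (P \<xi>) - D k (Q \<xi>)) * (c - d) $ k)"
  proof -
    have "g a - g b - (g c - g d) = psi 1 - psi 0"
      by (simp add: psi_def P_def Q_def)
    then show ?thesis
      unfolding \<xi>(3) psi'_def sum_subtractf[symmetric] by (auto simp: algebra_simps intro!: sum.cong)
  qed
  have "\<bar>g a - g b - (g c - g d)\<bar> \<le> (\<Sum>k\<in>UNIV. \<Lambda> k * norm (a - b - (c - d)) + H k * ?w * norm (c - d))"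
    unfolding eq
  proof (rule order_trans[OF sum_abs sum_mono])
    fix k
    have L0: "0 \<le> \<Lambda> k" using \<Lambda>[OF PS, of k] by linarith
    have "\<bar>D k (P \<xi>) - D k (Q \<xi>)\<bar> \<le> H k * ?w"
      using H[OF PS QS, of k] mult_left_mono[OF dPQ H0[of k]] by linarith
    then have "\<bar>D k (P \<xi>) - D k (Q \<xi>)\<bar> * \<bar>(c - d) $ k\<bar> \<le> (H k * ?w) * norm (c - d)"
      using H0 by (intro mult_mono component_le_norm_cart) auto
    moreover have "\<bar>D k (P \<xi>)\<bar> * \<bar>(a - b - (c - d)) $ k\<bar> \<le> \<Lambda> k * norm (a - b - (c - d))"
      using L0 \<Lambda>[OF PS] by (intro mult_mono component_le_norm_cart) auto
    ultimately show "\<bar>D k (P \<xi>) * (a - b - (c - d)) $ k + (D k (P \<xi>) - D k (Q \<xi>)) * (c - d) $ k\<bar>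
        \<le> \<Lambda> k * norm (a - b - (c - d)) + H k * ?w * norm (c - d)"
      by (intro order_trans[OF abs_triangle_ineq]) (simp add: abs_mult)
  qed
  also have "\<dots> = (\<Sum>k\<in>UNIV. \<Lambda> k) * norm (a - b - (c - d)) + (\<Sum>k\<in>UNIV. H k) * norm (c - d) * ?w"
    by (simp add: sum.distrib sum_distrib_left sum_distrib_right algebra_simps)
  finally show ?thesis .
qed

lemma norm_matrix_vector_mult_le_sum:
  fixes A :: "real ^ 'd ^ 'n"
  shows "norm (A *v h) \<le> (\<Sum>i\<in>UNIV. \<Sum>j\<in>UNIV. \<bar>A $ i $ j\<bar>) * norm h"
  using onorm[OF matrix_vector_mul_bounded_linear, of A h] onorm_le_matrix_component_sum[of A]
  by (meson mult_right_mono norm_ge_zero order_trans)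

text \<open>\<open>S\<close> is a closed ball for a given field and \<open>UNIV\<close> for a
  truncated one. Nonnegativity of the constants is demanded explicitly because a ball of negative
  radius is empty and would impose nothing on them.\<close>

definition lip_field ::
  "(real ^ 'n) set \<Rightarrow> (real ^ 'n \<Rightarrow> real ^ 'd ^ 'n) \<Rightarrow> real \<Rightarrow> real \<Rightarrow> bool" where
  "lip_field S f F \<Lambda> \<longleftrightarrow> 0 \<le> F \<and> 0 \<le> \<Lambda> \<and>
     (\<forall>a\<in>S. \<forall>h. norm (f a *v h) \<le> F * norm h) \<and>
     (\<forall>a\<in>S. \<forall>b\<in>S. \<forall>h. norm ((f a - f b) *v h) \<le> \<Lambda> * norm (a - b) * norm h)"

text \<open>Applied with \<open>a\<close>, \<open>c\<close> on one sequence and \<open>b\<close>,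
  \<open>d\<close> on the other: then \<open>a - b - (c - d)\<close> is the increment of the
  difference of the sequences, while \<open>a - c\<close> and \<open>b - d\<close> are increments of
  single sequences. With \<open>c = d = b\<close> it reduces to a Lipschitz bound with the constant
  \<open>\<Lambda>\<close>.\<close>

definition four_point_field ::
  "(real ^ 'n) set \<Rightarrow> (real ^ 'n \<Rightarrow> real ^ 'd ^ 'n) \<Rightarrow> real \<Rightarrow> real \<Rightarrow> real \<Rightarrow> bool" where
  "four_point_field S f \<alpha> \<Lambda> H \<longleftrightarrow> 0 \<le> \<Lambda> \<and> 0 \<le> H \<and>
     (\<forall>a\<in>S. \<forall>b\<in>S. \<forall>c\<in>S. \<forall>d\<in>S. \<forall>h. norm ((f a - f b - (f c - f d)) *v h) \<le>
        (\<Lambda> * norm (a - b - (c - d)) + H * norm (c - d) * (norm (a - c) powr \<alpha> + norm (b - d) powr \<alpha>))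
          * norm h)"

text \<open>The range \<open>0 < \<alpha>\<close>, \<open>\<alpha> \<le> 1\<close> forces
  \<open>N = 1\<close> in the splitting of \<open>\<gamma>\<close>; the end point
  \<open>\<gamma> = 2\<close> belongs to \<open>\<alpha> = 1\<close>.\<close>

lemma C_rho_D:
  assumes "1 < \<gamma>" "\<gamma> \<le> 2" "C_rho \<gamma> f"
  shows "Hoelder_derivs (Suc 0) (\<gamma> - 1) (\<lambda>z. f z $ i $ j)"
proof -
  obtain N \<alpha> where N: "0 < N" "0 < \<alpha>" "\<alpha> \<le> 1" "\<gamma> = real N + \<alpha>"
    "\<And>i j. Hoelder_derivs N \<alpha> (\<lambda>z. f z $ i $ j)"
    using assms(3) unfolding C_rho_def by auto
  have "N = Suc 0" using N(1,2,4) assms(2) by linarith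
  then show ?thesis using N by (metis add_diff_cancel_left' of_nat_1 One_nat_def)
qed

lemma C_rho_field_bounds:
  fixes f :: "real ^ 'n \<Rightarrow> real ^ 'd ^ 'n"
  assumes "1 < \<gamma>" "\<gamma> \<le> 2" "C_rho \<gamma> f"
  obtains F \<Lambda> H where "lip_field (cball 0 R) f F \<Lambda>" "four_point_field (cball 0 R) f (\<gamma> - 1) \<Lambda> H"
proof -
  let ?S = "cball (0::real^'n) R"
  have \<alpha>: "0 < \<gamma> - 1" using assms by simp
  define P where "P i j B L H \<longleftrightarrow> 0 \<le> B \<and> 0 \<le> L \<and> 0 \<le> H \<and> (\<forall>u\<in>?S. \<bar>f u $ i $ j\<bar> \<le> B) \<and>
     (\<forall>a\<in>?S. \<forall>b\<in>?S. \<forall>c\<in>?S. \<forall>d\<in>?S. \<bar>f a $ i $ j - f b $ i $ j - (f c $ i $ j - f d $ i $ j)\<bar> \<le>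
       L * norm (a - b - (c - d)) + H * norm (c - d) * (norm (a - c) powr (\<gamma> - 1) + norm (b - d) powr (\<gamma> - 1)))"
    for i j B L H
  have "\<exists>B L H. P i j B L H" for i j
  proof -
    let ?g = "\<lambda>z. f z $ i $ j"
    obtain D where g: "locally_Hoelder (\<gamma> - 1) ?g"
      and der: "\<And>z. (?g has_derivative (\<lambda>h. \<Sum>k\<in>UNIV. D k z * h $ k)) (at z)"
      and D: "\<And>k. locally_Hoelder (\<gamma> - 1) (D k)"
      using C_rho_D[OF assms, of i j] by auto
    define Q where "Q k B C \<longleftrightarrow> 0 \<le> C \<and> (\<forall>u\<in>?S. \<bar>D k u\<bar> \<le> B) \<and> (\<forall>u\<in>?S. \<forall>v\<in>?S. \<bar>D k u - D k v\<bar> \<le> C * dist u v powr (\<gamma> - 1))" for k B C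
    have "\<exists>B C. Q k B C" for k
      by (rule locally_Hoelder_compact[OF D[of k] compact_cball[of 0 R] \<alpha>]) (unfold Q_def, blast)
    then obtain B C where "\<And>k. Q k (B k) (C k)" by metis
    then have C0: "\<And>k. 0 \<le> C k" and B: "\<And>k u. u \<in> ?S \<Longrightarrow> \<bar>D k u\<bar> \<le> B k"
      and C: "\<And>k u v. u \<in> ?S \<Longrightarrow> v \<in> ?S \<Longrightarrow> \<bar>D k u - D k v\<bar> \<le> C k * dist u v powr (\<gamma> - 1)"
      unfolding Q_def by blast+
    obtain B0 where B0: "\<And>u. u \<in> ?S \<Longrightarrow> \<bar>?g u\<bar> \<le> B0"
      by (rule locally_Hoelder_compact[OF g compact_cball[of 0 R] \<alpha>]) blast
    have B': "\<bar>D k u\<bar> \<le> \<bar>B k\<bar>" if "u \<in> ?S" for k u using B[OF that, of k] by linarith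
    have B0': "\<bar>?g u\<bar> \<le> \<bar>B0\<bar>" if "u \<in> ?S" for u using B0[OF that] by linarith
    have fp: "\<bar>?g a - ?g b - (?g c - ?g d)\<bar> \<le> (\<Sum>k\<in>UNIV. \<bar>B k\<bar>) * norm (a - b - (c - d))
    + (\<Sum>k\<in>UNIV. C k) * norm (c - d) * (norm (a - c) powr (\<gamma> - 1) + norm (b - d) powr (\<gamma> - 1))"
      if "a \<in> ?S" "b \<in> ?S" "c \<in> ?S" "d \<in> ?S" for a b c d
      by (rule four_point_estimate[OF der convex_cball \<alpha> B' C C0 that])
    show ?thesis
      unfolding P_def
      by (intro exI[of _ "\<bar>B0\<bar>"] exI[of _ "\<Sum>k\<in>UNIV. \<bar>B k\<bar>"] exI[of _ "\<Sum>k\<in>UNIV. C k"] conjI ballI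
        abs_ge_zero sum_nonneg fp B0' C0)
  qed
  then obtain B L H where "\<And>i j. P i j (B i j) (L i j) (H i j)" by metis
  then have nn: "\<And>i j. 0 \<le> B i j" "\<And>i j. 0 \<le> L i j" "\<And>i j. 0 \<le> H i j"
    and B: "\<And>i j u. u \<in> ?S \<Longrightarrow> \<bar>f u $ i $ j\<bar> \<le> B i j"
    and fp: "\<And>i j a b c d. a \<in> ?S \<Longrightarrow> b \<in> ?S \<Longrightarrow> c \<in> ?S \<Longrightarrow> d \<in> ?S \<Longrightarrow>
       \<bar>f a $ i $ j - f b $ i $ j - (f c $ i $ j - f d $ i $ j)\<bar> \<le> L i j * norm (a - b - (c - d))
         + H i j * norm (c - d) * (norm (a - c) powr (\<gamma> - 1) + norm (b - d) powr (\<gamma> - 1))"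
    unfolding P_def by blast+
  define F where "F = (\<Sum>i\<in>UNIV. \<Sum>j\<in>UNIV. B i j)"
  define \<Lambda> where "\<Lambda> = (\<Sum>i\<in>UNIV. \<Sum>j\<in>UNIV. L i j)"
  define H' where "H' = (\<Sum>i\<in>UNIV. \<Sum>j\<in>UNIV. H i j)"
  have nn': "0 \<le> F" "0 \<le> \<Lambda>" "0 \<le> H'"
    unfolding F_def \<Lambda>_def H'_def by (auto intro!: sum_nonneg nn)
  have fF: "norm (f a *v h) \<le> F * norm h" if "a \<in> ?S" for a h
    unfolding F_def using B[OF that]
    by (intro order_trans[OF norm_matrix_vector_mult_le_sum] mult_right_mono sum_mono) auto
  have FP: "norm ((f a - f b - (f c - f d)) *v h) \<le>
        (\<Lambda> * norm (a - b - (c - d)) + H' * norm (c - d) * (norm (a - c) powr (\<gamma> - 1) + norm (b - d) powr (\<gamma> - 1)))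
          * norm h"
    if "a \<in> ?S" "b \<in> ?S" "c \<in> ?S" "d \<in> ?S" for a b c d h
  proof -
    have "(\<Sum>i\<in>UNIV. \<Sum>j\<in>UNIV. \<bar>(f a - f b - (f c - f d)) $ i $ j\<bar>) \<le>
      (\<Sum>i\<in>UNIV. \<Sum>j\<in>UNIV. L i j * norm (a - b - (c - d))
         + H i j * norm (c - d) * (norm (a - c) powr (\<gamma> - 1) + norm (b - d) powr (\<gamma> - 1)))"
      using fp[OF that] by (intro sum_mono) auto
    also have "\<dots> = (\<Lambda> * norm (a - b - (c - d)) + H' * norm (c - d) * (norm (a - c) powr (\<gamma> - 1) + norm (b - d) powr (\<gamma> - 1)))"
      unfolding \<Lambda>_def H'_def sum.distrib sum_distrib_right ..
    finally show ?thesis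
      by (intro order_trans[OF norm_matrix_vector_mult_le_sum] mult_right_mono) auto
  qed
  have "norm ((f a - f b) *v h) \<le> \<Lambda> * norm (a - b) * norm h" if "a \<in> ?S" "b \<in> ?S" for a b h
    using FP[of a b b b h] that by simp
  then have "lip_field ?S f F \<Lambda>"
    unfolding lip_field_def by (intro conjI ballI allI nn' fF)
  moreover have "four_point_field ?S f (\<gamma> - 1) \<Lambda> H'"
    unfolding four_point_field_def by (intro conjI ballI allI nn' FP)
  ultimately show thesis by (rule that)
qed

subsection \<open>Discrete sewing\<close>

text \<open>\<open>m\<close> is the last index up to which at most half of the control is spent, so
  what comes after \<open>Suc m\<close> is at most the other half. The step from \<open>m\<close> to
  \<open>Suc m\<close> belongs to neither piece, since a single step may carry nearly all of the
  control.\<close>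

lemma obtain_halving_index:
  fixes \<Omega> :: "nat \<Rightarrow> real"
  assumes "k < l" and mono: "\<And>i j. k \<le> i \<Longrightarrow> i \<le> j \<Longrightarrow> j \<le> l \<Longrightarrow> \<Omega> i \<le> \<Omega> j"
  obtains m where "k \<le> m" "m < l" "\<Omega> m - \<Omega> k \<le> (\<Omega> l - \<Omega> k) / 2" "\<Omega> l - \<Omega> (Suc m) \<le> (\<Omega> l - \<Omega> k) / 2"
proof -
  define P where "P m \<longleftrightarrow> k \<le> m \<and> m < l \<and> \<Omega> m - \<Omega> k \<le> (\<Omega> l - \<Omega> k) / 2" for m
  have Pk: "P k" using assms(1) mono[of k l] by (simp add: P_def)
  have bnd: "\<forall>m. P m \<longrightarrow> m \<le> l" by (auto simp: P_def)
  define m where "m = (GREATEST m. P m)"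
  have Pm: "P m" unfolding m_def by (rule GreatestI_nat[of P k l]) (use Pk bnd in auto)
  have "\<Omega> l - \<Omega> (Suc m) \<le> (\<Omega> l - \<Omega> k) / 2"
  proof (cases "Suc m = l")
    case True then show ?thesis using mono[of k l] assms(1) by simp
  next
    case False
    have "\<not> P (Suc m)"
    proof
      assume "P (Suc m)"
      then have "Suc m \<le> m" unfolding m_def by (rule Greatest_le_nat[of P _ l]) (use bnd in auto)
      then show False by simp
    qed
    then have "\<Omega> (Suc m) - \<Omega> k > (\<Omega> l - \<Omega> k) / 2" using Pm False by (auto simp: P_def)
    then show ?thesis by (simp add: field_simps)
  qed
  then show thesis using that Pm unfolding P_def by blast
qed

text \<open>Splitting at a halving index loses a factor \<open>2 powr (1 - \<beta>) < 1\<close> in the main term. The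
  coefficient \<open>1 + C * w powr \<mu>\<close> of the one-step errors is chosen so that its decay under halving
  absorbs the error terms produced by the perturbation \<open>lam * w powr \<mu> * norm (J k m)\<close>.\<close>

lemma discrete_sewing:
  fixes \<beta> \<mu> lam :: real
  assumes \<beta>: "1 < \<beta>" and \<mu>: "0 < \<mu>" and lam: "0 \<le> lam"
  obtains c L where "0 < c" "c \<le> 1" "0 \<le> L"
    "\<And>(J :: nat \<Rightarrow> nat \<Rightarrow> 'a::real_normed_vector) \<Omega> e D a b k l.
      \<lbrakk>0 \<le> D;
       \<And>k l. a \<le> k \<Longrightarrow> k \<le> l \<Longrightarrow> l \<le> b \<Longrightarrow> \<Omega> k \<le> \<Omega> l;
       \<And>k. J k k = 0;
       \<And>k. a \<le> k \<Longrightarrow> k < b \<Longrightarrow> norm (J k (Suc k)) \<le> e k;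
       \<And>k m l. a \<le> k \<Longrightarrow> k \<le> m \<Longrightarrow> m \<le> l \<Longrightarrow> l \<le> b \<Longrightarrow>
         norm (J k l - J k m - J m l) \<le> D * (\<Omega> l - \<Omega> k) powr \<beta> +
           (if \<Omega> l - \<Omega> k \<le> c then lam * (\<Omega> l - \<Omega> k) powr \<mu> * norm (J k m) else 0);
       a \<le> k; k \<le> l; l \<le> b\<rbrakk>
      \<Longrightarrow> norm (J k l) \<le> L * D * (\<Omega> l - \<Omega> k) powr \<beta> + 2 * sum e {k..<l}"
proof -
  define q where "q = 2 powr (1 - \<beta>)"
  define r where "r = 2 powr (- \<mu>)"
  have q: "0 < q" "q < 1" unfolding q_def using \<beta> by (auto intro: powr_less_one)
  have r: "0 < r" "r < 1" unfolding r_def using \<mu> by (auto intro: powr_less_one)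
  \<comment> \<open>Solves \<open>C * r + 2 * lam = C\<close>, with \<open>r\<close> the decay of
    \<open>w powr \<mu>\<close> under halving: one \<open>lam\<close> pays for the perturbation
    itself, the other for its product with the weight.\<close>
  define C where "C = 2 * lam / (1 - r)"
  have C0: "0 \<le> C" using lam r by (simp add: C_def)
  have Cr: "C * r + 2 * lam = C" using r by (simp add: C_def field_simps)
  have C2: "2 * lam \<le> C" using Cr C0 r by (smt (verit) mult_nonneg_nonneg)
  define \<kappa> where "\<kappa> = 1 - q"
  have \<kappa>: "0 < \<kappa>" using q by (simp add: \<kappa>_def)
  \<comment> \<open>A bound for \<open>w powr \<mu>\<close> on the perturbed range. The first entry
    gives \<open>C * c0 \<le> 1\<close>, which caps the weight at 2 and linearizes the product term;
    the second lets the perturbation use up at most half of the gain \<open>\<kappa>\<close> from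
    halving.\<close>
  define c0 where "c0 = min (1 / (C + 1)) (\<kappa> / (2 * (lam + 1)))"
  have c0: "0 < c0" using C0 \<kappa> lam by (simp add: c0_def)
  have "c0 \<le> 1 / (C + 1)" by (simp add: c0_def)
  also have "\<dots> \<le> 1" using C0 by simp
  finally have c01: "c0 \<le> 1" .
  have "C * c0 \<le> C * (1 / (C + 1))" using C0 by (intro mult_left_mono) (auto simp: c0_def)
  also have "\<dots> \<le> 1" using C0 by simp
  finally have Cc0: "C * c0 \<le> 1" .
  have "lam * c0 \<le> lam * (\<kappa> / (2 * (lam + 1)))" using lam by (intro mult_left_mono) (auto simp: c0_def)
  also have "\<dots> \<le> \<kappa> / 2" using lam \<kappa> by (simp add: field_simps)
  finally have lc0: "lam * c0 \<le> \<kappa> / 2" .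
  define c where "c = c0 powr (1 / \<mu>)"
  have c: "0 < c" "c \<le> 1" using c0 c01 \<mu> by (auto simp: c_def intro!: powr_le1)
  have cmu: "c powr \<mu> = c0" using c0 \<mu> by (simp add: c_def powr_powr)
  \<comment> \<open>Halving leaves the fraction \<open>q = 1 - \<kappa>\<close> of \<open>L\<close>,
    the perturbation takes back \<open>\<kappa> / 2\<close> of it, and the two splittings add
    \<open>2 * D\<close>; \<open>L = 4 / \<kappa>\<close> balances these.\<close>
  define L where "L = 4 / \<kappa>"
  have L0: "0 \<le> L" using \<kappa> by (simp add: L_def)
  have "L * \<kappa> = 4" using \<kappa> by (simp add: L_def)
  then have Lk: "L * q + L * (\<kappa> / 2) + 2 = L" by (simp add: \<kappa>_def field_simps)
  \<comment> \<open>The weight grows only up to \<open>c\<close>, beyond which no perturbation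
    occurs, and so stays at most 2. A constant weight would be multiplied by
    \<open>1 + lam * w powr \<mu>\<close> at each level of the recursion.\<close>
  define A where "A w = 1 + C * (min w c) powr \<mu>" for w
  have A_mono: "A v \<le> A w" if "0 \<le> v" "v \<le> w" for v w
    unfolding A_def using that C0 c \<mu> by (intro add_left_mono mult_left_mono powr_mono2) auto
  have A_1: "1 \<le> A w" for w unfolding A_def using C0 by simp
  have A_2: "A w \<le> 2" if "0 \<le> w" for w
  proof -
    have "C * (min w c) powr \<mu> \<le> C * c powr \<mu>" using that C0 c \<mu> by (intro mult_left_mono powr_mono2) auto
    then show ?thesis using Cc0 cmu by (simp add: A_def)
  qed
  have main: "norm (J k l) \<le> L * D * (\<Omega> l - \<Omega> k) powr \<beta> + A (\<Omega> l - \<Omega> k) * sum e {k..<l}"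
    if D: "0 \<le> D" and mono: "\<And>k l. a \<le> k \<Longrightarrow> k \<le> l \<Longrightarrow> l \<le> b \<Longrightarrow> \<Omega> k \<le> \<Omega> l"
      and J0: "\<And>k. J k k = 0"
      and J1: "\<And>k. a \<le> k \<Longrightarrow> k < b \<Longrightarrow> norm (J k (Suc k)) \<le> e k"
      and dJ: "\<And>k m l. a \<le> k \<Longrightarrow> k \<le> m \<Longrightarrow> m \<le> l \<Longrightarrow> l \<le> b \<Longrightarrow>
         norm (J k l - J k m - J m l) \<le> D * (\<Omega> l - \<Omega> k) powr \<beta> +
           (if \<Omega> l - \<Omega> k \<le> c then lam * (\<Omega> l - \<Omega> k) powr \<mu> * norm (J k m) else 0)"
      and kl: "a \<le> k" "k \<le> l" "l \<le> b"
    for J :: "nat \<Rightarrow> nat \<Rightarrow> 'a" and \<Omega> e D a b k l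
    using kl
  proof (induction "l - k" arbitrary: k l rule: less_induct)
    case less
    note kl = less.prems
    have e0: "0 \<le> e i" if "a \<le> i" "i < b" for i using J1[OF that] norm_ge_zero order_trans by blast
    show ?case
    proof (cases "k = l")
      case True then show ?thesis using J0 by simp
    next
      case False
      then have "k < l" using kl by simp
      then obtain m where m: "k \<le> m" "m < l" "\<Omega> m - \<Omega> k \<le> (\<Omega> l - \<Omega> k) / 2" "\<Omega> l - \<Omega> (Suc m) \<le> (\<Omega> l - \<Omega> k) / 2"
        by (rule obtain_halving_index[where \<Omega> = \<Omega>]) (use mono kl in auto)
      define w where "w = \<Omega> l - \<Omega> k"
      define w1 where "w1 = \<Omega> m - \<Omega> k"
      define w2 where "w2 = \<Omega> l - \<Omega> (Suc m)"
      define w3 where "w3 = \<Omega> l - \<Omega> m"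
      have w: "0 \<le> w" "0 \<le> w1" "0 \<le> w2" "0 \<le> w3" "w1 \<le> w / 2" "w2 \<le> w / 2" "w3 \<le> w" "w1 \<le> w" "w2 \<le> w"
        using mono[of k l] mono[of k m] mono[of "Suc m" l] mono[of m l] m kl
        unfolding w_def w1_def w2_def w3_def by auto
      define E1 where "E1 = sum e {k..<m}"
      define E2 where "E2 = sum e {Suc m..<l}"
      have E0: "0 \<le> E1" "0 \<le> E2" unfolding E1_def E2_def
        using kl m by (auto intro!: sum_nonneg e0)
      have em0: "0 \<le> e m" using e0[of m] kl m by auto
      have Esum: "sum e {k..<l} = E1 + (e m + E2)"
      proof -
        have "sum e {k..<l} = sum e {k..<m} + sum e {m..<l}"
          using m by (simp add: sum.atLeastLessThan_concat)
        then show ?thesis using m by (simp add: E1_def E2_def sum.atLeast_Suc_lessThan)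
      qed
      define n1 where "n1 = norm (J k m)"
      define n2 where "n2 = norm (J (Suc m) l)"
      have half: "v powr \<beta> \<le> q / 2 * w powr \<beta>" if "0 \<le> v" "v \<le> w / 2" for v
      proof -
        have "v powr \<beta> \<le> (w / 2) powr \<beta>" using that \<beta> by (intro powr_mono2) auto
        also have "\<dots> = q / 2 * w powr \<beta>"
          using w by (simp add: q_def powr_divide powr_diff)
        finally show ?thesis .
      qed
      have LD: "0 \<le> L * D" using L0 D by simp
      have h1: "L * D * w1 powr \<beta> \<le> L * D * (q / 2 * w powr \<beta>)" using half[of w1] w LD by (intro mult_left_mono) auto
      have h2: "L * D * w2 powr \<beta> \<le> L * D * (q / 2 * w powr \<beta>)" using half[of w2] w LD by (intro mult_left_mono) auto
      have n1: "n1 \<le> L * D * (q / 2 * w powr \<beta>) + A w1 * E1"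
        using less.hyps[of m k] kl m h1 unfolding n1_def w1_def E1_def by force
      have n2: "n2 \<le> L * D * (q / 2 * w powr \<beta>) + A w2 * E2"
        using less.hyps[of l "Suc m"] kl m h2 unfolding n2_def w2_def E2_def by force
      have nm: "norm (J m (Suc m)) \<le> e m" using J1[of m] kl m by simp
      have A2: "A w2 * E2 \<le> A w * E2" using A_mono[of w2 w] w E0 by (intro mult_right_mono) auto
      \<comment> \<open>The interval is split at \<open>m\<close> and its right part again at
        \<open>Suc m\<close>; \<open>d1\<close> and \<open>d2\<close> are the two failures of
        additivity.\<close>
      define d1 where "d1 = norm (J k l - J k m - J m l)"
      define d2 where "d2 = norm (J m l - J m (Suc m) - J (Suc m) l)"
      have tri: "norm (J k l) \<le> n1 + norm (J m (Suc m)) + n2 + d1 + d2"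
      proof -
        have "J k l = J k m + J m (Suc m) + J (Suc m) l + (J k l - J k m - J m l) + (J m l - J m (Suc m) - J (Suc m) l)"
          by simp
        then show ?thesis unfolding n1_def n2_def d1_def d2_def
          by (smt (verit) norm_triangle_ineq)
      qed
      \<comment> \<open>In the second splitting the perturbation multiplies a one-step defect, so it
        is charged to the coefficient of \<open>e m\<close>.\<close>
      have d2: "d2 \<le> D * w powr \<beta> + lam * (min w c) powr \<mu> * e m"
      proof -
        have "d2 \<le> D * w3 powr \<beta> + (if w3 \<le> c then lam * w3 powr \<mu> * norm (J m (Suc m)) else 0)"
          using dJ[of m "Suc m" l] kl m unfolding d2_def w3_def by simp
        moreover have "D * w3 powr \<beta> \<le> D * w powr \<beta>" using w D \<beta> by (intro mult_left_mono powr_mono2) auto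
        moreover have "(if w3 \<le> c then lam * w3 powr \<mu> * norm (J m (Suc m)) else 0) \<le> lam * (min w c) powr \<mu> * e m"
        proof (cases "w3 \<le> c")
          case True
          have "lam * w3 powr \<mu> * norm (J m (Suc m)) \<le> lam * (min w c) powr \<mu> * e m"
            using True w lam \<mu> nm by (intro mult_mono mult_left_mono powr_mono2 mult_nonneg_nonneg) auto
          then show ?thesis using True by simp
        next
          case False then show ?thesis using lam em0 by simp
        qed
        ultimately show ?thesis by linarith
      qed
      have em: "e m + lam * (min w c) powr \<mu> * e m \<le> A w * e m"
      proof -
        have "lam * (min w c) powr \<mu> \<le> C * (min w c) powr \<mu>" using C2 lam by (intro mult_right_mono) auto
        then have "(1 + lam * (min w c) powr \<mu>) * e m \<le> A w * e m"
          unfolding A_def using em0 by (intro mult_right_mono) auto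
        then show ?thesis by (simp add: algebra_simps)
      qed
      \<comment> \<open>Here the perturbation multiplies the defect of a whole piece, bounded by
        induction, so it enlarges both the main term and the error sum of that piece. The weight
        absorbs the latter since \<open>w1 \<le> w / 2\<close>.\<close>
      have dn: "n1 + d1 \<le> L * D * (q / 2 * w powr \<beta>) + D * w powr \<beta> + \<kappa> / 2 * (L * D * w powr \<beta>) + A w * E1"
      proof (cases "w \<le> c")
        case True
        define M where "M = w powr \<mu>"
        have M: "0 \<le> M" "M \<le> c0" unfolding M_def using True w \<mu> by (auto simp: cmu[symmetric] intro!: powr_mono2)
        have d1: "d1 \<le> D * w powr \<beta> + lam * M * n1"
          using dJ[of k m l] kl m True unfolding d1_def n1_def M_def w_def by simp
        have "A w1 \<le> 1 + C * r * M"
        proof -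
          have "w1 powr \<mu> \<le> (w / 2) powr \<mu>" using w \<mu> by (intro powr_mono2) auto
          also have "\<dots> = r * M" using w by (simp add: r_def M_def powr_divide powr_minus divide_simps)
          finally have "C * w1 powr \<mu> \<le> C * (r * M)" using C0 by (rule mult_left_mono)
          moreover have "min w1 c = w1" using w True by simp
          ultimately show ?thesis by (simp add: A_def mult.assoc)
        qed
        then have "A w1 * (1 + lam * M) \<le> (1 + C * r * M) * (1 + lam * M)"
          using lam M by (intro mult_right_mono) auto
        also have "\<dots> = 1 + C * r * M + lam * M + (C * M) * (r * (lam * M))" by (simp add: algebra_simps)
        also have "(C * M) * (r * (lam * M)) \<le> 1 * (1 * (lam * M))"
        proof (intro mult_mono)
          show "C * M \<le> 1" using mult_left_mono[OF M(2) C0] Cc0 by linarith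
        qed (use r lam M in auto)
        finally have "A w1 * (1 + lam * M) \<le> 1 + (C * r + 2 * lam) * M" by (simp add: algebra_simps)
        also have "\<dots> = A w" using True unfolding Cr A_def M_def by simp
        finally have "(A w1 * (1 + lam * M)) * E1 \<le> A w * E1" using E0 by (intro mult_right_mono)
        then have AE: "A w1 * E1 + lam * M * (A w1 * E1) \<le> A w * E1" by (simp add: algebra_simps)
        have lM: "lam * M \<le> \<kappa> / 2" using mult_left_mono[OF M(2) lam] lc0 by linarith
        have X: "L * D * (q / 2 * w powr \<beta>) \<le> L * D * w powr \<beta>"
          using LD q by (intro mult_left_mono mult_left_le_one_le) auto
        have "lam * M * n1 \<le> lam * M * (L * D * (q / 2 * w powr \<beta>)) + lam * M * (A w1 * E1)"
          using mult_left_mono[OF n1, of "lam * M"] lam M by (simp add: algebra_simps)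
        also have "lam * M * (L * D * (q / 2 * w powr \<beta>)) \<le> \<kappa> / 2 * (L * D * w powr \<beta>)"
          using L0 D q \<kappa> by (intro mult_mono[OF lM X]) auto
        finally show ?thesis using n1 d1 AE by linarith
      next
        case False
        have d1: "d1 \<le> D * w powr \<beta>"
          using dJ[of k m l] kl m False unfolding d1_def w_def by simp
        have "A w1 * E1 \<le> A w * E1" using A_mono[of w1 w] w E0 by (intro mult_right_mono) auto
        moreover have "0 \<le> \<kappa> / 2 * (L * D * w powr \<beta>)" using \<kappa> LD by simp
        ultimately show ?thesis using n1 d1 by linarith
      qed
      have "norm (J k l) \<le> (L * q + L * (\<kappa> / 2) + 2) * D * w powr \<beta> + A w * (E1 + (e m + E2))"
        using tri n2 nm A2 d2 em dn by (simp add: algebra_simps)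
      then show ?thesis unfolding Lk Esum w_def .
    qed
  qed
  show thesis
  proof (rule that[OF c L0])
    fix J :: "nat \<Rightarrow> nat \<Rightarrow> 'a" and \<Omega> e D a b k l
    assume D: "0 \<le> (D::real)" and mono: "\<And>k l. a \<le> k \<Longrightarrow> k \<le> l \<Longrightarrow> l \<le> b \<Longrightarrow> \<Omega> k \<le> (\<Omega> l :: real)"
      and J0: "\<And>k. J k k = 0"
      and J1: "\<And>k. a \<le> k \<Longrightarrow> k < b \<Longrightarrow> norm (J k (Suc k)) \<le> e k"
      and dJ: "\<And>k m l. a \<le> k \<Longrightarrow> k \<le> m \<Longrightarrow> m \<le> l \<Longrightarrow> l \<le> b \<Longrightarrow>
         norm (J k l - J k m - J m l) \<le> D * (\<Omega> l - \<Omega> k) powr \<beta> +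
           (if \<Omega> l - \<Omega> k \<le> c then lam * (\<Omega> l - \<Omega> k) powr \<mu> * norm (J k m) else 0)"
      and kl: "a \<le> k" "k \<le> l" "l \<le> b"
    have E0: "0 \<le> sum e {k..<l}"
    proof (rule sum_nonneg)
      fix i assume "i \<in> {k..<l}"
      then have "norm (J i (Suc i)) \<le> e i" using J1 kl by auto
      then show "0 \<le> e i" using norm_ge_zero order_trans by blast
    qed
    have "A (\<Omega> l - \<Omega> k) * sum e {k..<l} \<le> 2 * sum e {k..<l}"
      using A_2[of "\<Omega> l - \<Omega> k"] mono kl E0 by (intro mult_right_mono) auto
    with main[of D a b \<Omega> J e k l, OF D mono J0 J1 dJ kl]
    show "norm (J k l) \<le> L * D * (\<Omega> l - \<Omega> k) powr \<beta> + 2 * sum e {k..<l}" by linarith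
  qed
qed

subsection \<open>Defect and stability of discrete schemes\<close>

text \<open>The index type is left open, so that the same remainder serves for paths indexed by time
  and for schemes indexed by grid points.\<close>

definition defect ::
  "(real ^ 'n \<Rightarrow> real ^ 'd ^ 'n) \<Rightarrow> ('i \<Rightarrow> real ^ 'd) \<Rightarrow> ('i \<Rightarrow> real ^ 'n) \<Rightarrow> 'i \<Rightarrow> 'i \<Rightarrow> real ^ 'n" where
  "defect f X y s t = y t - y s - f (y s) *v (X t - X s)"

lemma defect_diff:
  "defect f X y s t - defect f X y s r - defect f X y r t = (f (y r) - f (y s)) *v (X t - X r)"
  by (simp add: defect_def algebra_simps matrix_vector_mult_diff_distrib matrix_vector_mult_diff_rdistrib)

lemma defect_self [simp]: "defect f X y s s = 0"
  by (simp add: defect_def)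

definition controlled :: "real \<Rightarrow> nat \<Rightarrow> (nat \<Rightarrow> real) \<Rightarrow> (nat \<Rightarrow> 'a::real_normed_vector) \<Rightarrow> bool" where
  "controlled p K \<Omega> X \<longleftrightarrow> (\<forall>k l. k \<le> l \<and> l \<le> K \<longrightarrow>
     \<Omega> k \<le> \<Omega> l \<and> norm (X l - X k) \<le> (\<Omega> l - \<Omega> k) powr (1 / p))"

lemma controlledD:
  assumes "controlled p K \<Omega> X" "k \<le> l" "l \<le> K"
  shows "\<Omega> k \<le> \<Omega> l" "norm (X l - X k) \<le> (\<Omega> l - \<Omega> k) powr (1 / p)"
  using assms unfolding controlled_def by auto

text \<open>The increment of \<open>y\<close> is the defect plus
  \<open>f (y k) *v (X m - X k)\<close>, so the Lipschitz bound estimates the failure of additivity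
  by \<open>\<Lambda> * F * w powr (2 / p)\<close> plus the perturbation with
  \<open>\<mu> = 1 / p\<close> that sewing tolerates. For \<open>w > c\<close> it tolerates none;
  there the boundedness of \<open>f\<close> gives the order \<open>w powr (1 / p)\<close>, which is
  at most \<open>c powr (- (1 / p)) * w powr (2 / p)\<close>.\<close>

lemma discrete_defect_bound:
  fixes f :: "real ^ 'n \<Rightarrow> real ^ 'd ^ 'n"
  assumes p: "1 \<le> p" "p < 2" and f: "lip_field S f F \<Lambda>"
  obtains L where "0 \<le> L"
    "\<And>K y X \<Omega> e k l. \<lbrakk>controlled p K \<Omega> X; \<And>k. k \<le> K \<Longrightarrow> y k \<in> S;
        \<And>k. k < K \<Longrightarrow> norm (defect f X y k (Suc k)) \<le> e k; k \<le> l; l \<le> K\<rbrakk>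
      \<Longrightarrow> norm (defect f X y k l) \<le> L * (\<Omega> l - \<Omega> k) powr (2 / p) + 2 * sum e {k..<l}"
proof -
  have F: "0 \<le> F" "\<And>a h. a \<in> S \<Longrightarrow> norm (f a *v h) \<le> F * norm h"
    and \<Lambda>: "0 \<le> \<Lambda>" "\<And>a b h. a \<in> S \<Longrightarrow> b \<in> S \<Longrightarrow> norm ((f a - f b) *v h) \<le> \<Lambda> * norm (a - b) * norm h"
    using f unfolding lip_field_def by auto
  have ex: "1 < 2 / p" "0 < 1 / p" using p by auto
  obtain c L where c: "0 < c" "0 \<le> L"
    and sew: "\<And>(J :: nat \<Rightarrow> nat \<Rightarrow> real ^ 'n) \<Omega> e D a b k l.
      \<lbrakk>0 \<le> D;
       \<And>k l. a \<le> k \<Longrightarrow> k \<le> l \<Longrightarrow> l \<le> b \<Longrightarrow> \<Omega> k \<le> \<Omega> l;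
       \<And>k. J k k = 0;
       \<And>k. a \<le> k \<Longrightarrow> k < b \<Longrightarrow> norm (J k (Suc k)) \<le> e k;
       \<And>k m l. a \<le> k \<Longrightarrow> k \<le> m \<Longrightarrow> m \<le> l \<Longrightarrow> l \<le> b \<Longrightarrow>
         norm (J k l - J k m - J m l) \<le> D * (\<Omega> l - \<Omega> k) powr (2 / p) +
           (if \<Omega> l - \<Omega> k \<le> c then \<Lambda> * (\<Omega> l - \<Omega> k) powr (1 / p) * norm (J k m) else 0);
       a \<le> k; k \<le> l; l \<le> b\<rbrakk>
      \<Longrightarrow> norm (J k l) \<le> L * D * (\<Omega> l - \<Omega> k) powr (2 / p) + 2 * sum e {k..<l}"
    by (rule discrete_sewing[OF ex \<Lambda>(1), where 'a = "real ^ 'n"]) blast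
  define D where "D = \<Lambda> * F + 2 * F * c powr (- (1 / p))"
  have D0: "0 \<le> D" using F \<Lambda> by (simp add: D_def)
  show thesis
  proof (rule that[of "L * D"])
    show "0 \<le> L * D" using c D0 by simp
    fix K y X \<Omega> e k l
    assume ctl: "controlled p K \<Omega> X" and y: "\<And>k. k \<le> K \<Longrightarrow> y k \<in> S"
      and e: "\<And>k. k < K \<Longrightarrow> norm (defect f X y k (Suc k)) \<le> e k"
      and kl: "k \<le> l" "l \<le> K"
    show "norm (defect f X y k l) \<le> L * D * (\<Omega> l - \<Omega> k) powr (2 / p) + 2 * sum e {k..<l}"
    proof (rule sew[OF D0, where a=0 and b=K and J="defect f X y"])
      fix k m l assume kml: "k \<le> m" "m \<le> l" "l \<le> K"
      define w where "w = \<Omega> l - \<Omega> k"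
      have mono: "\<Omega> k \<le> \<Omega> m" "\<Omega> m \<le> \<Omega> l" using controlledD(1)[OF ctl] kml by auto
      have w0: "0 \<le> w" using mono by (simp add: w_def)
      have Xkm: "norm (X m - X k) \<le> w powr (1 / p)"
        using controlledD(2)[OF ctl, of k m] powr_mono2[of "1 / p" "\<Omega> m - \<Omega> k" w] kml mono p by (simp add: w_def)
      have Xml: "norm (X l - X m) \<le> w powr (1 / p)"
        using controlledD(2)[OF ctl, of m l] powr_mono2[of "1 / p" "\<Omega> l - \<Omega> m" w] kml mono p by (simp add: w_def)
      have yk: "y k \<in> S" "y m \<in> S" using y kml by auto
      have ww: "w powr (1 / p) * w powr (1 / p) = w powr (2 / p)" by (simp flip: powr_add)
      have "norm (defect f X y k l - defect f X y k m - defect f X y m l) \<le> D * w powr (2 / p) +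
           (if w \<le> c then \<Lambda> * w powr (1 / p) * norm (defect f X y k m) else 0)"
      proof (cases "w \<le> c")
        case True
        have "y m - y k = defect f X y k m + f (y k) *v (X m - X k)" by (simp add: defect_def)
        then have "norm (y m - y k) \<le> norm (defect f X y k m) + norm (f (y k) *v (X m - X k))"
          using norm_triangle_ineq by metis
        also have "norm (f (y k) *v (X m - X k)) \<le> F * w powr (1 / p)"
          using F(2)[OF yk(1), of "X m - X k"] mult_left_mono[OF Xkm F(1)] by linarith
        finally have ym: "norm (y m - y k) \<le> norm (defect f X y k m) + F * w powr (1 / p)" by simp
        have "norm ((f (y m) - f (y k)) *v (X l - X m)) \<le> \<Lambda> * norm (y m - y k) * norm (X l - X m)"
          using \<Lambda>(2) yk by auto
        also have "\<dots> \<le> \<Lambda> * (norm (defect f X y k m) + F * w powr (1 / p)) * w powr (1 / p)"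
          using \<Lambda>(1) F(1) by (intro mult_mono mult_left_mono ym Xml) auto
        also have "\<dots> = \<Lambda> * F * (w powr (1 / p) * w powr (1 / p)) + \<Lambda> * w powr (1 / p) * norm (defect f X y k m)"
          by (simp add: algebra_simps)
        also have "\<dots> \<le> D * w powr (2 / p) + \<Lambda> * w powr (1 / p) * norm (defect f X y k m)"
          unfolding ww using F(1) by (intro add_right_mono mult_right_mono) (auto simp: D_def)
        finally show ?thesis using True by (simp add: defect_diff)
      next
        case False
        then have w: "c < w" by simp
        have "norm ((f (y m) - f (y k)) *v (X l - X m)) \<le> norm (f (y m) *v (X l - X m)) + norm (f (y k) *v (X l - X m))"
          by (simp add: matrix_vector_mult_diff_rdistrib norm_triangle_ineq4)
        also have "\<dots> \<le> 2 * F * norm (X l - X m)"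
          using F(2)[OF yk(1), of "X l - X m"] F(2)[OF yk(2), of "X l - X m"] by simp
        also have "\<dots> \<le> 2 * F * w powr (1 / p)" using F(1) Xml by (intro mult_left_mono) auto
        also have "w powr (1 / p) = w powr (- (1 / p)) * w powr (2 / p)"
          by (simp flip: powr_add)
        also have "\<dots> \<le> c powr (- (1 / p)) * w powr (2 / p)"
          using w c p by (intro mult_right_mono powr_mono2') auto
        finally have "norm ((f (y m) - f (y k)) *v (X l - X m)) \<le> 2 * F * (c powr (- (1 / p)) * w powr (2 / p))"
          using F(1) by (simp add: mult_left_mono)
        also have "\<dots> \<le> D * w powr (2 / p)"
          using \<Lambda>(1) F(1) by (simp add: D_def algebra_simps)
        finally show ?thesis using False by (simp add: defect_diff)
      qed
      then show "norm (defect f X y k l - defect f X y k m - defect f X y m l) \<le> D * (\<Omega> l - \<Omega> k) powr (2 / p) +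
           (if \<Omega> l - \<Omega> k \<le> c then \<Lambda> * (\<Omega> l - \<Omega> k) powr (1 / p) * norm (defect f X y k m) else 0)"
        unfolding w_def .
    qed (use controlledD(1)[OF ctl] e kl in auto)
  qed
qed

text \<open>A defect of order \<open>2 / p\<close> is traded for the order \<open>1 / p\<close> of
  the increments of \<open>X\<close> at the cost of a factor \<open>W powr (1 / p)\<close>.\<close>

lemma increment_le_of_defect:
  assumes f: "lip_field S f F \<Lambda>" and y: "y s \<in> S" and p: "0 < p" and L: "0 \<le> L"
    and def: "norm (defect f X y s t) \<le> L * w powr (2 / p)"
    and X: "norm (X t - X s) \<le> w powr (1 / p)" and w: "0 \<le> w" "w \<le> W"
  shows "norm (y t - y s) \<le> (F + L * W powr (1 / p)) * w powr (1 / p)"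
proof -
  have F: "0 \<le> F" "norm (f (y s) *v (X t - X s)) \<le> F * norm (X t - X s)"
    using f y unfolding lip_field_def by auto
  have "y t - y s = defect f X y s t + f (y s) *v (X t - X s)" by (simp add: defect_def)
  then have "norm (y t - y s) \<le> norm (defect f X y s t) + norm (f (y s) *v (X t - X s))"
    using norm_triangle_ineq by metis
  also have "norm (f (y s) *v (X t - X s)) \<le> F * w powr (1 / p)"
    using F(2) mult_left_mono[OF X F(1)] by linarith
  also have "w powr (2 / p) = w powr (1 / p) * w powr (1 / p)" by (simp flip: powr_add)
  then have "L * w powr (2 / p) \<le> L * (W powr (1 / p) * w powr (1 / p))"
    using L w p by (auto intro!: mult_left_mono mult_right_mono powr_mono2)
  with def have "norm (defect f X y s t) \<le> L * (W powr (1 / p) * w powr (1 / p))" by linarith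
  finally show ?thesis by (simp add: algebra_simps)
qed

text \<open>A discrete Gronwall argument over blocks of control instead of time. The longest initial
  piece that spends at most \<open>j * c\<close> is followed by one overshooting step and a
  remainder, together at most \<open>2 * c\<close>, which is why \<open>loc\<close> reaches up to
  \<open>2 * c\<close>. The factor solves the recursion
  \<open>a (j + 1) = 2 * a j + 1\<close>.\<close>

lemma chain_bound:
  fixes z \<Omega> :: "nat \<Rightarrow> real"
  assumes mono: "\<And>k l. k \<le> l \<Longrightarrow> l \<le> K \<Longrightarrow> \<Omega> k \<le> \<Omega> l"
    and step: "\<And>k. k < K \<Longrightarrow> \<Omega> (Suc k) - \<Omega> k \<le> c"
    and loc: "\<And>a b. a \<le> b \<Longrightarrow> b \<le> K \<Longrightarrow> \<Omega> b - \<Omega> a \<le> 2 * c \<Longrightarrow> z b \<le> 2 * z a + E"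
    and c: "0 < c" and z0: "z 0 = 0" and E: "0 \<le> E"
    and k: "k \<le> K" "\<Omega> k - \<Omega> 0 \<le> real j * c"
  shows "z k \<le> (2 ^ Suc j - 1) * E"
  using k
proof (induction j arbitrary: k)
  case 0
  then show ?case using loc[of 0 k] z0 c by simp
next
  case (Suc j)
  define P where "P a \<longleftrightarrow> a \<le> k \<and> \<Omega> a - \<Omega> 0 \<le> real j * c" for a
  have P0: "P 0" using c by (simp add: P_def)
  have bnd: "\<forall>a. P a \<longrightarrow> a \<le> k" by (auto simp: P_def)
  define a where "a = (GREATEST a. P a)"
  have Pa: "P a" unfolding a_def by (rule GreatestI_nat[of P 0 k]) (use P0 bnd in auto)
  have za: "z a \<le> (2 ^ Suc j - 1) * E" using Suc.IH[of a] Pa Suc.prems by (auto simp: P_def)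
  have "\<Omega> k - \<Omega> a \<le> 2 * c"
  proof (cases "a = k")
    case False
    have "\<not> P (Suc a)"
    proof
      assume "P (Suc a)"
      then have "Suc a \<le> a" unfolding a_def by (rule Greatest_le_nat[of P _ k]) (use bnd in auto)
      then show False by simp
    qed
    then have "\<Omega> (Suc a) - \<Omega> 0 > real j * c" using Pa False by (auto simp: P_def)
    moreover have "\<Omega> (Suc a) - \<Omega> a \<le> c" using step[of a] Pa False Suc.prems by (auto simp: P_def)
    ultimately show ?thesis using Suc.prems by (simp add: algebra_simps)
  qed (use c in auto)
  then have "z k \<le> 2 * z a + E" using loc[of a k] Pa Suc.prems by (auto simp: P_def)
  also have "\<dots> \<le> 2 * ((2 ^ Suc j - 1) * E) + E" using za by simp
  also have "\<dots> = (2 ^ Suc (Suc j) - 1) * E" by (simp add: algebra_simps)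
  finally show ?case .
qed

text \<open>The increment of \<open>f (y k) - f (y' k)\<close> is controlled by the distance of the two sequences times
  \<open>w powr ((\<gamma> - 1) / p)\<close>, which leaves the exponent \<open>\<gamma> / p > 1\<close> needed for sewing.\<close>

lemma discrete_stability:
  fixes f :: "real ^ 'n \<Rightarrow> real ^ 'd ^ 'n"
  assumes p: "1 \<le> p" "p < \<gamma>" "\<gamma> \<le> 2" and f: "four_point_field S f (\<gamma> - 1) \<Lambda> H"
    and B: "0 \<le> B" and W: "0 \<le> W"
  obtains c C where "0 < c" "0 \<le> C"
    "\<And>K y y' X \<Omega> e k. \<lbrakk>controlled p K \<Omega> X; \<Omega> K - \<Omega> 0 \<le> W;
        \<And>k. k \<le> K \<Longrightarrow> y k \<in> S; \<And>k. k \<le> K \<Longrightarrow> y' k \<in> S;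
        \<And>k l. k \<le> l \<Longrightarrow> l \<le> K \<Longrightarrow> norm (y l - y k) \<le> B * (\<Omega> l - \<Omega> k) powr (1 / p);
        \<And>k l. k \<le> l \<Longrightarrow> l \<le> K \<Longrightarrow> norm (y' l - y' k) \<le> B * (\<Omega> l - \<Omega> k) powr (1 / p);
        \<And>k. k < K \<Longrightarrow> \<Omega> (Suc k) - \<Omega> k \<le> c;
        \<And>k. k < K \<Longrightarrow> norm (defect f X y k (Suc k)) + norm (defect f X y' k (Suc k)) \<le> e k;
        y 0 = y' 0; k \<le> K\<rbrakk>
      \<Longrightarrow> norm (y k - y' k) \<le> C * sum e {..<K}"
proof -
  have \<Lambda>: "0 \<le> \<Lambda>" and H: "0 \<le> H"
    and fp: "\<And>a b c d h. a \<in> S \<Longrightarrow> b \<in> S \<Longrightarrow> c \<in> S \<Longrightarrow> d \<in> S \<Longrightarrow> norm ((f a - f b - (f c - f d)) *v h) \<le>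
        (\<Lambda> * norm (a - b - (c - d)) + H * norm (c - d) * (norm (a - c) powr (\<gamma> - 1) + norm (b - d) powr (\<gamma> - 1)))
          * norm h"
    using f unfolding four_point_field_def by auto
  have lip: "norm ((f a - f b) *v h) \<le> \<Lambda> * norm (a - b) * norm h" if "a \<in> S" "b \<in> S" for a b h
    using fp[of a b b b h] that by simp
  have ex: "1 < \<gamma> / p" "0 < 1 / p" using p by auto
  obtain c1 L where c1: "0 < c1" "c1 \<le> 1" and L: "0 \<le> L"
    and sew: "\<And>(J :: nat \<Rightarrow> nat \<Rightarrow> real ^ 'n) \<Omega> e D a b k l.
      \<lbrakk>0 \<le> D;
       \<And>k l. a \<le> k \<Longrightarrow> k \<le> l \<Longrightarrow> l \<le> b \<Longrightarrow> \<Omega> k \<le> \<Omega> l;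
       \<And>k. J k k = 0;
       \<And>k. a \<le> k \<Longrightarrow> k < b \<Longrightarrow> norm (J k (Suc k)) \<le> e k;
       \<And>k m l. a \<le> k \<Longrightarrow> k \<le> m \<Longrightarrow> m \<le> l \<Longrightarrow> l \<le> b \<Longrightarrow>
         norm (J k l - J k m - J m l) \<le> D * (\<Omega> l - \<Omega> k) powr (\<gamma> / p) +
           (if \<Omega> l - \<Omega> k \<le> c1 then \<Lambda> * (\<Omega> l - \<Omega> k) powr (1 / p) * norm (J k m) else 0);
       a \<le> k; k \<le> l; l \<le> b\<rbrakk>
      \<Longrightarrow> norm (J k l) \<le> L * D * (\<Omega> l - \<Omega> k) powr (\<gamma> / p) + 2 * sum e {k..<l}"
    by (rule discrete_sewing[OF ex \<Lambda>, where 'a = "real ^ 'n"]) blast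
  \<comment> \<open>The first summand comes from the part
    \<open>\<Lambda> * M * w powr (1 / p)\<close> of the increment of the difference, the second
    from the Hoelder terms, with two increments of size \<open>B * w powr (1 / p)\<close>.\<close>
  define D where "D = \<Lambda> * \<Lambda> + 2 * H * B powr (\<gamma> - 1)"
  have D0: "0 \<le> D" using \<Lambda> H by (simp add: D_def)
  define G where "G = \<Lambda> + L * D"
  have G0: "0 \<le> G" using \<Lambda> L D0 by (simp add: G_def)
  \<comment> \<open>\<open>G\<close> collects the coefficients of \<open>M * w powr (1 / p)\<close>;
    \<open>c2\<close> makes \<open>G * c2 powr (1 / p)\<close> at most 1/2, so that half of
    \<open>M\<close> can be absorbed.\<close>
  define c2 where "c2 = min c1 ((1 / (2 * (G + 1))) powr p)"
  have c2: "0 < c2" "c2 \<le> c1" using c1 G0 by (auto simp: c2_def)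
  have "c2 powr (1 / p) \<le> ((1 / (2 * (G + 1))) powr p) powr (1 / p)"
    using c2 p by (intro powr_mono2) (auto simp: c2_def)
  also have "\<dots> = 1 / (2 * (G + 1))" using p G0 by (simp add: powr_powr)
  finally have "G * c2 powr (1 / p) \<le> G * (1 / (2 * (G + 1)))" using G0 by (rule mult_left_mono)
  also have "\<dots> \<le> 1 / 2" using G0 by (simp add: field_simps)
  finally have Gc: "G * c2 powr (1 / p) \<le> 1 / 2" .
  \<comment> \<open>Half of \<open>c2\<close>, since chaining meets blocks of control up to
    \<open>2 * c\<close>.\<close>
  define c where "c = c2 / 2"
  have c0: "0 < c" using c2 by (simp add: c_def)
  define N where "N = nat \<lceil>W / c\<rceil>"
  have "W / c \<le> real N" unfolding N_def by linarith
  then have N: "W \<le> real N * c" using c0 by (simp add: field_simps)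
  show thesis
  \<comment> \<open>The factor 4 is that of \<open>E\<close> in the block estimate, which solves
    \<open>M \<le> norm (z a) + M / 2 + 2 * E\<close> for \<open>M\<close>.\<close>
  proof (rule that[of c "(2 ^ Suc N - 1) * 4"])
    show "0 < c" by fact
    have "(1::real) \<le> 2 ^ Suc N" by (rule one_le_power) simp
    then show "0 \<le> ((2::real) ^ Suc N - 1) * 4" by simp
    fix K y y' X \<Omega> e k
    assume ctl: "controlled p K \<Omega> X" and WK: "\<Omega> K - \<Omega> 0 \<le> W"
      and yS: "\<And>k. k \<le> K \<Longrightarrow> y k \<in> S" and y'S: "\<And>k. k \<le> K \<Longrightarrow> y' k \<in> S"
      and yB: "\<And>k l. k \<le> l \<Longrightarrow> l \<le> K \<Longrightarrow> norm (y l - y k) \<le> B * (\<Omega> l - \<Omega> k) powr (1 / p)"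
      and y'B: "\<And>k l. k \<le> l \<Longrightarrow> l \<le> K \<Longrightarrow> norm (y' l - y' k) \<le> B * (\<Omega> l - \<Omega> k) powr (1 / p)"
      and step: "\<And>k. k < K \<Longrightarrow> \<Omega> (Suc k) - \<Omega> k \<le> c"
      and e: "\<And>k. k < K \<Longrightarrow> norm (defect f X y k (Suc k)) + norm (defect f X y' k (Suc k)) \<le> e k"
      and init: "y 0 = y' 0" and k: "k \<le> K"
    define z where "z k = y k - y' k" for k
    define R where "R k l = defect f X y k l - defect f X y' k l" for k l
    have e0: "0 \<le> e k" if "k < K" for k
      using e[OF that] by (meson add_nonneg_nonneg norm_ge_zero order_trans)
    define E where "E = sum e {..<K}"
    have E0: "0 \<le> E" unfolding E_def by (rule sum_nonneg) (use e0 in auto)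
    have zR: "z l - z k = R k l + (f (y k) - f (y' k)) *v (X l - X k)" for k l
      by (simp add: z_def R_def defect_def algebra_simps matrix_vector_mult_diff_rdistrib)
    have loc: "norm (z b) \<le> 2 * norm (z a) + 4 * E"
      if ab: "a \<le> b" "b \<le> K" "\<Omega> b - \<Omega> a \<le> c2" for a b
    proof -
      \<comment> \<open>Every estimate on the block is linear in \<open>M\<close>, and evaluating at
        an index where the maximum is attained turns them into a bound for \<open>M\<close>.\<close>
      define M where "M = Max ((\<lambda>k. norm (z k)) ` {a..b})"
      have M: "norm (z k) \<le> M" if "a \<le> k" "k \<le> b" for k
        unfolding M_def using that by (intro Max_ge) auto
      have "M \<in> (\<lambda>k. norm (z k)) ` {a..b}" unfolding M_def using ab by (intro Max_in) auto
      then obtain l where l: "a \<le> l" "l \<le> b" "M = norm (z l)" by auto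
      have M0: "0 \<le> M" using l by simp
      have Gz: "norm ((f (y k) - f (y' k)) *v h) \<le> \<Lambda> * M * norm h" if "a \<le> k" "k \<le> b" for k h
      proof -
        have "norm ((f (y k) - f (y' k)) *v h) \<le> \<Lambda> * norm (z k) * norm h"
          unfolding z_def using yS[of k] y'S[of k] that ab by (intro lip) auto
        also have "\<dots> \<le> \<Lambda> * M * norm h" using M[OF that] \<Lambda> by (intro mult_right_mono mult_left_mono) auto
        finally show ?thesis .
      qed
      define w where "w = \<Omega> l - \<Omega> a"
      \<comment> \<open>On this block \<open>w \<le> c1\<close>, so the perturbation is available
        for every pair of indices, and sewing applies with the constant
        \<open>D * M\<close>.\<close>
      have "norm (R a l) \<le> L * (D * M) * w powr (\<gamma> / p) + 2 * sum e {a..<l}"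
        unfolding w_def
      proof (rule sew[where a=a and b=b and J=R])
        show "0 \<le> D * M" using D0 M0 by simp
        fix k m l assume kml: "a \<le> k" "k \<le> m" "m \<le> l" "l \<le> b"
        define w where "w = \<Omega> l - \<Omega> k"
        have mono: "\<Omega> k \<le> \<Omega> m" "\<Omega> m \<le> \<Omega> l" "\<Omega> a \<le> \<Omega> k" "\<Omega> l \<le> \<Omega> b"
          using controlledD(1)[OF ctl] kml ab by auto
        have w: "0 \<le> w" "w \<le> c2" "w \<le> 1" using mono ab c1 c2 by (auto simp: w_def)
        have Xkm: "norm (X m - X k) \<le> w powr (1 / p)"
          using controlledD(2)[OF ctl, of k m] powr_mono2[of "1 / p" "\<Omega> m - \<Omega> k" w] kml ab mono p by (simp add: w_def)
        have Xml: "norm (X l - X m) \<le> w powr (1 / p)"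
          using controlledD(2)[OF ctl, of m l] powr_mono2[of "1 / p" "\<Omega> l - \<Omega> m" w] kml ab mono p by (simp add: w_def)
        have Bw: "B * (\<Omega> m - \<Omega> k) powr (1 / p) \<le> B * w powr (1 / p)"
          using B mono p by (intro mult_left_mono powr_mono2) (auto simp: w_def)
        have hol: "v powr (\<gamma> - 1) \<le> B powr (\<gamma> - 1) * w powr ((\<gamma> - 1) / p)"
          if "0 \<le> v" "v \<le> B * (\<Omega> m - \<Omega> k) powr (1 / p)" for v
        proof -
          have "v powr (\<gamma> - 1) \<le> (B * w powr (1 / p)) powr (\<gamma> - 1)"
            using that Bw p by (intro powr_mono2) auto
          also have "\<dots> = B powr (\<gamma> - 1) * w powr ((\<gamma> - 1) / p)"
            using B by (simp add: powr_mult powr_powr)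
          finally show ?thesis .
        qed
        have hy: "norm (y m - y k) powr (\<gamma> - 1) + norm (y' m - y' k) powr (\<gamma> - 1)
            \<le> 2 * (B powr (\<gamma> - 1) * w powr ((\<gamma> - 1) / p))"
          using hol[of "norm (y m - y k)"] hol[of "norm (y' m - y' k)"] yB[of k m] y'B[of k m] kml ab by simp
        have "norm (z m - z k) \<le> norm (R k m) + norm ((f (y k) - f (y' k)) *v (X m - X k))"
          unfolding zR[of m k] by (rule norm_triangle_ineq)
        also have "norm ((f (y k) - f (y' k)) *v (X m - X k)) \<le> \<Lambda> * M * w powr (1 / p)"
        proof (rule order_trans[OF Gz])
          show "\<Lambda> * M * norm (X m - X k) \<le> \<Lambda> * M * w powr (1 / p)"
            using \<Lambda> M0 by (intro mult_left_mono Xkm) auto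
        qed (use kml in auto)
        finally have zm: "norm (z m - z k) \<le> norm (R k m) + \<Lambda> * M * w powr (1 / p)" by simp
        have dR: "R k l - R k m - R m l = (f (y m) - f (y' m) - (f (y k) - f (y' k))) *v (X l - X m)"
        proof -
          have "R k l - R k m - R m l = (defect f X y k l - defect f X y k m - defect f X y m l)
             - (defect f X y' k l - defect f X y' k m - defect f X y' m l)" by (simp add: R_def)
          then show ?thesis unfolding defect_diff by (simp add: matrix_vector_mult_diff_rdistrib)
        qed
        have "norm (R k l - R k m - R m l) \<le> (\<Lambda> * norm (y m - y' m - (y k - y' k))
           + H * norm (y k - y' k) * (norm (y m - y k) powr (\<gamma> - 1) + norm (y' m - y' k) powr (\<gamma> - 1))) * norm (X l - X m)"
          unfolding dR using yS y'S kml ab by (intro fp) auto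
        also have "\<dots> \<le> (\<Lambda> * (norm (R k m) + \<Lambda> * M * w powr (1 / p))
           + H * M * (2 * (B powr (\<gamma> - 1) * w powr ((\<gamma> - 1) / p)))) * w powr (1 / p)"
          using \<Lambda> H M0 B Xml zm M[of k] hy kml unfolding z_def
          by (intro mult_mono add_mono mult_left_mono add_nonneg_nonneg mult_nonneg_nonneg) auto
        also have "\<dots> = \<Lambda> * w powr (1 / p) * norm (R k m) + \<Lambda> * \<Lambda> * M * (w powr (1 / p) * w powr (1 / p))
           + 2 * H * B powr (\<gamma> - 1) * M * (w powr ((\<gamma> - 1) / p) * w powr (1 / p))"
          by (simp add: algebra_simps)
        also have "w powr ((\<gamma> - 1) / p) * w powr (1 / p) = w powr (\<gamma> / p)"
          by (simp add: diff_divide_distrib flip: powr_add)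
        also have "w powr (1 / p) * w powr (1 / p) = w powr (2 / p)" by (simp flip: powr_add)
        \<comment> \<open>Since \<open>w \<le> 1\<close> and \<open>\<gamma> \<le> 2\<close>, the
          exponent \<open>2 / p\<close> may be lowered to \<open>\<gamma> / p\<close>.\<close>
        also have "\<Lambda> * w powr (1 / p) * norm (R k m) + \<Lambda> * \<Lambda> * M * w powr (2 / p)
             + 2 * H * B powr (\<gamma> - 1) * M * w powr (\<gamma> / p)
           \<le> \<Lambda> * w powr (1 / p) * norm (R k m) + \<Lambda> * \<Lambda> * M * w powr (\<gamma> / p)
             + 2 * H * B powr (\<gamma> - 1) * M * w powr (\<gamma> / p)"
          using \<Lambda> H M0 w p by (intro add_mono mult_left_mono powr_mono' divide_right_mono) auto
        also have "\<dots> = D * M * w powr (\<gamma> / p) + \<Lambda> * w powr (1 / p) * norm (R k m)"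
          by (simp add: D_def algebra_simps)
        finally show "norm (R k l - R k m - R m l) \<le> D * M * (\<Omega> l - \<Omega> k) powr (\<gamma> / p) +
           (if \<Omega> l - \<Omega> k \<le> c1 then \<Lambda> * (\<Omega> l - \<Omega> k) powr (1 / p) * norm (R k m) else 0)"
          using w c2 unfolding w_def[symmetric] by simp
      next
        fix k assume "a \<le> k" "k < b"
        then show "norm (R k (Suc k)) \<le> e k"
          unfolding R_def using e[of k] ab norm_triangle_ineq4 order_trans by (meson less_le_trans)
      qed (use controlledD(1)[OF ctl] ab l in \<open>auto simp: R_def\<close>)
      moreover have "sum e {a..<l} \<le> E"
        unfolding E_def using l ab e0 by (intro sum_mono2) auto
      moreover have w: "0 \<le> w" "w \<le> c2" "w \<le> 1"
        using controlledD(1)[OF ctl, of a l] controlledD(1)[OF ctl, of l b] l ab c1 c2 by (auto simp: w_def)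
      moreover have "L * (D * M) * w powr (\<gamma> / p) \<le> L * (D * M) * w powr (1 / p)"
        using w p L D0 M0 by (intro mult_left_mono powr_mono' divide_right_mono) auto
      moreover have "norm ((f (y a) - f (y' a)) *v (X l - X a)) \<le> \<Lambda> * M * w powr (1 / p)"
      proof (rule order_trans[OF Gz])
        show "\<Lambda> * M * norm (X l - X a) \<le> \<Lambda> * M * w powr (1 / p)"
          using \<Lambda> M0 controlledD(2)[OF ctl, of a l] l ab by (intro mult_left_mono) (auto simp: w_def)
      qed (use ab in auto)
      moreover have "norm (z l - z a) \<le> norm (R a l) + norm ((f (y a) - f (y' a)) *v (X l - X a))"
        unfolding zR[of l a] by (rule norm_triangle_ineq)
      moreover have "G * w powr (1 / p) * M = \<Lambda> * M * w powr (1 / p) + L * (D * M) * w powr (1 / p)"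
        by (simp add: G_def algebra_simps)
      ultimately have "norm (z l - z a) \<le> G * w powr (1 / p) * M + 2 * E"
        by linarith
      also have "G * w powr (1 / p) * M \<le> 1 / 2 * M"
      proof (rule mult_right_mono[OF order_trans[OF _ Gc] M0])
        show "G * w powr (1 / p) \<le> G * c2 powr (1 / p)"
          using w G0 p by (intro mult_left_mono powr_mono2) auto
      qed
      finally have "norm (z l - z a) \<le> M / 2 + 2 * E" by simp
      moreover have "norm (z l) \<le> norm (z a) + norm (z l - z a)" using norm_triangle_sub by blast
      ultimately have "M \<le> 2 * norm (z a) + 4 * E" using l by simp
      then show ?thesis using M[of b] ab by simp
    qed
    have "norm (z k) \<le> (2 ^ Suc N - 1) * (4 * E)"
    proof (rule chain_bound[where K=K and \<Omega>=\<Omega> and c=c])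
      show "\<Omega> k - \<Omega> 0 \<le> real N * c" using N WK controlledD(1)[OF ctl k] by linarith
      show "norm (z b) \<le> 2 * norm (z a) + 4 * E" if "a \<le> b" "b \<le> K" "\<Omega> b - \<Omega> a \<le> 2 * c" for a b
        using loc that by (simp add: c_def)
    qed (use controlledD(1)[OF ctl] step c0 E0 k init in \<open>auto simp: z_def\<close>)
    then show "norm (y k - y' k) \<le> ((2 ^ Suc N - 1) * 4) * sum e {..<K}"
      by (simp only: z_def E_def mult.assoc)
  qed
qed

subsection \<open>Elementary properties of solutions\<close>

definition control :: "real \<Rightarrow> real \<Rightarrow> (real \<Rightarrow> real) \<Rightarrow> (real \<Rightarrow> 'a::real_normed_vector) \<Rightarrow> bool" where
  "control p T \<omega> x \<longleftrightarrow> continuous_on {0..T} \<omega> \<and> continuous_on {0..T} x \<and>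
     (\<forall>s t. 0 \<le> s \<and> s \<le> t \<and> t \<le> T \<longrightarrow> \<omega> s \<le> \<omega> t \<and> norm (x t - x s) \<le> (\<omega> t - \<omega> s) powr (1 / p))"

lemma controlD:
  assumes "control p T \<omega> x" "0 \<le> s" "s \<le> t" "t \<le> T"
  shows "\<omega> s \<le> \<omega> t" "norm (x t - x s) \<le> (\<omega> t - \<omega> s) powr (1 / p)"
  using assms unfolding control_def by auto

lemma finite_p_variation_control:
  assumes p: "0 < p" and x: "continuous_on {0..T} x" "finite_p_variation p T x"
  obtains \<omega> where "control p T \<omega> x"
proof -
  obtain \<omega> where \<omega>: "continuous_on {0..T} \<omega>" "mono_on {0..T} \<omega>"
    "\<And>s t. 0 \<le> s \<Longrightarrow> s \<le> t \<Longrightarrow> t \<le> T \<Longrightarrow> norm (x t - x s) powr p \<le> \<omega> t - \<omega> s"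
    using x(2) unfolding finite_p_variation_def by blast
  have "norm (x t - x s) \<le> (\<omega> t - \<omega> s) powr (1 / p)" if "0 \<le> s" "s \<le> t" "t \<le> T" for s t
  proof -
    have "norm (x t - x s) = (norm (x t - x s) powr p) powr (1 / p)"
      using p by (simp add: powr_powr)
    also have "\<dots> \<le> (\<omega> t - \<omega> s) powr (1 / p)"
      using p by (intro powr_mono2 \<omega>(3) that) auto
    finally show ?thesis .
  qed
  moreover have "\<omega> s \<le> \<omega> t" if "0 \<le> s" "s \<le> t" "t \<le> T" for s t
    using \<omega>(2) that by (intro mono_onD[of "{0..T}" \<omega>]) auto
  ultimately have "control p T \<omega> x" using \<omega>(1) x(1) unfolding control_def by blast
  then show thesis by (rule that)
qed

lemma mono_seq_upto:
  fixes u :: "nat \<Rightarrow> real"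
  assumes "\<And>k. k < K \<Longrightarrow> u k \<le> u (Suc k)" "k \<le> l" "l \<le> K"
  shows "u k \<le> u l"
  using assms(2,3)
proof (induction l rule: dec_induct)
  case (step l)
  then show ?case using assms(1)[of l] by fastforce
qed simp

text \<open>Steps of length 0 are allowed, as grids frozen at a given time have them.\<close>

lemma controlled_grid:
  assumes "control p T \<omega> x" "\<And>k. k < K \<Longrightarrow> u k \<le> u (Suc k)" "0 \<le> u 0" "u K \<le> T"
  shows "controlled p K (\<lambda>k. \<omega> (u k)) (\<lambda>k. x (u k))"
  unfolding controlled_def
proof (intro allI impI)
  fix k l assume kl: "k \<le> l \<and> l \<le> K"
  have "u 0 \<le> u k" "u k \<le> u l" "u l \<le> u K"
    using kl by (auto intro!: mono_seq_upto[of K u] assms(2))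
  then show "\<omega> (u k) \<le> \<omega> (u l) \<and> norm (x (u l) - x (u k)) \<le> (\<omega> (u l) - \<omega> (u k)) powr (1 / p)"
    using controlD[OF assms(1), of "u k" "u l"] assms(3,4) by auto
qed

lemma defect_sample: "defect f (\<lambda>k. x (u k)) (\<lambda>k. y (u k)) k l = defect f x y (u k) (u l)"
  by (simp add: defect_def)

lemma defect_euler: "defect f (\<lambda>k. x (u k)) (euler f x y0 u) k (Suc k) = 0"
  by (simp add: defect_def)

text \<open>The form in which the solution property is used: a small mesh replaces small increments
  of the solution's own control, and the bound is additive in \<open>\<nu>\<close>, so that one-step
  errors along a grid telescope to \<open>\<epsilon>\<close> times the total increment of
  \<open>\<nu>\<close>.\<close>

definition small_defects ::
  "(real ^ 'n \<Rightarrow> real ^ 'd ^ 'n) \<Rightarrow> (real \<Rightarrow> real ^ 'd) \<Rightarrow> real \<Rightarrow> (real \<Rightarrow> real ^ 'n) \<Rightarrow> (real \<Rightarrow> real) \<Rightarrow> bool" where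
  "small_defects f x t1 y \<nu> \<longleftrightarrow> continuous_on {0..t1} \<nu> \<and> mono_on {0..t1} \<nu> \<and>
     (\<forall>\<epsilon>>0. \<exists>\<delta>>0. \<forall>s t. 0 \<le> s \<and> s \<le> t \<and> t \<le> t1 \<and> t - s < \<delta> \<longrightarrow>
        norm (defect f x y s t) \<le> \<epsilon> * (\<nu> t - \<nu> s))"

lemma small_defectsE:
  assumes "small_defects f x t1 y \<nu>" "0 < \<epsilon>"
  obtains \<delta> where "0 < \<delta>" "\<And>s t. 0 \<le> s \<Longrightarrow> s \<le> t \<Longrightarrow> t \<le> t1 \<Longrightarrow> t - s < \<delta> \<Longrightarrow>
    norm (defect f x y s t) \<le> \<epsilon> * (\<nu> t - \<nu> s)"
  using assms unfolding small_defects_def by meson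

lemma small_defects_mono:
  assumes "small_defects f x t1 y \<nu>" "0 \<le> s" "s \<le> t" "t \<le> t1"
  shows "\<nu> s \<le> \<nu> t"
  using assms unfolding small_defects_def by (auto intro: mono_onD)

text \<open>By uniform continuity a small mesh makes the increments of \<open>\<omega>\<close> small
  enough for the condition on \<open>\<theta>\<close>. Dividing \<open>\<epsilon>\<close> by the
  number \<open>n\<close> of components prepares the passage from components to the norm.\<close>

lemma solution_on_small_defects:
  fixes f :: "real ^ 'n \<Rightarrow> real ^ 'd ^ 'n"
  assumes "solution_on f x y0 t1 y"
  obtains \<nu> where "small_defects f x t1 y \<nu>"
proof -
  obtain \<omega> \<theta> where \<omega>: "continuous_on {0..t1} \<omega>" "mono_on {0..t1} \<omega>"
    and \<theta>: "\<theta> 0 = 0" "\<theta> \<in> o[at_right 0](\<lambda>\<delta>. \<delta>)"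
    and sol: "\<And>i s t. 0 \<le> s \<Longrightarrow> s < t \<Longrightarrow> t \<le> t1 \<Longrightarrow>
           \<bar>(y t - y s - f (y s) *v (x t - x s)) $ i\<bar> \<le> \<theta> (\<omega> t - \<omega> s)"
    using assms unfolding solution_on_def by blast
  define n where "n = real CARD('n)"
  have n: "0 < n" by (simp add: n_def)
  have "\<exists>\<delta>>0. \<forall>s t. 0 \<le> s \<and> s \<le> t \<and> t \<le> t1 \<and> t - s < \<delta> \<longrightarrow> norm (defect f x y s t) \<le> \<epsilon> * (\<omega> t - \<omega> s)"
    if \<epsilon>: "0 < \<epsilon>" for \<epsilon>
  proof -
    have "eventually (\<lambda>\<delta>. norm (\<theta> \<delta>) \<le> \<epsilon> / n * norm \<delta>) (at_right 0)"
      using \<theta>(2) \<epsilon> n by (intro landau_o.smallD) auto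
    then obtain d where d: "0 < d" "\<And>v. 0 < v \<Longrightarrow> v < d \<Longrightarrow> \<theta> v \<le> \<epsilon> / n * v"
      unfolding eventually_at_right_field by force
    \<comment> \<open>The value \<open>v = 0\<close> occurs wherever \<open>\<omega>\<close> is
      constant; it is covered by \<open>\<theta> 0 = 0\<close>, as the asymptotic condition speaks
      of \<open>v > 0\<close> only.\<close>
    have \<theta>v: "\<theta> v \<le> \<epsilon> / n * v" if "0 \<le> v" "v < d" for v
      using d(2)[of v] \<theta>(1) that by (cases "v = 0") auto
    have "uniformly_continuous_on {0..t1} \<omega>" using \<omega>(1) by (intro compact_uniformly_continuous) auto
    then obtain \<delta> where \<delta>: "0 < \<delta>" "\<And>s t. s \<in> {0..t1} \<Longrightarrow> t \<in> {0..t1} \<Longrightarrow> dist t s < \<delta> \<Longrightarrow> dist (\<omega> t) (\<omega> s) < d"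
      unfolding uniformly_continuous_on_def using d(1) by metis
    show ?thesis
    proof (intro exI[of _ \<delta>] conjI \<delta>(1) allI impI)
      fix s t assume st: "0 \<le> s \<and> s \<le> t \<and> t \<le> t1 \<and> t - s < \<delta>"
      show "norm (defect f x y s t) \<le> \<epsilon> * (\<omega> t - \<omega> s)"
      proof (cases "s = t")
        case False
        have w: "0 \<le> \<omega> t - \<omega> s" "\<omega> t - \<omega> s < d"
          using mono_onD[OF \<omega>(2), of s t] \<delta>(2)[of s t] st by (auto simp: dist_real_def)
        have "norm (defect f x y s t) \<le> (\<Sum>i\<in>UNIV. \<bar>defect f x y s t $ i\<bar>)" by (rule norm_le_l1_cart)
        also have "\<dots> \<le> (\<Sum>i\<in>(UNIV::'n set). \<epsilon> / n * (\<omega> t - \<omega> s))"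
        proof (rule sum_mono)
          fix i show "\<bar>defect f x y s t $ i\<bar> \<le> \<epsilon> / n * (\<omega> t - \<omega> s)"
            unfolding defect_def using st False by (intro order_trans[OF sol \<theta>v[OF w]]) auto
        qed
        also have "\<dots> = \<epsilon> * (\<omega> t - \<omega> s)" using n by (simp add: n_def)
        finally show ?thesis .
      qed simp
    qed
  qed
  then have "small_defects f x t1 y \<omega>" unfolding small_defects_def using \<omega> by blast
  then show thesis by (rule that)
qed

text \<open>The power \<open>L * v powr (2 / p)\<close> serves as \<open>\<theta>\<close>: it is of
  smaller order than \<open>v\<close> because \<open>2 / p > 1\<close>, and it vanishes at 0 because
  \<open>0 powr a\<close> is 0.\<close>

lemma solution_on_of_defect_bound:
  assumes "continuous_on {0..t1} \<omega>" "\<And>s t. 0 \<le> s \<Longrightarrow> s \<le> t \<Longrightarrow> t \<le> t1 \<Longrightarrow> \<omega> s \<le> \<omega> t"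
    and p: "1 \<le> p" "p < 2" and L: "0 \<le> L" and y0: "y 0 = y0"
    and bnd: "\<And>s t. 0 \<le> s \<Longrightarrow> s \<le> t \<Longrightarrow> t \<le> t1 \<Longrightarrow> norm (defect f x y s t) \<le> L * (\<omega> t - \<omega> s) powr (2 / p)"
  shows "solution_on f x y0 t1 y"
proof -
  have ex: "0 < 2 / p - 1" using p by simp
  have "((\<lambda>v. L * v powr (2 / p - 1)) \<longlongrightarrow> L * 0) (at_right 0)"
    using ex eventually_at_right_less[of "0::real"]
    by (intro tendsto_mult tendsto_const tendsto_zero_powrI tendsto_ident_at) (auto elim!: eventually_mono)
  then have "((\<lambda>v. L * v powr (2 / p - 1)) \<longlongrightarrow> 0) (at_right 0)" by simp
  then have lim: "((\<lambda>v. L * v powr (2 / p) / v) \<longlongrightarrow> 0) (at_right 0)"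
  proof (rule Lim_transform_eventually)
    show "\<forall>\<^sub>F v in at_right 0. L * v powr (2 / p - 1) = L * v powr (2 / p) / v"
      using eventually_at_right_less[of "0::real"] by eventually_elim (simp add: powr_diff)
  qed
  have "(\<lambda>v. L * v powr (2 / p)) \<in> o[at_right 0](\<lambda>v. v)"
    using lim eventually_at_right_less[of "0::real"]
    by (intro smalloI_tendsto) (auto elim!: eventually_mono)
  moreover have "\<bar>(y t - y s - f (y s) *v (x t - x s)) $ i\<bar> \<le> L * (\<omega> t - \<omega> s) powr (2 / p)"
    if "0 \<le> s" "s < t" "t \<le> t1" for i s t
    unfolding defect_def[symmetric] using that by (intro order_trans[OF component_le_norm_cart bnd]) auto
  moreover have "mono_on {0..t1} \<omega>" using assms(2) by (auto intro!: mono_onI)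
  ultimately show ?thesis
    unfolding solution_on_def using y0 assms(1) L
    by (intro conjI exI[of _ \<omega>] exI[of _ "\<lambda>v. L * v powr (2 / p)"]) auto
qed

text \<open>Over a step shorter than \<open>\<delta>\<close>, the solution is controlled by \<open>f\<close> at the left end point
  alone, so it cannot blow up within the step.\<close>

lemma small_defects_bounded:
  fixes f :: "real ^ 'n \<Rightarrow> real ^ 'd ^ 'n"
  assumes sd: "small_defects f x t1 y \<nu>" and x: "continuous_on {0..t1} x"
  shows "bounded (y ` {0..t1})"
proof -
  obtain \<delta> where \<delta>: "0 < \<delta>" "\<And>s t. 0 \<le> s \<Longrightarrow> s \<le> t \<Longrightarrow> t \<le> t1 \<Longrightarrow> t - s < \<delta> \<Longrightarrow>
    norm (defect f x y s t) \<le> 1 * (\<nu> t - \<nu> s)"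
    by (rule small_defectsE[OF sd, of 1]) auto
  have "bounded (x ` {0..t1})" using x by (intro compact_imp_bounded compact_continuous_image) auto
  then obtain b where b: "\<And>t. 0 \<le> t \<Longrightarrow> t \<le> t1 \<Longrightarrow> norm (x t) \<le> b"
    unfolding bounded_iff by (metis atLeastAtMost_iff imageI)
  \<comment> \<open>No bound for \<open>f\<close> along \<open>y\<close> is known yet, as such
    bounds hold on balls; each block of length \<open>\<delta> / 2\<close> uses the single matrix
    \<open>f (y s)\<close> at its start.\<close>
  have "bounded (y ` {0..min t1 (real j * (\<delta> / 2))})" for j
  proof (induction j)
    case 0
    have "{0..min t1 (real 0 * (\<delta> / 2))} \<subseteq> {0}" by auto
    then have "y ` {0..min t1 (real 0 * (\<delta> / 2))} \<subseteq> {y 0}" by blast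
    then show ?case by (rule bounded_subset[rotated]) simp
  next
    case (Suc j)
    define s where "s = min t1 (real j * (\<delta> / 2))"
    show ?case
    proof (cases "0 \<le> t1")
      case True
      have s: "0 \<le> s" "s \<le> t1" using True \<delta>(1) by (auto simp: s_def)
      have "norm (y t) \<le> (\<nu> t1 - \<nu> 0) + norm (y s) + onorm ((*v) (f (y s))) * (2 * b)"
        if t: "s \<le> t" "t \<le> min t1 (real (Suc j) * (\<delta> / 2))" for t
      proof -
        have ts: "t - s < \<delta>"
        proof (cases "t1 \<le> real j * (\<delta> / 2)")
          case True then show ?thesis using t \<delta>(1) by (simp add: s_def)
        next
          case False then show ?thesis using t \<delta>(1) by (simp add: s_def algebra_simps)
        qed
        have "norm (defect f x y s t) \<le> \<nu> t - \<nu> s" using \<delta>(2)[of s t] s t ts by simp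
        also have "\<dots> \<le> \<nu> t1 - \<nu> 0"
          using small_defects_mono[OF sd, of t t1] small_defects_mono[OF sd, of 0 s] s t by simp
        finally have d: "norm (defect f x y s t) \<le> \<nu> t1 - \<nu> 0" .
        have "norm (x t - x s) \<le> 2 * b"
          using b[of t] b[of s] s t norm_triangle_ineq4[of "x t" "x s"] by simp
        then have "norm (f (y s) *v (x t - x s)) \<le> onorm ((*v) (f (y s))) * (2 * b)"
          by (intro order_trans[OF onorm[OF matrix_vector_mul_bounded_linear] mult_left_mono]
              onorm_pos_le matrix_vector_mul_bounded_linear)
        moreover have "y t = defect f x y s t + y s + f (y s) *v (x t - x s)" by (simp add: defect_def)
        then have "norm (y t) \<le> norm (defect f x y s t) + norm (y s) + norm (f (y s) *v (x t - x s))"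
          using norm_triangle_ineq[of "defect f x y s t + y s" "f (y s) *v (x t - x s)"]
            norm_triangle_ineq[of "defect f x y s t" "y s"] by simp
        ultimately show ?thesis using d by linarith
      qed
      then have "bounded (y ` {s..min t1 (real (Suc j) * (\<delta> / 2))})"
        unfolding bounded_iff ball_simps by (meson atLeastAtMost_iff)
      then have "bounded (y ` ({0..s} \<union> {s..min t1 (real (Suc j) * (\<delta> / 2))}))"
        using Suc.IH by (simp add: s_def image_Un)
      then show ?thesis by (rule bounded_subset[OF _ image_mono]) auto
    qed auto
  qed
  moreover obtain j where "t1 \<le> real j * (\<delta> / 2)"
    using reals_Archimedean3[of "\<delta> / 2"] \<delta>(1) by (auto dest: less_imp_le)
  ultimately show ?thesis by (metis min.absorb1)
qed

text \<open>Continuity is not part of the definition of a solution. It comes from the defect bound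
  with \<open>\<epsilon> = 1\<close>, which compares increments of \<open>y\<close> with those of
  \<open>x\<close> and \<open>\<nu>\<close>.\<close>

lemma small_defects_continuous:
  assumes sd: "small_defects f x t1 y \<nu>" and x: "continuous_on {0..t1} x"
    and f: "lip_field S f F \<Lambda>" and yS: "\<And>s. 0 \<le> s \<Longrightarrow> s \<le> t1 \<Longrightarrow> y s \<in> S"
  shows "continuous_on {0..t1} y"
proof -
  have F: "0 \<le> F" "\<And>a h. a \<in> S \<Longrightarrow> norm (f a *v h) \<le> F * norm h" using f unfolding lip_field_def by auto
  have \<nu>: "continuous_on {0..t1} \<nu>" using sd unfolding small_defects_def by auto
  obtain \<delta> where \<delta>: "0 < \<delta>" "\<And>s t. 0 \<le> s \<Longrightarrow> s \<le> t \<Longrightarrow> t \<le> t1 \<Longrightarrow> t - s < \<delta> \<Longrightarrow>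
    norm (defect f x y s t) \<le> 1 * (\<nu> t - \<nu> s)"
    by (rule small_defectsE[OF sd, of 1]) auto
  have inc: "norm (y t - y s) \<le> F * norm (x t - x s) + \<bar>\<nu> t - \<nu> s\<bar>" if "0 \<le> s" "s \<le> t" "t \<le> t1" "t - s < \<delta>" for s t
  proof -
    have "y t - y s = defect f x y s t + f (y s) *v (x t - x s)" by (simp add: defect_def)
    then have "norm (y t - y s) \<le> norm (defect f x y s t) + norm (f (y s) *v (x t - x s))"
      using norm_triangle_ineq by metis
    moreover have "norm (defect f x y s t) \<le> 1 * (\<nu> t - \<nu> s)" using that by (intro \<delta>(2))
    moreover have "norm (f (y s) *v (x t - x s)) \<le> F * norm (x t - x s)" using that by (intro F(2) yS) auto
    moreover note abs_ge_self[of "\<nu> t - \<nu> s"]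
    ultimately show ?thesis by simp
  qed
  show ?thesis
    unfolding continuous_on_def
  proof
    fix s assume s: "s \<in> {0..t1}"
    have "((\<lambda>t. F * norm (x t - x s) + \<bar>\<nu> t - \<nu> s\<bar>) \<longlongrightarrow> F * norm (x s - x s) + \<bar>\<nu> s - \<nu> s\<bar>) (at s within {0..t1})"
      using s x \<nu> unfolding continuous_on_def by (intro tendsto_intros) auto
    then have g: "((\<lambda>t. F * norm (x t - x s) + \<bar>\<nu> t - \<nu> s\<bar>) \<longlongrightarrow> 0) (at s within {0..t1})" by simp
    have "((\<lambda>t. y t - y s) \<longlongrightarrow> 0) (at s within {0..t1})"
    proof (rule Lim_null_comparison[OF _ g])
      show "\<forall>\<^sub>F t in at s within {0..t1}. norm (y t - y s) \<le> F * norm (x t - x s) + \<bar>\<nu> t - \<nu> s\<bar>"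
        unfolding eventually_at
      proof (intro exI[of _ \<delta>] conjI \<delta>(1) ballI impI)
        fix t assume t: "t \<in> {0..t1}" "t \<noteq> s \<and> dist t s < \<delta>"
        show "norm (y t - y s) \<le> F * norm (x t - x s) + \<bar>\<nu> t - \<nu> s\<bar>"
        proof (cases "s \<le> t")
          case True then show ?thesis using inc[of s t] s t by (auto simp: dist_real_def)
        next
          case False then show ?thesis using inc[of t s] s t
            by (auto simp: dist_real_def norm_minus_commute abs_minus_commute)
        qed
      qed
    qed
    then show "(y \<longlongrightarrow> y s) (at s within {0..t1})" using LIM_zero_cancel by blast
  qed
qed

lemma small_defects_grid:
  assumes sd: "small_defects f x t1 y \<nu>" and \<epsilon>: "0 < \<epsilon>"
  obtains \<delta> where "0 < \<delta>" "\<And>u K k. (\<And>k. k < K \<Longrightarrow> u k \<le> u (Suc k)) \<Longrightarrow> 0 \<le> u 0 \<Longrightarrow> u K \<le> t1 \<Longrightarrow>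
    (\<And>k. k < K \<Longrightarrow> u (Suc k) - u k < \<delta>) \<Longrightarrow> k < K \<Longrightarrow>
    norm (defect f x y (u k) (u (Suc k))) \<le> \<epsilon> * (\<nu> (u (Suc k)) - \<nu> (u k))"
proof -
  obtain \<delta> where \<delta>: "0 < \<delta>" "\<And>s t. 0 \<le> s \<Longrightarrow> s \<le> t \<Longrightarrow> t \<le> t1 \<Longrightarrow> t - s < \<delta> \<Longrightarrow>
    norm (defect f x y s t) \<le> \<epsilon> * (\<nu> t - \<nu> s)"
    by (rule small_defectsE[OF sd \<epsilon>]) auto
  show thesis
  proof (rule that[OF \<delta>(1)])
    fix u :: "nat \<Rightarrow> real" and K k
    assume u: "\<And>k. k < K \<Longrightarrow> u k \<le> u (Suc k)" "0 \<le> u 0" "u K \<le> t1" "\<And>k. k < K \<Longrightarrow> u (Suc k) - u k < \<delta>" "k < K"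
    have "u 0 \<le> u k" "u (Suc k) \<le> u K" using u(5) by (auto intro!: mono_seq_upto[of K u] u(1))
    then show "norm (defect f x y (u k) (u (Suc k))) \<le> \<epsilon> * (\<nu> (u (Suc k)) - \<nu> (u k))"
      using u by (intro \<delta>(2)) auto
  qed
qed

lemma uniform_grid:
  fixes s t \<delta> :: real
  assumes "s \<le> t" "0 < \<delta>"
  obtains n :: nat and u :: "nat \<Rightarrow> real" where "0 < n" "u 0 = s" "u n = t"
    "\<And>k. u k \<le> u (Suc k)" "\<And>k. u (Suc k) - u k < \<delta>"
proof -
  obtain n :: nat where n: "(t - s) / \<delta> < real n" using reals_Archimedean2 by blast
  have "0 \<le> (t - s) / \<delta>" using assms by simp
  then have n0: "0 < n" using n by (cases n) auto
  define h where "h = (t - s) / real n"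
  have "t - s < real n * \<delta>" using n assms by (simp add: field_simps)
  then have h: "0 \<le> h" "h < \<delta>" "real n * h = t - s" using assms n0 by (auto simp: h_def field_simps)
  show thesis
    by (rule that[of n "\<lambda>k. s + real k * h"]) (use n0 h in \<open>auto simp: algebra_simps\<close>)
qed

text \<open>Sewing along a grid from \<open>s\<close> to \<open>t\<close> leaves only
  \<open>2 * sum e\<close> as a trace of the grid, and this tends to 0 with the mesh. So the
  unspecified control and \<open>\<theta>\<close> of a solution are replaced by the control of
  \<open>x\<close>, with one constant for all solutions in \<open>S\<close>. The start
  \<open>a\<close> is separate from 0 because a solution may be known to lie in \<open>S\<close>
  only from a later time on.\<close>

lemma solution_defect_bound:
  fixes f :: "real ^ 'n \<Rightarrow> real ^ 'd ^ 'n"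
  assumes p: "1 \<le> p" "p < 2" and f: "lip_field S f F \<Lambda>" and ctl: "control p T \<omega> x"
  obtains L where "0 \<le> L"
    "\<And>y \<nu> a t1 s t. \<lbrakk>small_defects f x t1 y \<nu>; t1 \<le> T; \<And>s. a \<le> s \<Longrightarrow> s \<le> t1 \<Longrightarrow> y s \<in> S;
        0 \<le> a; a \<le> s; s \<le> t; t \<le> t1\<rbrakk>
      \<Longrightarrow> norm (defect f x y s t) \<le> L * (\<omega> t - \<omega> s) powr (2 / p)"
proof -
  obtain L where L: "0 \<le> L"
    "\<And>K y X \<Omega> e k l. \<lbrakk>controlled p K \<Omega> X; \<And>k. k \<le> K \<Longrightarrow> y k \<in> S;
        \<And>k. k < K \<Longrightarrow> norm (defect f X y k (Suc k)) \<le> e k; k \<le> l; l \<le> K\<rbrakk>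
      \<Longrightarrow> norm (defect f X y k l) \<le> L * (\<Omega> l - \<Omega> k) powr (2 / p) + 2 * sum e {k..<l}"
    by (rule discrete_defect_bound[OF p f]) blast
  show thesis
  proof (rule that[OF L(1)])
    fix y \<nu> a t1 s t
    assume sd: "small_defects f x t1 y \<nu>" and t1: "t1 \<le> T" and yS: "\<And>s. a \<le> s \<Longrightarrow> s \<le> t1 \<Longrightarrow> y s \<in> S"
      and a: "0 \<le> a" "a \<le> s" and st': "s \<le> t" "t \<le> t1"
    have st: "0 \<le> s" "s \<le> t" "t \<le> t1" using a st' by auto
    show "norm (defect f x y s t) \<le> L * (\<omega> t - \<omega> s) powr (2 / p)"
    proof (rule field_le_epsilon)
      fix \<eta> :: real assume \<eta>: "0 < \<eta>"
      define v where "v = \<nu> t - \<nu> s"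
      have v: "0 \<le> v" using small_defects_mono[OF sd st] by (simp add: v_def)
      \<comment> \<open>The 2 is the factor of \<open>sum e\<close> in the sewing bound; adding 1
        guards against \<open>v = 0\<close>.\<close>
      define \<epsilon> where "\<epsilon> = \<eta> / (2 * (v + 1))"
      have \<epsilon>: "0 < \<epsilon>" using \<eta> v by (simp add: \<epsilon>_def)
      have "2 * (\<epsilon> * v) \<le> 2 * (\<epsilon> * (v + 1))" using \<epsilon> by simp
      also have "\<dots> = \<eta>" using v by (simp add: \<epsilon>_def field_simps)
      finally have \<epsilon>v: "2 * (\<epsilon> * v) \<le> \<eta>" .
      obtain \<delta> where \<delta>: "0 < \<delta>" "\<And>u K k. (\<And>k. k < K \<Longrightarrow> u k \<le> u (Suc k)) \<Longrightarrow> 0 \<le> u 0 \<Longrightarrow> u K \<le> t1 \<Longrightarrow>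
        (\<And>k. k < K \<Longrightarrow> u (Suc k) - u k < \<delta>) \<Longrightarrow> k < K \<Longrightarrow>
        norm (defect f x y (u k) (u (Suc k))) \<le> \<epsilon> * (\<nu> (u (Suc k)) - \<nu> (u k))"
        by (rule small_defects_grid[OF sd \<epsilon>]) blast
      obtain n u where u: "0 < n" "u 0 = s" "u n = t" "\<And>k. u k \<le> u (Suc k)" "\<And>k. u (Suc k) - u k < \<delta>"
        by (rule uniform_grid[OF st(2) \<delta>(1)]) blast
      have uin: "a \<le> u k \<and> u k \<le> t1" if "k \<le> n" for k
        using mono_seq_upto[of n u 0 k] mono_seq_upto[of n u k n] that u(2-4) st a by auto
      have "norm (defect f (\<lambda>k. x (u k)) (\<lambda>k. y (u k)) 0 n) \<le> L * (\<omega> (u n) - \<omega> (u 0)) powr (2 / p)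
          + 2 * (\<Sum>k\<in>{0..<n}. \<epsilon> * (\<nu> (u (Suc k)) - \<nu> (u k)))"
      proof (rule L(2)[where K=n])
        show "controlled p n (\<lambda>k. \<omega> (u k)) (\<lambda>k. x (u k))"
          using u st t1 by (intro controlled_grid[OF ctl]) auto
        show "norm (defect f (\<lambda>k. x (u k)) (\<lambda>k. y (u k)) k (Suc k)) \<le> \<epsilon> * (\<nu> (u (Suc k)) - \<nu> (u k))"
          if "k < n" for k
          unfolding defect_sample using u st that by (intro \<delta>(2)[where K=n]) auto
      qed (use uin yS in auto)
      also have "(\<Sum>k\<in>{0..<n}. \<epsilon> * (\<nu> (u (Suc k)) - \<nu> (u k))) = \<epsilon> * v"
        unfolding sum_distrib_left[symmetric] atLeast0LessThan sum_lessThan_telescope[of "\<lambda>k. \<nu> (u k)" n]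
          u(2,3) v_def ..
      finally show "norm (defect f x y s t) \<le> L * (\<omega> t - \<omega> s) powr (2 / p) + \<eta>"
        using \<epsilon>v by (simp add: defect_sample u)
    qed
  qed
qed

lemma solution_increment_bound:
  fixes f :: "real ^ 'n \<Rightarrow> real ^ 'd ^ 'n"
  assumes p: "1 \<le> p" "p < 2" and f: "lip_field S f F \<Lambda>" and ctl: "control p T \<omega> x"
  obtains B where "0 \<le> B"
    "\<And>y \<nu> a t1 s t. \<lbrakk>small_defects f x t1 y \<nu>; t1 \<le> T; \<And>s. a \<le> s \<Longrightarrow> s \<le> t1 \<Longrightarrow> y s \<in> S;
        0 \<le> a; a \<le> s; s \<le> t; t \<le> t1\<rbrakk>
      \<Longrightarrow> norm (y t - y s) \<le> B * (\<omega> t - \<omega> s) powr (1 / p)"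
proof -
  obtain L where L: "0 \<le> L"
    "\<And>y \<nu> a t1 s t. \<lbrakk>small_defects f x t1 y \<nu>; t1 \<le> T; \<And>s. a \<le> s \<Longrightarrow> s \<le> t1 \<Longrightarrow> y s \<in> S;
        0 \<le> a; a \<le> s; s \<le> t; t \<le> t1\<rbrakk>
      \<Longrightarrow> norm (defect f x y s t) \<le> L * (\<omega> t - \<omega> s) powr (2 / p)"
    by (rule solution_defect_bound[OF p f ctl]) blast
  define B where "B = F + L * (\<omega> T - \<omega> 0) powr (1 / p)"
  show thesis
  proof (rule that[of B])
    show "0 \<le> B" using f L(1) by (simp add: B_def lip_field_def)
    fix y \<nu> a t1 s t
    assume sd: "small_defects f x t1 y \<nu>" and t1: "t1 \<le> T" and yS: "\<And>s. a \<le> s \<Longrightarrow> s \<le> t1 \<Longrightarrow> y s \<in> S"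
      and a: "0 \<le> a" "a \<le> s" and st: "s \<le> t" "t \<le> t1"
    have d: "norm (defect f x y s t) \<le> L * (\<omega> t - \<omega> s) powr (2 / p)"
      by (rule L(2)[OF sd t1 yS a st])
    have "\<omega> 0 \<le> \<omega> s" "\<omega> s \<le> \<omega> t" "\<omega> t \<le> \<omega> T" using a st t1 by (auto intro!: controlD(1)[OF ctl])
    then show "norm (y t - y s) \<le> B * (\<omega> t - \<omega> s) powr (1 / p)"
      unfolding B_def using p a st t1 L(1)
      by (intro increment_le_of_defect[OF f _ _ _ d] yS controlD(2)[OF ctl]) auto
  qed
qed

subsection \<open>Uniqueness and convergence of the Euler scheme\<close>

lemma solution_on_subset:
  assumes "solution_on f x y0 t1 y" "t2 \<le> t1"
  shows "solution_on f x y0 t2 y"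
proof -
  obtain \<omega> \<theta> where "y 0 = y0" and \<omega>: "continuous_on {0..t1} \<omega>" "mono_on {0..t1} \<omega>"
    and \<theta>: "\<forall>\<delta>\<ge>0. 0 \<le> \<theta> \<delta>" "\<theta> 0 = 0" "\<theta> \<in> o[at_right 0](\<lambda>\<delta>. \<delta>)"
    and sol: "\<forall>i s t. 0 \<le> s \<and> s < t \<and> t \<le> t1 \<longrightarrow>
           \<bar>(y t - y s - f (y s) *v (x t - x s)) $ i\<bar> \<le> \<theta> (\<omega> t - \<omega> s)"
    using assms(1) unfolding solution_on_def by blast
  moreover have "{0..t2} \<subseteq> {0..t1}" using assms(2) by auto
  then have "continuous_on {0..t2} \<omega>" "mono_on {0..t2} \<omega>"
    using \<omega> by (auto intro: continuous_on_subset monotone_on_subset)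
  moreover have "\<forall>i s t. 0 \<le> s \<and> s < t \<and> t \<le> t2 \<longrightarrow>
           \<bar>(y t - y s - f (y s) *v (x t - x s)) $ i\<bar> \<le> \<theta> (\<omega> t - \<omega> s)"
    using sol assms(2) by (meson order_trans)
  ultimately show ?thesis unfolding solution_on_def by blast
qed

lemma solution_on_cong:
  assumes "0 \<le> t1" "\<And>s. 0 \<le> s \<Longrightarrow> s \<le> t1 \<Longrightarrow> y s = y' s"
  shows "solution_on f x y0 t1 y \<longleftrightarrow> solution_on f x y0 t1 y'"
proof -
  have "(y t - y s - f (y s) *v (x t - x s)) $ i = (y' t - y' s - f (y' s) *v (x t - x s)) $ i"
    if "0 \<le> s \<and> s < t \<and> t \<le> t1" for s t i
    using assms(2)[of s] assms(2)[of t] that by simp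
  then show ?thesis
    unfolding solution_on_def using assms(2)[of 0] assms(1) by (simp cong: conj_cong imp_cong)
qed

lemma control_small_steps:
  assumes "control p T \<omega> x" "0 < c"
  obtains \<delta> where "0 < \<delta>" "\<And>s t. 0 \<le> s \<Longrightarrow> s \<le> t \<Longrightarrow> t \<le> T \<Longrightarrow> t - s < \<delta> \<Longrightarrow> \<omega> t - \<omega> s \<le> c"
proof -
  have "uniformly_continuous_on {0..T} \<omega>"
    using assms(1) unfolding control_def by (intro compact_uniformly_continuous) auto
  then obtain \<delta> where \<delta>: "0 < \<delta>" "\<And>s t. s \<in> {0..T} \<Longrightarrow> t \<in> {0..T} \<Longrightarrow> dist t s < \<delta> \<Longrightarrow> dist (\<omega> t) (\<omega> s) < c"
    unfolding uniformly_continuous_on_def using assms(2) by metis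
  have "\<omega> t - \<omega> s \<le> c" if "0 \<le> s" "s \<le> t" "t \<le> T" "t - s < \<delta>" for s t
    using \<delta>(2)[of s t] that by (auto simp: dist_real_def)
  then show thesis using that \<delta>(1) by blast
qed

text \<open>Both solutions are sampled on one uniform grid of \<open>{0..t1}\<close>, and stability
  is applied at its last point. Earlier times then follow by restricting the solutions.\<close>

lemma solution_unique_endpoint:
  fixes f :: "real ^ 'n \<Rightarrow> real ^ 'd ^ 'n"
  assumes p: "1 \<le> p" "p < \<gamma>" "\<gamma> \<le> 2" and f: "C_rho \<gamma> f" and ctl: "control p T \<omega> x"
    and t1: "0 \<le> t1" "t1 \<le> T"
    and y: "solution_on f x y0 t1 y" and y': "solution_on f x y0 t1 y'"
  shows "y t1 = y' t1"
proof -
  obtain \<nu> where \<nu>: "small_defects f x t1 y \<nu>" by (rule solution_on_small_defects[OF y])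
  obtain \<nu>' where \<nu>': "small_defects f x t1 y' \<nu>'" by (rule solution_on_small_defects[OF y'])
  have x: "continuous_on {0..t1} x"
    using ctl t1 unfolding control_def by (auto intro: continuous_on_subset)
  have "bounded (y ` {0..t1} \<union> y' ` {0..t1})"
    using small_defects_bounded[OF \<nu> x] small_defects_bounded[OF \<nu>' x] by simp
  then obtain R where R: "\<forall>z\<in>y ` {0..t1} \<union> y' ` {0..t1}. norm z \<le> R"
    unfolding bounded_iff by blast
  then have yR: "\<And>s. 0 \<le> s \<Longrightarrow> s \<le> t1 \<Longrightarrow> y s \<in> cball 0 R" "\<And>s. 0 \<le> s \<Longrightarrow> s \<le> t1 \<Longrightarrow> y' s \<in> cball 0 R"
    using R by auto
  obtain F \<Lambda> H where field: "lip_field (cball 0 R) f F \<Lambda>" "four_point_field (cball 0 R) f (\<gamma> - 1) \<Lambda> H"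
    by (rule C_rho_field_bounds[of \<gamma> f R]) (use p f in auto)
  obtain B where B: "0 \<le> B"
    "\<And>y \<nu> a t1 s t. \<lbrakk>small_defects f x t1 y \<nu>; t1 \<le> T; \<And>s. a \<le> s \<Longrightarrow> s \<le> t1 \<Longrightarrow> y s \<in> cball 0 R;
        0 \<le> a; a \<le> s; s \<le> t; t \<le> t1\<rbrakk>
      \<Longrightarrow> norm (y t - y s) \<le> B * (\<omega> t - \<omega> s) powr (1 / p)"
    by (rule solution_increment_bound[OF p(1) _ field(1) ctl]) (use p in auto)
  define W where "W = \<omega> t1 - \<omega> 0"
  have W: "0 \<le> W" using controlD(1)[OF ctl, of 0 t1] t1 by (simp add: W_def)
  obtain c C where c: "0 < c" "0 \<le> C"
    and stab: "\<And>K y y' X \<Omega> e k. \<lbrakk>controlled p K \<Omega> X; \<Omega> K - \<Omega> 0 \<le> W;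
        \<And>k. k \<le> K \<Longrightarrow> y k \<in> cball 0 R; \<And>k. k \<le> K \<Longrightarrow> y' k \<in> cball 0 R;
        \<And>k l. k \<le> l \<Longrightarrow> l \<le> K \<Longrightarrow> norm (y l - y k) \<le> B * (\<Omega> l - \<Omega> k) powr (1 / p);
        \<And>k l. k \<le> l \<Longrightarrow> l \<le> K \<Longrightarrow> norm (y' l - y' k) \<le> B * (\<Omega> l - \<Omega> k) powr (1 / p);
        \<And>k. k < K \<Longrightarrow> \<Omega> (Suc k) - \<Omega> k \<le> c;
        \<And>k. k < K \<Longrightarrow> norm (defect f X y k (Suc k)) + norm (defect f X y' k (Suc k)) \<le> e k;
        y 0 = y' 0; k \<le> K\<rbrakk>
      \<Longrightarrow> norm (y k - y' k) \<le> C * sum e {..<K}"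
    by (rule discrete_stability[OF p field(2) B(1) W]) blast
  obtain \<delta>c where \<delta>c: "0 < \<delta>c" "\<And>s t. 0 \<le> s \<Longrightarrow> s \<le> t \<Longrightarrow> t \<le> T \<Longrightarrow> t - s < \<delta>c \<Longrightarrow> \<omega> t - \<omega> s \<le> c"
    by (rule control_small_steps[OF ctl c(1)]) blast
  \<comment> \<open>On any grid of \<open>{0..t1}\<close> the one-step errors of both solutions sum
    to \<open>\<epsilon> * V\<close>.\<close>
  define V where "V = (\<nu> t1 - \<nu> 0) + (\<nu>' t1 - \<nu>' 0)"
  have V: "0 \<le> V" using small_defects_mono[OF \<nu>, of 0 t1] small_defects_mono[OF \<nu>', of 0 t1] t1 by (simp add: V_def)
  have "norm (y t1 - y' t1) \<le> 0 + \<eta>" if \<eta>: "0 < \<eta>" for \<eta>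
  proof -
    define \<epsilon> where "\<epsilon> = \<eta> / (C * V + 1)"
    have \<epsilon>: "0 < \<epsilon>" using \<eta> c V by (simp add: \<epsilon>_def add_nonneg_pos)
    obtain \<delta> where \<delta>: "0 < \<delta>" "\<And>u K k. (\<And>k. k < K \<Longrightarrow> u k \<le> u (Suc k)) \<Longrightarrow> 0 \<le> u 0 \<Longrightarrow> u K \<le> t1 \<Longrightarrow>
        (\<And>k. k < K \<Longrightarrow> u (Suc k) - u k < \<delta>) \<Longrightarrow> k < K \<Longrightarrow>
        norm (defect f x y (u k) (u (Suc k))) \<le> \<epsilon> * (\<nu> (u (Suc k)) - \<nu> (u k))"
      by (rule small_defects_grid[OF \<nu> \<epsilon>]) blast
    obtain \<delta>' where \<delta>': "0 < \<delta>'" "\<And>u K k. (\<And>k. k < K \<Longrightarrow> u k \<le> u (Suc k)) \<Longrightarrow> 0 \<le> u 0 \<Longrightarrow> u K \<le> t1 \<Longrightarrow>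
        (\<And>k. k < K \<Longrightarrow> u (Suc k) - u k < \<delta>') \<Longrightarrow> k < K \<Longrightarrow>
        norm (defect f x y' (u k) (u (Suc k))) \<le> \<epsilon> * (\<nu>' (u (Suc k)) - \<nu>' (u k))"
      by (rule small_defects_grid[OF \<nu>' \<epsilon>]) blast
    have "0 < min \<delta>c (min \<delta> \<delta>')" using \<delta>c \<delta> \<delta>' by simp
    then obtain n u where u: "0 < n" "u 0 = 0" "u n = t1" "\<And>k. u k \<le> u (Suc k)" "\<And>k. u (Suc k) - u k < min \<delta>c (min \<delta> \<delta>')"
      by (rule uniform_grid[OF t1(1)]) blast
    have uin: "0 \<le> u k \<and> u k \<le> t1" if "k \<le> n" for k
      using mono_seq_upto[of n u 0 k] mono_seq_upto[of n u k n] that u(2-4) by auto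
    have ukl: "u k \<le> u l" if "k \<le> l" "l \<le> n" for k l
      using mono_seq_upto[of n u k l] that u(4) by auto
    define e where "e k = \<epsilon> * ((\<nu> (u (Suc k)) + \<nu>' (u (Suc k))) - (\<nu> (u k) + \<nu>' (u k)))" for k
    have "norm ((\<lambda>k. y (u k)) n - (\<lambda>k. y' (u k)) n) \<le> C * sum e {..<n}"
    proof (rule stab[where X = "\<lambda>k. x (u k)" and \<Omega> = "\<lambda>k. \<omega> (u k)"])
      show "controlled p n (\<lambda>k. \<omega> (u k)) (\<lambda>k. x (u k))"
        using u t1 by (intro controlled_grid[OF ctl]) auto
      show "\<omega> (u n) - \<omega> (u 0) \<le> W" using u by (simp add: W_def)
      show "norm (y (u l) - y (u k)) \<le> B * (\<omega> (u l) - \<omega> (u k)) powr (1 / p)" if "k \<le> l" "l \<le> n" for k l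
        using uin[of k] uin[of l] ukl[OF that] that by (intro B(2)[OF \<nu> t1(2) yR(1), of 0]) auto
      show "norm (y' (u l) - y' (u k)) \<le> B * (\<omega> (u l) - \<omega> (u k)) powr (1 / p)" if "k \<le> l" "l \<le> n" for k l
        using uin[of k] uin[of l] ukl[OF that] that by (intro B(2)[OF \<nu>' t1(2) yR(2), of 0]) auto
      show "\<omega> (u (Suc k)) - \<omega> (u k) \<le> c" if "k < n" for k
        using \<delta>c(2)[of "u k" "u (Suc k)"] uin[of k] uin[of "Suc k"] u(4,5)[of k] that t1 by auto
      fix k assume k: "k < n"
      have "norm (defect f x y (u k) (u (Suc k))) \<le> \<epsilon> * (\<nu> (u (Suc k)) - \<nu> (u k))"
        using u k by (intro \<delta>(2)[where K=n]) auto
      moreover have "norm (defect f x y' (u k) (u (Suc k))) \<le> \<epsilon> * (\<nu>' (u (Suc k)) - \<nu>' (u k))"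
        using u k by (intro \<delta>'(2)[where K=n]) auto
      ultimately show "norm (defect f (\<lambda>k. x (u k)) (\<lambda>k. y (u k)) k (Suc k))
          + norm (defect f (\<lambda>k. x (u k)) (\<lambda>k. y' (u k)) k (Suc k)) \<le> e k"
        unfolding defect_sample e_def by (simp add: algebra_simps)
    qed (use yR uin u y y' in \<open>auto simp: solution_on_def\<close>)
    also have "sum e {..<n} = \<epsilon> * V"
      unfolding e_def sum_distrib_left[symmetric] sum_lessThan_telescope[of "\<lambda>k. \<nu> (u k) + \<nu>' (u k)" n] u(2,3) V_def
      by simp
    also have "C * (\<epsilon> * V) \<le> \<epsilon> * (C * V + 1)" using \<epsilon> by (simp add: algebra_simps)
    also have "\<dots> = \<eta>"
    proof -
      have "C * V + 1 \<noteq> 0" using c V by (smt (verit) mult_nonneg_nonneg)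
      then show ?thesis by (simp add: \<epsilon>_def)
    qed
    finally show ?thesis using u by simp
  qed
  then have "norm (y t1 - y' t1) \<le> 0" by (rule field_le_epsilon)
  then show ?thesis by simp
qed

lemma solution_unique:
  fixes f :: "real ^ 'n \<Rightarrow> real ^ 'd ^ 'n"
  assumes "1 \<le> p" "p < \<gamma>" "\<gamma> \<le> 2" "C_rho \<gamma> f" "control p T \<omega> x"
    and "solution_on f x y0 t1 y" "solution_on f x y0 t2 y'" "0 \<le> s" "s \<le> t1" "s \<le> t2" "s \<le> T"
  shows "y s = y' s"
  using assms by (intro solution_unique_endpoint[OF assms(1-5) assms(8)]) (auto intro: solution_on_subset)

text \<open>The Euler scheme stays in the ball where the field bounds hold, since as long as it does it is
  within \<open>1/2\<close> of the solution and the next step moves it by less than \<open>1/2\<close>.\<close>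

lemma euler_convergence:
  fixes f :: "real ^ 'n \<Rightarrow> real ^ 'd ^ 'n"
  assumes p: "1 \<le> p" "p < \<gamma>" "\<gamma> \<le> 2" and f: "C_rho \<gamma> f" and ctl: "control p T \<omega> x"
    and t1: "0 \<le> t1" "t1 \<le> T" and y: "solution_on f x y0 t1 y" and \<eta>: "0 < \<eta>"
  obtains \<delta> where "0 < \<delta>" "\<And>K (u :: nat \<Rightarrow> real) k. \<lbrakk>u 0 = 0; u K = t1;
      \<And>k. k < K \<Longrightarrow> u k \<le> u (Suc k) \<and> u (Suc k) - u k < \<delta>; k \<le> K\<rbrakk>
      \<Longrightarrow> norm (euler f x y0 u k - y (u k)) < \<eta>"
proof -
  obtain \<nu> where \<nu>: "small_defects f x t1 y \<nu>" by (rule solution_on_small_defects[OF y])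
  have y0: "y 0 = y0" using y by (simp add: solution_on_def)
  have x: "continuous_on {0..t1} x"
    using ctl t1 unfolding control_def by (auto intro: continuous_on_subset)
  obtain R0 where R0: "\<And>s. 0 \<le> s \<Longrightarrow> s \<le> t1 \<Longrightarrow> norm (y s) \<le> R0"
    using small_defects_bounded[OF \<nu> x] unfolding bounded_iff ball_simps by (meson atLeastAtMost_iff)
  define R where "R = R0 + 1"
  have yR: "\<And>s. 0 \<le> s \<Longrightarrow> s \<le> t1 \<Longrightarrow> y s \<in> cball 0 R" using R0 by (force simp: R_def)
  obtain F \<Lambda> H where field: "lip_field (cball 0 R) f F \<Lambda>" "four_point_field (cball 0 R) f (\<gamma> - 1) \<Lambda> H"
    by (rule C_rho_field_bounds[of \<gamma> f R]) (use p f in auto)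
  have F: "0 \<le> F" "\<And>a h. a \<in> cball 0 R \<Longrightarrow> norm (f a *v h) \<le> F * norm h"
    using field(1) unfolding lip_field_def by blast+
  have p2: "p < 2" using p by simp
  obtain B1 where B1: "0 \<le> B1"
    "\<And>y \<nu> a t1 s t. \<lbrakk>small_defects f x t1 y \<nu>; t1 \<le> T; \<And>s. a \<le> s \<Longrightarrow> s \<le> t1 \<Longrightarrow> y s \<in> cball 0 R;
        0 \<le> a; a \<le> s; s \<le> t; t \<le> t1\<rbrakk>
      \<Longrightarrow> norm (y t - y s) \<le> B1 * (\<omega> t - \<omega> s) powr (1 / p)"
    by (rule solution_increment_bound[OF p(1) p2 field(1) ctl]) blast
  obtain L where L: "0 \<le> L"
    "\<And>K y X \<Omega> e k l. \<lbrakk>controlled p K \<Omega> X; \<And>k. k \<le> K \<Longrightarrow> y k \<in> cball 0 R;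
        \<And>k. k < K \<Longrightarrow> norm (defect f X y k (Suc k)) \<le> e k; k \<le> l; l \<le> K\<rbrakk>
      \<Longrightarrow> norm (defect f X y k l) \<le> L * (\<Omega> l - \<Omega> k) powr (2 / p) + 2 * sum e {k..<l}"
    by (rule discrete_defect_bound[OF p(1) p2 field(1)]) blast
  define W where "W = \<omega> t1 - \<omega> 0"
  have W: "0 \<le> W" using controlD(1)[OF ctl, of 0 t1] t1 by (simp add: W_def)
  \<comment> \<open>One constant must bound the increments of both sequences to be compared:
    \<open>B1\<close> serves the solution, the other entry the scheme while it stays in the
    ball.\<close>
  define B where "B = max B1 (F + L * W powr (1 / p))"
  have B: "0 \<le> B" using B1 by (simp add: B_def)
  obtain c C where c: "0 < c" "0 \<le> C"
    and stab: "\<And>K y y' X \<Omega> e k. \<lbrakk>controlled p K \<Omega> X; \<Omega> K - \<Omega> 0 \<le> W;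
        \<And>k. k \<le> K \<Longrightarrow> y k \<in> cball 0 R; \<And>k. k \<le> K \<Longrightarrow> y' k \<in> cball 0 R;
        \<And>k l. k \<le> l \<Longrightarrow> l \<le> K \<Longrightarrow> norm (y l - y k) \<le> B * (\<Omega> l - \<Omega> k) powr (1 / p);
        \<And>k l. k \<le> l \<Longrightarrow> l \<le> K \<Longrightarrow> norm (y' l - y' k) \<le> B * (\<Omega> l - \<Omega> k) powr (1 / p);
        \<And>k. k < K \<Longrightarrow> \<Omega> (Suc k) - \<Omega> k \<le> c;
        \<And>k. k < K \<Longrightarrow> norm (defect f X y k (Suc k)) + norm (defect f X y' k (Suc k)) \<le> e k;
        y 0 = y' 0; k \<le> K\<rbrakk>
      \<Longrightarrow> norm (y k - y' k) \<le> C * sum e {..<K}"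
    by (rule discrete_stability[OF p field(2) B W]) blast
  obtain \<delta>c where \<delta>c: "0 < \<delta>c" "\<And>s t. 0 \<le> s \<Longrightarrow> s \<le> t \<Longrightarrow> t \<le> T \<Longrightarrow> t - s < \<delta>c \<Longrightarrow> \<omega> t - \<omega> s \<le> c"
    by (rule control_small_steps[OF ctl c(1)]) blast
  \<comment> \<open>An amount of control over which the scheme moves by at most 1/2 in one step:
    \<open>F * cF powr (1 / p)\<close> equals \<open>F / (2 * (F + 1))\<close>.\<close>
  define cF where "cF = (1 / (2 * (F + 1))) powr p"
  have cF: "0 < cF" using F by (simp add: cF_def)
  obtain \<delta>x where \<delta>x: "0 < \<delta>x" "\<And>s t. 0 \<le> s \<Longrightarrow> s \<le> t \<Longrightarrow> t \<le> T \<Longrightarrow> t - s < \<delta>x \<Longrightarrow> \<omega> t - \<omega> s \<le> cF"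
    by (rule control_small_steps[OF ctl cF]) blast
  have Fx: "F * norm (x t - x s) \<le> 1 / 2" if "0 \<le> s" "s \<le> t" "t \<le> T" "t - s < \<delta>x" for s t
  proof -
    have "norm (x t - x s) \<le> (\<omega> t - \<omega> s) powr (1 / p)" using controlD(2)[OF ctl] that by auto
    also have "\<dots> \<le> cF powr (1 / p)"
      using \<delta>x(2) controlD(1)[OF ctl] that p by (intro powr_mono2) auto
    also have "\<dots> = 1 / (2 * (F + 1))" using p F by (simp add: cF_def powr_powr)
    finally have "F * norm (x t - x s) \<le> F * (1 / (2 * (F + 1)))" using F by (intro mult_left_mono)
    also have "\<dots> \<le> 1 / 2" using F by (simp add: field_simps)
    finally show ?thesis .
  qed
  define V where "V = \<nu> t1 - \<nu> 0"
  have V: "0 \<le> V" using small_defects_mono[OF \<nu>, of 0 t1] t1 by (simp add: V_def)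
  \<comment> \<open>\<open>\<eta> / 2\<close> makes the final inequality strict, and 1/2 leaves room
    for one further step inside the ball of radius \<open>R0 + 1\<close>.\<close>
  define \<eta>1 where "\<eta>1 = min (\<eta> / 2) (1 / 2)"
  have \<eta>1: "0 < \<eta>1" "\<eta>1 < \<eta>" "\<eta>1 \<le> 1 / 2" using \<eta> by (auto simp: \<eta>1_def)
  have CV: "0 < C * V + 1" using c V by (simp add: add_nonneg_pos)
  define \<epsilon> where "\<epsilon> = \<eta>1 / (C * V + 1)"
  have \<epsilon>: "0 < \<epsilon>" using \<eta>1 CV by (simp add: \<epsilon>_def)
  have "C * (\<epsilon> * V) \<le> \<epsilon> * (C * V + 1)" using \<epsilon> by (simp add: algebra_simps)
  also have "\<dots> = \<eta>1" using CV by (simp add: \<epsilon>_def)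
  finally have C\<epsilon>V: "C * (\<epsilon> * V) \<le> \<eta>1" .
  obtain \<delta>y where \<delta>y: "0 < \<delta>y" "\<And>s t. 0 \<le> s \<Longrightarrow> s \<le> t \<Longrightarrow> t \<le> t1 \<Longrightarrow> t - s < \<delta>y \<Longrightarrow>
      norm (defect f x y s t) \<le> \<epsilon> * (\<nu> t - \<nu> s)"
    by (rule small_defectsE[OF \<nu> \<epsilon>]) blast
  show thesis
  proof (rule that[of "min \<delta>c (min \<delta>x \<delta>y)"])
    show "0 < min \<delta>c (min \<delta>x \<delta>y)" using \<delta>c \<delta>x \<delta>y by simp
    fix K k and u :: "nat \<Rightarrow> real"
    assume u0: "u 0 = 0" and uK: "u K = t1" and kK: "k \<le> K"
      and u: "\<And>k. k < K \<Longrightarrow> u k \<le> u (Suc k) \<and> u (Suc k) - u k < min \<delta>c (min \<delta>x \<delta>y)"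
    define E where "E = euler f x y0 u"
    have ukl: "u k \<le> u l" if "k \<le> l" "l \<le> K" for k l
      using mono_seq_upto[of K u k l] that u by auto
    have uin: "0 \<le> u k" "u k \<le> t1" if "k \<le> K" for k
      using ukl[of 0 k] ukl[of k K] that u0 uK by auto
    \<comment> \<open>Closeness at \<open>k\<close> presupposes that the scheme is in the ball up to
      \<open>k\<close>, so stability is applied to the grid cut off at \<open>k\<close>. The
      induction for \<open>inR\<close> then alternates closeness at \<open>k\<close> with the step
      to \<open>Suc k\<close>.\<close>
    have close: "norm (y (u k) - E k) \<le> \<eta>1" if k: "k \<le> K" and ER: "\<And>j. j \<le> k \<Longrightarrow> E j \<in> cball 0 R" for k
    proof -
      define e where "e j = \<epsilon> * (\<nu> (u (Suc j)) - \<nu> (u j))" for j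
      have ctk: "controlled p k (\<lambda>k. \<omega> (u k)) (\<lambda>k. x (u k))"
        using u uin u0 t1 k by (intro controlled_grid[OF ctl]) (auto intro: order_trans)
      have "norm ((\<lambda>k. y (u k)) k - E k) \<le> C * sum e {..<k}"
      proof (rule stab[OF ctk])
        show "\<omega> (u k) - \<omega> (u 0) \<le> W"
          using controlD(1)[OF ctl, of "u k" t1] uin[OF k] t1 u0 by (simp add: W_def)
        show "norm (y (u j) - y (u i)) \<le> B * (\<omega> (u j) - \<omega> (u i)) powr (1 / p)" if "i \<le> j" "j \<le> k" for i j
        proof -
          have "norm (y (u j) - y (u i)) \<le> B1 * (\<omega> (u j) - \<omega> (u i)) powr (1 / p)"
            using uin[of i] uin[of j] ukl[of i j] that k by (intro B1(2)[OF \<nu> t1(2) yR, of 0]) auto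
          also have "\<dots> \<le> B * (\<omega> (u j) - \<omega> (u i)) powr (1 / p)"
            by (intro mult_right_mono) (auto simp: B_def)
          finally show ?thesis .
        qed
        show "norm (E j - E i) \<le> B * (\<omega> (u j) - \<omega> (u i)) powr (1 / p)" if ij: "i \<le> j" "j \<le> k" for i j
        proof -
          have "norm (defect f (\<lambda>k. x (u k)) E i j) \<le> L * (\<omega> (u j) - \<omega> (u i)) powr (2 / p) + 2 * (\<Sum>l\<in>{i..<j}. 0)"
            using ER ij by (intro L(2)[OF ctk]) (auto simp: E_def defect_euler)
          then have "norm (defect f (\<lambda>k. x (u k)) E i j) \<le> L * (\<omega> (u j) - \<omega> (u i)) powr (2 / p)" by simp
          moreover have "norm (x (u j) - x (u i)) \<le> (\<omega> (u j) - \<omega> (u i)) powr (1 / p)" "0 \<le> \<omega> (u j) - \<omega> (u i)"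
            using controlledD[OF ctk ij] by auto
          moreover have "\<omega> (u j) - \<omega> (u i) \<le> W"
            using controlD(1)[OF ctl, of 0 "u i"] controlD(1)[OF ctl, of "u j" t1] uin[of i] uin[of j] ij k t1
            by (auto simp: W_def)
          ultimately have "norm (E j - E i) \<le> (F + L * W powr (1 / p)) * (\<omega> (u j) - \<omega> (u i)) powr (1 / p)"
            using p ER ij L(1)
            by (intro increment_le_of_defect[OF field(1), where X = "\<lambda>k. x (u k)"]) auto
          also have "\<dots> \<le> B * (\<omega> (u j) - \<omega> (u i)) powr (1 / p)"
            by (intro mult_right_mono) (auto simp: B_def)
          finally show ?thesis .
        qed
        show "\<omega> (u (Suc j)) - \<omega> (u j) \<le> c" if "j < k" for j
          using \<delta>c(2)[of "u j" "u (Suc j)"] uin[of j] uin[of "Suc j"] u[of j] that k t1 by auto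
        show "norm (defect f (\<lambda>k. x (u k)) (\<lambda>k. y (u k)) j (Suc j)) + norm (defect f (\<lambda>k. x (u k)) E j (Suc j)) \<le> e j"
          if "j < k" for j
          using \<delta>y(2)[of "u j" "u (Suc j)"] uin[of j] uin[of "Suc j"] u[of j] that k
          unfolding defect_sample E_def defect_euler e_def by auto
      qed (use yR uin k ER u0 y0 in \<open>auto simp: E_def\<close>)
      also have "sum e {..<k} = \<epsilon> * (\<nu> (u k) - \<nu> (u 0))"
        unfolding e_def sum_distrib_left[symmetric] sum_lessThan_telescope[of "\<lambda>k. \<nu> (u k)" k] ..
      also have "C * (\<epsilon> * (\<nu> (u k) - \<nu> (u 0))) \<le> C * (\<epsilon> * V)"
        using c \<epsilon> small_defects_mono[OF \<nu>, of "u k" t1] uin[OF k] u0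
        by (intro mult_left_mono) (auto simp: V_def)
      also note C\<epsilon>V
      finally show ?thesis .
    qed
    have inR: "\<forall>j\<le>k. E j \<in> cball 0 R" if "k \<le> K" for k
      using that
    proof (induction k)
      case 0
      then show ?case using yR[of 0] t1 y0 by (simp add: E_def)
    next
      case (Suc k)
      then have IH: "\<forall>j\<le>k. E j \<in> cball 0 R" and k: "k < K" by auto
      have "norm (y (u k) - E k) \<le> \<eta>1" using IH k by (intro close) auto
      moreover have "norm (y (u k)) \<le> R0" using R0 uin[of k] k by auto
      moreover have "norm (E k) \<le> norm (y (u k)) + norm (y (u k) - E k)" using norm_triangle_sub norm_minus_commute by metis
      ultimately have Ek: "norm (E k) \<le> R0 + 1 / 2" using \<eta>1 by linarith
      have "norm (f (E k) *v (x (u (Suc k)) - x (u k))) \<le> F * norm (x (u (Suc k)) - x (u k))"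
        using IH by (intro F(2)) auto
      also have "\<dots> \<le> 1 / 2"
        using u[of k] uin[of k] uin[of "Suc k"] k t1 by (intro Fx) auto
      finally have "norm (f (E k) *v (x (u (Suc k)) - x (u k))) \<le> 1 / 2" .
      moreover have "E (Suc k) = E k + f (E k) *v (x (u (Suc k)) - x (u k))" by (simp add: E_def)
      ultimately have "norm (E (Suc k)) \<le> R0 + 1"
        using Ek norm_triangle_ineq[of "E k" "f (E k) *v (x (u (Suc k)) - x (u k))"] by simp
      then show ?case using IH by (auto simp: R_def le_Suc_eq)
    qed
    have "norm (y (u k) - E k) \<le> \<eta>1" using close[OF kK] inR[OF kK] by blast
    then show "norm (euler f x y0 u k - y (u k)) < \<eta>"
      using \<eta>1 by (simp add: E_def norm_minus_commute)
  qed
qed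

subsection \<open>Solutions for bounded Lipschitz fields\<close>

lemma euler_cong:
  assumes "\<And>i. i \<le> k \<Longrightarrow> u i = v i"
  shows "euler f x y0 u k = euler f x y0 v k"
  using assms by (induction k) auto

lemma euler_stationary:
  assumes "k \<le> l" "\<And>i. k \<le> i \<Longrightarrow> i \<le> l \<Longrightarrow> u i = u k"
  shows "euler f x y0 u l = euler f x y0 u k"
  using assms
proof (induction l rule: dec_induct)
  case (step l)
  have "u (Suc l) = u k" "u l = u k" using step.prems[of "Suc l"] step.prems[of l] step.hyps by simp_all
  moreover have "euler f x y0 u l = euler f x y0 u k" by (intro step.IH step.prems) simp_all
  ultimately show ?case by simp
qed simp

text \<open>Freezing the uniform grid at time \<open>t\<close> turns the Euler scheme into a function of \<open>t\<close>
  that interpolates its values at the grid points.\<close>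

definition euler_path ::
  "(real ^ 'n \<Rightarrow> real ^ 'd ^ 'n) \<Rightarrow> (real \<Rightarrow> real ^ 'd) \<Rightarrow> real ^ 'n \<Rightarrow> real \<Rightarrow> nat \<Rightarrow> real \<Rightarrow> real ^ 'n" where
  "euler_path f x y0 h n t = euler f x y0 (\<lambda>j. min (real j * h) t) n"

text \<open>The grids frozen at \<open>real j * h\<close> and at \<open>t\<close> agree up to the
  index \<open>j\<close>, and from \<open>j\<close> on the former is stationary.\<close>

lemma euler_path_grid:
  assumes h: "0 \<le> h" and "j \<le> n" "real j * h \<le> t"
  shows "euler f x y0 (\<lambda>j. min (real j * h) t) j = euler_path f x y0 h n (real j * h)"
proof -
  have le: "real i * h \<le> real k * h" if "i \<le> k" for i k using that h by (intro mult_right_mono) auto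
  have "euler_path f x y0 h n (real j * h) = euler f x y0 (\<lambda>i. min (real i * h) (real j * h)) j"
    unfolding euler_path_def by (rule euler_stationary) (simp_all only: assms(2) min_absorb2[OF le] order_refl)
  also have "\<dots> = euler f x y0 (\<lambda>j. min (real j * h) t) j"
  proof (rule euler_cong)
    fix i assume "i \<le> j"
    then show "min (real i * h) (real j * h) = min (real i * h) t" using le[of i j] assms(3) by simp
  qed
  finally show ?thesis by simp
qed

text \<open>Between grid points the scheme follows \<open>x\<close> itself, with the coefficient
  taken at the left grid point; unlike linear interpolation, this produces no error of its
  own.\<close>

lemma euler_path_step:
  assumes h: "0 \<le> h" and j: "Suc j \<le> n" "real j * h \<le> s" "s \<le> real (Suc j) * h"
  shows "defect f x (euler_path f x y0 h n) (real j * h) s = 0"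
proof -
  have le: "real i * h \<le> real k * h" if "i \<le> k" for i k using that h by (intro mult_right_mono) auto
  have "s \<le> real i * h" if "Suc j \<le> i" for i using le[OF that] j by linarith
  then have "euler_path f x y0 h n s = euler f x y0 (\<lambda>j. min (real j * h) s) (Suc j)"
    unfolding euler_path_def using j by (intro euler_stationary) (auto simp: min_absorb2)
  also have "\<dots> = euler_path f x y0 h n (real j * h)
      + f (euler_path f x y0 h n (real j * h)) *v (x s - x (real j * h))"
    using euler_path_grid[OF h _ j(2), of n f x y0] j
    by (simp add: min_absorb1 min_absorb2 algebra_simps)
  finally show ?thesis by (simp add: defect_def)
qed

lemma grid_floor:
  fixes s h :: real
  assumes h: "0 < h" and s: "0 \<le> s" "s \<le> real (Suc n) * h"
  obtains j where "Suc j \<le> Suc n" "real j * h \<le> s" "s \<le> real (Suc j) * h"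
proof (cases "s = real (Suc n) * h")
  \<comment> \<open>At the right end of the grid the floor would give the index
    \<open>Suc n\<close>; the last cell, with index \<open>n\<close>, is taken instead.\<close>
  case True
  then show thesis using that[of n] h by (simp add: algebra_simps)
next
  case False
  define j where "j = nat \<lfloor>s / h\<rfloor>"
  have "0 \<le> s / h" using h s by simp
  then have j: "real j \<le> s / h" "s / h < real j + 1" unfolding j_def by linarith+
  have "s / h < real (Suc n)" using False s h by (simp add: field_simps)
  then have "real j < real (Suc n)" using j(1) by linarith
  then have "j < Suc n" by (simp only: of_nat_less_iff)
  then show thesis using that[of j] j h by (simp add: field_simps)
qed

text \<open>Sewing bounds the defect of a scheme from a grid point on, where its coefficient is
  updated. From an arbitrary time, a detour over the next grid point still gives an increment bound
  uniform in the mesh, hence equicontinuity. The limit inherits the defect bound at every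
  \<open>s\<close> because grid points approach \<open>s\<close> from the left.\<close>

lemma bounded_field_solution:
  fixes g :: "real ^ 'n \<Rightarrow> real ^ 'd ^ 'n"
  assumes p: "1 \<le> p" "p < 2" and g: "lip_field UNIV g F \<Lambda>" and ctl: "control p T \<omega> x" and T: "0 < T"
  obtains y L where "continuous_on {0..T} y" "y 0 = y0" "0 \<le> L"
    "\<And>s t. 0 \<le> s \<Longrightarrow> s \<le> t \<Longrightarrow> t \<le> T \<Longrightarrow> norm (defect g x y s t) \<le> L * (\<omega> t - \<omega> s) powr (2 / p)"
proof -
  have F: "0 \<le> F" "\<And>a h. norm (g a *v h) \<le> F * norm h"
    and \<Lambda>: "\<And>a b h. norm ((g a - g b) *v h) \<le> \<Lambda> * norm (a - b) * norm h"
    using g unfolding lip_field_def by auto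
  obtain L where L: "0 \<le> L"
    "\<And>K y X \<Omega> e k l. \<lbrakk>controlled p K \<Omega> X; \<And>k. k \<le> K \<Longrightarrow> y k \<in> UNIV;
        \<And>k. k < K \<Longrightarrow> norm (defect g X y k (Suc k)) \<le> e k; k \<le> l; l \<le> K\<rbrakk>
      \<Longrightarrow> norm (defect g X y k l) \<le> L * (\<Omega> l - \<Omega> k) powr (2 / p) + 2 * sum e {k..<l}"
    by (rule discrete_defect_bound[OF p g]) blast
  define h where "h n = T / real (Suc n)" for n
  have h: "0 < h n" "real (Suc n) * h n = T" for n using T by (auto simp: h_def)
  define Y where "Y n = euler_path g x y0 (h n) (Suc n)" for n
  \<comment> \<open>Freezing at \<open>t\<close> produces a finite scheme without one-step errors
    whose last value is \<open>Y n t\<close>, and the discrete bound applies to it.\<close>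
  have Ydef: "norm (defect g x (Y n) (real j * h n) t) \<le> L * (\<omega> t - \<omega> (real j * h n)) powr (2 / p)"
    if j: "j \<le> Suc n" "real j * h n \<le> t" and t: "t \<le> T" for n j t
  proof -
    have t0: "0 \<le> t" using j h(1)[of n] by (meson mult_nonneg_nonneg of_nat_0_le_iff less_imp_le order_trans)
    let ?u = "\<lambda>j. min (real j * h n) t"
    let ?E = "euler g x y0 ?u"
    have ct: "controlled p (Suc n) (\<lambda>k. \<omega> (?u k)) (\<lambda>k. x (?u k))"
    proof (rule controlled_grid[OF ctl])
      show "?u k \<le> ?u (Suc k)" for k using h(1)[of n] by (simp add: min_le_iff_disj algebra_simps)
    qed (use t t0 in auto)
    have "defect g (\<lambda>k. x (?u k)) ?E k (Suc k) = 0" for k by (rule defect_euler)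
    then have "norm (defect g (\<lambda>k. x (?u k)) ?E j (Suc n)) \<le> L * (\<omega> (?u (Suc n)) - \<omega> (?u j)) powr (2 / p) + 2 * (\<Sum>i\<in>{j..<Suc n}. 0)"
      using j by (intro L(2)[OF ct]) simp_all
    moreover have "?u (Suc n) = t" "?u j = real j * h n" using t j unfolding h(2) by auto
    moreover have "?E j = Y n (real j * h n)"
      unfolding Y_def using h(1)[of n] j by (intro euler_path_grid) auto
    moreover have "?E (Suc n) = Y n t" by (simp only: Y_def euler_path_def)
    ultimately show ?thesis unfolding defect_def by simp
  qed
  define W where "W = \<omega> T - \<omega> 0"
  define B where "B = F + L * W powr (1 / p)"
  have B: "0 \<le> B" using F L by (simp add: B_def)
  have W: "0 \<le> \<omega> t - \<omega> s" "\<omega> t - \<omega> s \<le> W" if "0 \<le> s" "s \<le> t" "t \<le> T" for s t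
    using controlD(1)[OF ctl, of 0 s] controlD(1)[OF ctl, of s t] controlD(1)[OF ctl, of t T] that by (auto simp: W_def)
  \<comment> \<open>\<open>F\<close> covers the piece up to the next grid point, \<open>B\<close>
    the rest.\<close>
  define G where "G = F + B"
  have G: "0 \<le> G" using F B by (simp add: G_def)
  have Yinc: "norm (Y n t - Y n s) \<le> G * (\<omega> t - \<omega> s) powr (1 / p)" if st: "0 \<le> s" "s \<le> t" "t \<le> T" for n s t
  proof -
    obtain j where j: "Suc j \<le> Suc n" "real j * h n \<le> s" "s \<le> real (Suc j) * h n"
      using st h[of n] by (auto intro: grid_floor[of "h n" s n])
    define r where "r = real j * h n"
    have r: "0 \<le> r" using h(1)[of n] by (simp add: r_def)
    have loc: "norm (Y n v - Y n s) \<le> F * (\<omega> v - \<omega> s) powr (1 / p)"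
      if v: "s \<le> v" "v \<le> real (Suc j) * h n" "v \<le> T" for v
    proof -
      have "defect g x (Y n) r v = 0" "defect g x (Y n) r s = 0"
        unfolding Y_def r_def using j v h(1)[of n] by (auto intro!: euler_path_step)
      then have "Y n v = Y n r + g (Y n r) *v (x v - x r)" "Y n s = Y n r + g (Y n r) *v (x s - x r)"
        by (simp_all add: defect_def diff_eq_eq add.commute)
      then have "Y n v - Y n s = g (Y n r) *v (x v - x r) - g (Y n r) *v (x s - x r)" by simp
      also have "\<dots> = g (Y n r) *v (x v - x s)" by (simp add: matrix_vector_mult_diff_distrib)
      finally have "norm (Y n v - Y n s) \<le> F * norm (x v - x s)" using F(2) by metis
      also have "\<dots> \<le> F * (\<omega> v - \<omega> s) powr (1 / p)"
        using F(1) v st by (intro mult_left_mono controlD(2)[OF ctl]) auto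
      finally show ?thesis .
    qed
    show ?thesis
    proof (cases "t \<le> real (Suc j) * h n")
      case True
      have "F * (\<omega> t - \<omega> s) powr (1 / p) \<le> G * (\<omega> t - \<omega> s) powr (1 / p)"
        using B by (intro mult_right_mono) (auto simp: G_def)
      then show ?thesis using loc[of t] True st by linarith
    next
      case False
      define v where "v = real (Suc j) * h n"
      have v: "s \<le> v" "v \<le> t" "0 \<le> v" using False j st by (auto simp: v_def)
      have "norm (Y n v - Y n s) \<le> F * (\<omega> v - \<omega> s) powr (1 / p)" using loc[of v] v st by (simp add: v_def)
      also have "\<dots> \<le> F * (\<omega> t - \<omega> s) powr (1 / p)"
        using F(1) p W(1)[of s v] W(1)[of v t] v st by (intro mult_left_mono powr_mono2) auto
      finally have 1: "norm (Y n v - Y n s) \<le> F * (\<omega> t - \<omega> s) powr (1 / p)" .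
      have "norm (defect g x (Y n) v t) \<le> L * (\<omega> t - \<omega> v) powr (2 / p)"
        unfolding v_def using j False st by (intro Ydef) auto
      then have "norm (Y n t - Y n v) \<le> B * (\<omega> t - \<omega> v) powr (1 / p)"
        unfolding B_def using p L(1) v st W[of v t] controlD(2)[OF ctl, of v t]
        by (intro increment_le_of_defect[OF g]) auto
      also have "\<dots> \<le> B * (\<omega> t - \<omega> s) powr (1 / p)"
        using B p W(1)[of s v] W(1)[of v t] v st by (intro mult_left_mono powr_mono2) auto
      finally have 2: "norm (Y n t - Y n v) \<le> B * (\<omega> t - \<omega> s) powr (1 / p)" .
      have "norm (Y n t - Y n s) \<le> norm (Y n v - Y n s) + norm (Y n t - Y n v)"
        using norm_triangle_ineq[of "Y n v - Y n s" "Y n t - Y n v"] by simp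
      then show ?thesis using 1 2 by (simp add: G_def algebra_simps)
    qed
  qed
  have Yinc': "norm (Y n s - Y n t) \<le> G * \<bar>\<omega> t - \<omega> s\<bar> powr (1 / p)" if "s \<in> {0..T}" "t \<in> {0..T}" for n s t
  proof (cases "s \<le> t")
    case True
    then show ?thesis using Yinc[of s t n] W(1)[of s t] that by (simp add: norm_minus_commute)
  next
    case False
    then show ?thesis using Yinc[of t s n] W(1)[of t s] that by (simp add: abs_minus_commute)
  qed
  have Y0: "Y n 0 = y0" for n
  proof -
    have "euler_path g x y0 (h n) (Suc n) 0 = euler g x y0 (\<lambda>j. min (real j * h n) 0) 0"
      unfolding euler_path_def using h(1)[of n] by (intro euler_stationary) (auto simp: min_absorb2)
    then show ?thesis by (simp add: Y_def)
  qed
  have \<omega>: "continuous_on {0..T} \<omega>" and x: "continuous_on {0..T} x" using ctl unfolding control_def by auto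
  have modulus: "\<exists>d>0. \<forall>t\<in>{0..T}. \<bar>s - t\<bar> < d \<longrightarrow> G * \<bar>\<omega> t - \<omega> s\<bar> powr (1 / p) < e"
    if s: "s \<in> {0..T}" and e: "0 < e" for s e
  proof -
    have "((\<lambda>t. G * \<bar>\<omega> t - \<omega> s\<bar> powr (1 / p)) \<longlongrightarrow> G * 0) (at s within {0..T})"
    proof (intro tendsto_mult tendsto_const tendsto_zero_powrI)
      have "((\<lambda>t. \<bar>\<omega> t - \<omega> s\<bar>) \<longlongrightarrow> \<bar>\<omega> s - \<omega> s\<bar>) (at s within {0..T})"
        using \<omega> s unfolding continuous_on_def by (intro tendsto_intros) auto
      then show "((\<lambda>t. \<bar>\<omega> t - \<omega> s\<bar>) \<longlongrightarrow> 0) (at s within {0..T})" by simp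
    qed (use p in auto)
    then have "\<forall>\<^sub>F t in at s within {0..T}. dist (G * \<bar>\<omega> t - \<omega> s\<bar> powr (1 / p)) (G * 0) < e"
      using e by (rule tendstoD)
    then obtain d where d: "d > 0"
      "\<forall>t\<in>{0..T}. t \<noteq> s \<and> dist t s < d \<longrightarrow> dist (G * \<bar>\<omega> t - \<omega> s\<bar> powr (1 / p)) (G * 0) < e"
      unfolding eventually_at by blast
    have "G * \<bar>\<omega> t - \<omega> s\<bar> powr (1 / p) < e" if "t \<in> {0..T}" "\<bar>s - t\<bar> < d" for t
    proof (cases "t = s")
      case False
      moreover have "dist t s < d" using that(2) by (simp add: dist_real_def abs_minus_commute)
      ultimately have "dist (G * \<bar>\<omega> t - \<omega> s\<bar> powr (1 / p)) (G * 0) < e"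
        using d(2) that(1) by blast
      then show ?thesis using G by (simp add: dist_real_def)
    qed (use e in simp)
    then show ?thesis using d(1) by blast
  qed
  have bounded: "norm (Y n s) \<le> norm y0 + G * W powr (1 / p)" if "s \<in> {0..T}" for n s
  proof -
    have "norm (Y n s - Y n 0) \<le> G * (\<omega> s - \<omega> 0) powr (1 / p)" using Yinc[of 0 s n] that by auto
    also have "\<dots> \<le> G * W powr (1 / p)"
      using W[of 0 s] that G p by (intro mult_left_mono powr_mono2) auto
    finally show ?thesis using norm_triangle_sub[of "Y n s" "y0"] by (simp add: Y0)
  qed
  have equicontinuous: "\<exists>d>0. \<forall>n t. t \<in> {0..T} \<and> norm (s - t) < d \<longrightarrow> norm (Y n s - Y n t) < e"
    if s: "s \<in> {0..T}" and e: "0 < e" for s e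
  proof -
    obtain d where d: "0 < d" "\<forall>t\<in>{0..T}. \<bar>s - t\<bar> < d \<longrightarrow> G * \<bar>\<omega> t - \<omega> s\<bar> powr (1 / p) < e"
      using modulus[OF s e] by blast
    have "norm (Y n s - Y n t) < e" if "t \<in> {0..T} \<and> norm (s - t) < d" for n t
      by (rule order_le_less_trans[OF Yinc'[OF s]]) (use d(2) that in auto)
    then show ?thesis using d(1) by blast
  qed
  have "\<exists>y r. continuous_on {0..T} y \<and> strict_mono (r :: nat \<Rightarrow> nat) \<and>
      (\<forall>e>0. \<exists>N. \<forall>n s. n \<ge> N \<and> s \<in> {0..T} \<longrightarrow> norm (Y (r n) s - y s) < e)"
  proof (rule Arzela_Ascoli[OF compact_Icc bounded equicontinuous])
    fix y and r :: "nat \<Rightarrow> nat"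
    assume yr: "continuous_on {0..T} y" "strict_mono r"
      and lim: "\<And>e. 0 < e \<Longrightarrow> \<exists>N. \<forall>n s. n \<ge> N \<and> s \<in> {0..T} \<longrightarrow> norm (Y (r n) s - y s) < e"
    show ?thesis by (intro exI[of _ y] exI[of _ r] conjI yr allI impI lim)
  qed
  then obtain y r where y: "continuous_on {0..T} y" and r: "strict_mono (r :: nat \<Rightarrow> nat)"
    and lim: "\<forall>e>0. \<exists>N. \<forall>n s. n \<ge> N \<and> s \<in> {0..T} \<longrightarrow> norm (Y (r n) s - y s) < e"
    by blast
  have lim': "(\<lambda>n. Y (r n) s) \<longlonglongrightarrow> y s" if "s \<in> {0..T}" for s
    unfolding lim_sequentially dist_norm
  proof (intro allI impI)
    fix e :: real assume "0 < e"
    then obtain N where "\<forall>n s. n \<ge> N \<and> s \<in> {0..T} \<longrightarrow> norm (Y (r n) s - y s) < e"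
      using lim by blast
    then show "\<exists>N. \<forall>n\<ge>N. norm (Y (r n) s - y s) < e" using that by blast
  qed
  have "y 0 = y0"
    using LIMSEQ_unique[OF lim'[of 0], of y0] T by (simp add: Y0)
  moreover have "norm (defect g x y s t) \<le> L * (\<omega> t - \<omega> s) powr (2 / p)"
    if st: "0 \<le> s" "s \<le> t" "t \<le> T" for s t
  proof -
    have "\<forall>n. \<exists>j. Suc j \<le> Suc n \<and> real j * h n \<le> s \<and> s \<le> real (Suc j) * h n"
    proof
      fix n
      show "\<exists>j. Suc j \<le> Suc n \<and> real j * h n \<le> s \<and> s \<le> real (Suc j) * h n"
        by (rule grid_floor[of "h n" s n]) (use st h[of n] in auto)
    qed
    from choice[OF this] obtain j where j: "\<And>n. Suc (j n) \<le> Suc n" "\<And>n. real (j n) * h n \<le> s"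
      "\<And>n. s \<le> real (Suc (j n)) * h n"
      by blast
    \<comment> \<open>The grid point to the left of \<open>s\<close>, at distance at most
      \<open>h (r n)\<close>, which tends to 0.\<close>
    define \<sigma> where "\<sigma> n = real (j (r n)) * h (r n)" for n
    have \<sigma>: "0 \<le> \<sigma> n" "\<sigma> n \<le> s" "s - \<sigma> n \<le> h (r n)" for n
      using j(2,3)[of "r n"] h(1)[of "r n"] by (auto simp: \<sigma>_def algebra_simps)
    have "(\<lambda>n. T * inverse (real (Suc n))) \<longlonglongrightarrow> T * 0"
      by (intro tendsto_mult tendsto_const LIMSEQ_inverse_real_of_nat)
    then have "h \<longlonglongrightarrow> 0" by (simp add: h_def[abs_def] divide_inverse)
    then have hr: "(\<lambda>n. h (r n)) \<longlonglongrightarrow> 0" using LIMSEQ_subseq_LIMSEQ[OF _ r] by (simp add: o_def)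
    have "(\<lambda>n. s - \<sigma> n) \<longlonglongrightarrow> 0"
      by (rule tendsto_sandwich[OF _ _ tendsto_const hr]) (use \<sigma> in auto)
    then have "(\<lambda>n. s - (s - \<sigma> n)) \<longlonglongrightarrow> s - 0" by (intro tendsto_diff tendsto_const)
    then have \<sigma>s: "\<sigma> \<longlonglongrightarrow> s" by simp
    have "\<sigma> n \<in> {0..T}" for n using \<sigma>(1,2)[of n] st by auto
    then have \<sigma>T: "\<forall>n. \<sigma> n \<in> {0..T}" by blast
    have sT: "s \<in> {0..T}" using st by auto
    have \<omega>\<sigma>: "(\<lambda>n. \<omega> (\<sigma> n)) \<longlonglongrightarrow> \<omega> s" and x\<sigma>: "(\<lambda>n. x (\<sigma> n)) \<longlonglongrightarrow> x s"
      using continuous_on_tendsto_compose[OF \<omega> \<sigma>s sT] continuous_on_tendsto_compose[OF x \<sigma>s sT] \<sigma>T by auto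
    have G\<sigma>: "(\<lambda>n. G * \<bar>\<omega> s - \<omega> (\<sigma> n)\<bar> powr (1 / p)) \<longlonglongrightarrow> G * 0"
    proof (intro tendsto_mult tendsto_const tendsto_zero_powrI)
      have "(\<lambda>n. \<omega> s - \<omega> (\<sigma> n)) \<longlonglongrightarrow> \<omega> s - \<omega> s" by (intro tendsto_diff tendsto_const \<omega>\<sigma>)
      then show "(\<lambda>n. \<bar>\<omega> s - \<omega> (\<sigma> n)\<bar>) \<longlonglongrightarrow> 0" by (intro tendsto_rabs_zero) simp
    qed (use p in auto)
    have "(\<lambda>n. Y (r n) (\<sigma> n) - Y (r n) s) \<longlonglongrightarrow> 0"
    proof (rule Lim_null_comparison[OF always_eventually])
      show "\<forall>n. norm (Y (r n) (\<sigma> n) - Y (r n) s) \<le> G * \<bar>\<omega> s - \<omega> (\<sigma> n)\<bar> powr (1 / p)"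
        using Yinc'[OF _ sT] \<sigma>T by blast
    qed (use G\<sigma> in simp)
    from tendsto_add[OF this lim'[OF sT]] have Y\<sigma>: "(\<lambda>n. Y (r n) (\<sigma> n)) \<longlonglongrightarrow> y s" by simp
    have xt: "(\<lambda>n. x t - x (\<sigma> n)) \<longlonglongrightarrow> x t - x s" by (intro tendsto_diff tendsto_const x\<sigma>)
    have "(\<lambda>n. \<Lambda> * norm (Y (r n) (\<sigma> n) - y s) * norm (x t - x (\<sigma> n))) \<longlonglongrightarrow> \<Lambda> * norm (y s - y s) * norm (x t - x s)"
      by (intro tendsto_intros Y\<sigma> xt)
    then have "(\<lambda>n. \<Lambda> * norm (Y (r n) (\<sigma> n) - y s) * norm (x t - x (\<sigma> n))) \<longlonglongrightarrow> 0" by simp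
    then have "(\<lambda>n. (g (Y (r n) (\<sigma> n)) - g (y s)) *v (x t - x (\<sigma> n))) \<longlonglongrightarrow> 0"
      by (rule Lim_null_comparison[OF always_eventually[OF allI[OF \<Lambda>]]])
    from tendsto_add[OF this bounded_linear.tendsto[OF matrix_vector_mul_bounded_linear[of "g (y s)"] xt]]
    have gx: "(\<lambda>n. g (Y (r n) (\<sigma> n)) *v (x t - x (\<sigma> n))) \<longlonglongrightarrow> g (y s) *v (x t - x s)"
      by (simp add: matrix_vector_mult_diff_rdistrib)
    have tT: "t \<in> {0..T}" using st by auto
    have "(\<lambda>n. norm (defect g x (Y (r n)) (\<sigma> n) t)) \<longlonglongrightarrow> norm (defect g x y s t)"
      unfolding defect_def by (intro tendsto_norm tendsto_diff lim'[OF tT] Y\<sigma> gx)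
    moreover have "(\<lambda>n. L * (\<omega> t - \<omega> (\<sigma> n)) powr (2 / p)) \<longlonglongrightarrow> L * (\<omega> t - \<omega> s) powr (2 / p)"
    proof (intro tendsto_mult tendsto_const tendsto_powr2 tendsto_diff \<omega>\<sigma> always_eventually allI)
      show "0 \<le> \<omega> t - \<omega> (\<sigma> n)" for n using W(1)[of "\<sigma> n" t] \<sigma>[of n] st by auto
    qed (use p in auto)
    moreover have "\<exists>N. \<forall>n\<ge>N. norm (defect g x (Y (r n)) (\<sigma> n) t) \<le> L * (\<omega> t - \<omega> (\<sigma> n)) powr (2 / p)"
    proof (intro exI allI impI)
      fix n
      show "norm (defect g x (Y (r n)) (\<sigma> n) t) \<le> L * (\<omega> t - \<omega> (\<sigma> n)) powr (2 / p)"
        unfolding \<sigma>_def using j(1)[of "r n"] \<sigma>(2)[of n] st by (intro Ydef) (auto simp: \<sigma>_def)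
    qed
    ultimately show ?thesis by (rule LIMSEQ_le)
  qed
  ultimately show thesis by (rule that[OF y _ L(1)])
qed

subsection \<open>Maximal solutions\<close>

text \<open>The closest-point map onto a ball is 1-Lipschitz, so composing \<open>f\<close> with it
  extends the bounds on the ball to the whole space. The path obtained exists up to \<open>T\<close>
  and solves the original equation as long as it remains in the ball, where the two fields
  coincide.\<close>

lemma truncated_solution:
  fixes f :: "real ^ 'n \<Rightarrow> real ^ 'd ^ 'n"
  assumes p: "1 \<le> p" "p < 2" and f: "lip_field (cball 0 R) f F \<Lambda>" and R: "0 \<le> R"
    and ctl: "control p T \<omega> x" and T: "0 < T"
  obtains Y where "continuous_on {0..T} Y" "Y 0 = y0"
    "\<And>t1. t1 \<le> T \<Longrightarrow> (\<And>s. 0 \<le> s \<Longrightarrow> s \<le> t1 \<Longrightarrow> norm (Y s) \<le> R) \<Longrightarrow> solution_on f x y0 t1 Y"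
proof -
  let ?S = "cball (0 :: real ^ 'n) R"
  define \<pi> where "\<pi> = closest_point ?S"
  have S: "convex ?S" "closed ?S" "?S \<noteq> {}" using R by auto
  have \<pi>: "\<pi> z \<in> ?S" for z unfolding \<pi>_def by (rule closest_point_in_set[OF S(2,3)])
  have \<pi>_lip: "norm (\<pi> a - \<pi> b) \<le> norm (a - b)" for a b
    using closest_point_lipschitz[OF S, of a b] by (simp add: \<pi>_def dist_norm)
  have \<pi>_id: "\<pi> z = z" if "norm z \<le> R" for z
    unfolding \<pi>_def using that by (intro closest_point_self) simp
  have F: "0 \<le> F" "0 \<le> \<Lambda>" "\<And>a h. a \<in> ?S \<Longrightarrow> norm (f a *v h) \<le> F * norm h"
    and \<Lambda>: "\<And>a b h. a \<in> ?S \<Longrightarrow> b \<in> ?S \<Longrightarrow> norm ((f a - f b) *v h) \<le> \<Lambda> * norm (a - b) * norm h"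
    using f unfolding lip_field_def by blast+
  have "norm ((f (\<pi> a) - f (\<pi> b)) *v h) \<le> \<Lambda> * norm (a - b) * norm h" for a b h
    by (rule order_trans[OF \<Lambda>[OF \<pi> \<pi>]]) (intro mult_right_mono mult_left_mono \<pi>_lip F norm_ge_zero)
  then have g: "lip_field UNIV (\<lambda>z. f (\<pi> z)) F \<Lambda>"
    unfolding lip_field_def by (intro conjI ballI allI F \<pi>)
  obtain Y L where Y: "continuous_on {0..T} Y" "Y 0 = y0" and L: "0 \<le> L"
    "\<And>s t. 0 \<le> s \<Longrightarrow> s \<le> t \<Longrightarrow> t \<le> T \<Longrightarrow> norm (defect (\<lambda>z. f (\<pi> z)) x Y s t) \<le> L * (\<omega> t - \<omega> s) powr (2 / p)"
    by (rule bounded_field_solution[OF p g ctl T]) blast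
  show thesis
  proof (rule that[OF Y])
    fix t1 assume t1: "t1 \<le> T" and Yb: "\<And>s. 0 \<le> s \<Longrightarrow> s \<le> t1 \<Longrightarrow> norm (Y s) \<le> R"
    show "solution_on f x y0 t1 Y"
    proof (rule solution_on_of_defect_bound[where \<omega> = \<omega>, OF _ _ p L(1), where y = Y, OF _ _ Y(2)])
      show "continuous_on {0..t1} \<omega>" using ctl t1 unfolding control_def by (auto intro: continuous_on_subset)
      show "\<omega> s \<le> \<omega> t" if "0 \<le> s" "s \<le> t" "t \<le> t1" for s t using controlD(1)[OF ctl, of s t] that t1 by simp
      show "norm (defect f x Y s t) \<le> L * (\<omega> t - \<omega> s) powr (2 / p)" if "0 \<le> s" "s \<le> t" "t \<le> t1" for s t
      proof -
        have "\<pi> (Y s) = Y s" using that by (intro \<pi>_id Yb) auto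
        then have "defect (\<lambda>z. f (\<pi> z)) x Y s t = defect f x Y s t" by (simp add: defect_def)
        then show ?thesis using L(2)[of s t] that t1 by simp
      qed
    qed
  qed
qed

text \<open>\<open>v\<close> is the least element of the compact set where \<open>g\<close> is at
  least \<open>c\<close>; if \<open>g v\<close> exceeded \<open>c\<close>, the intermediate value
  theorem would give an earlier element.\<close>

lemma first_exit:
  fixes g :: "real \<Rightarrow> real"
  assumes g: "continuous_on {a..b} g" and ab: "a \<le> b" and "g a < c" "c \<le> g b"
  obtains v where "a < v" "v \<le> b" "g v = c" "\<And>s. a \<le> s \<Longrightarrow> s < v \<Longrightarrow> g s < c"
proof -
  define A where "A = {a..b} \<inter> g -` {c..}"
  have "closed A" unfolding A_def by (intro continuous_closed_preimage g closed_atLeastAtMost closed_atLeast)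
  moreover have "bounded A"
    by (rule bounded_subset[OF bounded_closed_interval[of a b]]) (auto simp: A_def)
  ultimately have "compact A" by (simp add: compact_eq_bounded_closed)
  moreover have "b \<in> A" using assms by (simp add: A_def)
  ultimately obtain v where v: "v \<in> A" "\<And>s. s \<in> A \<Longrightarrow> v \<le> s"
    using compact_attains_inf[of A] by blast
  have less: "g s < c" if "a \<le> s" "s < v" for s
    using v(2)[of s] that v(1) by (force simp: A_def)
  have av: "a < v" using v(1) assms(3) by (cases "a = v") (auto simp: A_def)
  have "g v = c"
  proof (rule ccontr)
    assume "g v \<noteq> c"
    then have "c < g v" using v(1) by (auto simp: A_def)
    moreover have "continuous_on {a..v} g" using g v(1) by (auto simp: A_def intro: continuous_on_subset)
    ultimately obtain s where s: "a \<le> s" "s \<le> v" "g s = c"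
      using IVT'[of g a c v] assms(3) av by auto
    then show False using less[of s] \<open>c < g v\<close> by (cases "s = v") auto
  qed
  then show thesis using that av v(1) less by (auto simp: A_def)
qed

lemma solution_bounded:
  assumes "solution_on f x y0 t1 y" "continuous_on {0..t1} x"
  shows "bounded (y ` {0..t1})"
  using solution_on_small_defects[OF assms(1)] small_defects_bounded assms(2) by metis

lemma solution_continuous:
  fixes f :: "real ^ 'n \<Rightarrow> real ^ 'd ^ 'n"
  assumes "1 < \<gamma>" "\<gamma> \<le> 2" "C_rho \<gamma> f" and y: "solution_on f x y0 t1 y" and x: "continuous_on {0..t1} x"
  shows "continuous_on {0..t1} y"
proof -
  obtain R where R: "\<forall>z\<in>y ` {0..t1}. norm z \<le> R"
    using solution_bounded[OF y x] unfolding bounded_iff by blast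
  obtain F \<Lambda> H where f: "lip_field (cball 0 R) f F \<Lambda>"
    using C_rho_field_bounds[OF assms(1-3)] by blast
  obtain \<nu> where "small_defects f x t1 y \<nu>" by (rule solution_on_small_defects[OF y])
  then show ?thesis using R by (intro small_defects_continuous[OF _ x f]) auto
qed

text \<open>A solution starting in the ball of radius \<open>M\<close> needs a fixed amount of the control to leave the
  ball of radius \<open>M + 1\<close>; hence it cannot return to the small ball arbitrarily close to \<open>\<tau>\<close> and
  still be unbounded there.\<close>

lemma solution_norm_at_top_or_bounded:
  fixes f :: "real ^ 'n \<Rightarrow> real ^ 'd ^ 'n"
  assumes p: "1 \<le> p" "p < \<gamma>" "\<gamma> \<le> 2" and f: "C_rho \<gamma> f" and ctl: "control p T \<omega> x"
    and \<tau>: "0 < \<tau>" "\<tau> \<le> T" and y: "solution_before f x y0 \<tau> y"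
    and nlim: "\<not> filterlim (\<lambda>t. norm (y t)) at_top (at_left \<tau>)"
  obtains R where "\<And>t. 0 \<le> t \<Longrightarrow> t < \<tau> \<Longrightarrow> norm (y t) \<le> R"
proof -
  obtain M where M: "\<not> eventually (\<lambda>t. M \<le> norm (y t)) (at_left \<tau>)"
    using nlim unfolding filterlim_at_top by blast
  have ysol: "solution_on f x y0 t y" if "0 \<le> t" "t < \<tau>" for t
    using y that unfolding solution_before_def by blast
  have xc: "continuous_on {0..t} x" if "t \<le> \<tau>" for t
    using ctl that \<tau> unfolding control_def by (auto intro: continuous_on_subset)
  have \<gamma>: "1 < \<gamma>" "p < 2" using p by auto
  obtain F \<Lambda> H where field: "lip_field (cball 0 (M + 1)) f F \<Lambda>"
    using C_rho_field_bounds[OF \<gamma>(1) p(3) f] by blast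
  obtain B where B: "0 \<le> B"
    "\<And>y \<nu> a t1 s t. \<lbrakk>small_defects f x t1 y \<nu>; t1 \<le> T; \<And>s. a \<le> s \<Longrightarrow> s \<le> t1 \<Longrightarrow> y s \<in> cball 0 (M + 1);
        0 \<le> a; a \<le> s; s \<le> t; t \<le> t1\<rbrakk>
      \<Longrightarrow> norm (y t - y s) \<le> B * (\<omega> t - \<omega> s) powr (1 / p)"
    by (rule solution_increment_bound[OF p(1) \<gamma>(2) field ctl]) blast
  \<comment> \<open>\<open>B * c powr (1 / p)\<close> equals \<open>B / (B + 2)\<close>, so this
    much control moves a solution in the ball by less than 1.\<close>
  define c where "c = (1 / (B + 2)) powr p"
  have c: "0 < c" using B by (simp add: c_def)
  have Bc: "B * c powr (1 / p) < 1" using p B by (simp add: c_def powr_powr field_simps)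
  obtain \<delta> where \<delta>: "0 < \<delta>" "\<And>s t. 0 \<le> s \<Longrightarrow> s \<le> t \<Longrightarrow> t \<le> T \<Longrightarrow> t - s < \<delta> \<Longrightarrow> \<omega> t - \<omega> s \<le> c"
    by (rule control_small_steps[OF ctl c]) blast
  \<comment> \<open>Failure of the limit gives times arbitrarily close to \<open>\<tau>\<close> with
    norm below \<open>M\<close>; this one is so close that at most \<open>c\<close> of the control
    is left before \<open>\<tau>\<close>.\<close>
  obtain a where a: "0 < a" "a < \<tau>" "\<tau> - a < \<delta>" "norm (y a) < M"
  proof -
    have "\<exists>a. max 0 (\<tau> - \<delta>) < a \<and> a < \<tau> \<and> \<not> M \<le> norm (y a)"
    proof (rule ccontr)
      assume "\<nexists>a. max 0 (\<tau> - \<delta>) < a \<and> a < \<tau> \<and> \<not> M \<le> norm (y a)"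
      then have "\<forall>t>max 0 (\<tau> - \<delta>). t < \<tau> \<longrightarrow> M \<le> norm (y t)" by blast
      moreover have "max 0 (\<tau> - \<delta>) < \<tau>" using \<tau> \<delta> by simp
      ultimately have "eventually (\<lambda>t. M \<le> norm (y t)) (at_left \<tau>)"
        using eventually_at_left[of "max 0 (\<tau> - \<delta>)" \<tau>] by blast
      then show False using M by blast
    qed
    then show thesis using that by (auto simp: not_le)
  qed
  have near: "norm (y t) \<le> M + 1" if t: "a \<le> t" "t < \<tau>" for t
  proof (rule ccontr)
    assume neg: "\<not> norm (y t) \<le> M + 1"
    have sol: "solution_on f x y0 t y" using ysol t a by simp
    have cont: "continuous_on {a..t} (\<lambda>s. norm (y s))"
      by (rule continuous_on_norm, rule continuous_on_subset[OF solution_continuous[OF \<gamma>(1) p(3) f sol]])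
        (use xc t a in auto)
    obtain v where v: "a < v" "v \<le> t" "norm (y v) = M + 1" "\<And>s. a \<le> s \<Longrightarrow> s < v \<Longrightarrow> norm (y s) < M + 1"
      by (rule first_exit[OF cont t(1), of "M + 1"]) (use a neg in auto)
    \<comment> \<open>The increment bound is applied on \<open>{a..v}\<close> alone, the stretch
      known to lie in the ball.\<close>
    have yv: "y s \<in> cball 0 (M + 1)" if "a \<le> s" "s \<le> v" for s
      using v(3) v(4)[of s] that by (cases "s = v") auto
    have "solution_on f x y0 v y" using ysol v t a by simp
    then obtain \<nu> where \<nu>: "small_defects f x v y \<nu>" by (rule solution_on_small_defects)
    have "norm (y v - y a) \<le> B * (\<omega> v - \<omega> a) powr (1 / p)"
      using v t a \<tau> by (intro B(2)[OF \<nu> _ yv]) auto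
    also have "\<dots> \<le> B * c powr (1 / p)"
      using B(1) p \<delta>(2)[of a v] controlD(1)[OF ctl, of a v] v t a \<tau>
      by (intro mult_left_mono powr_mono2) auto
    also note Bc
    finally have "norm (y v - y a) < 1" .
    then show False using norm_triangle_sub[of "y v" "y a"] v(3) a(4) by linarith
  qed
  obtain R where R: "\<forall>z\<in>y ` {0..a}. norm z \<le> R"
    using solution_bounded[OF ysol xc, of a] a unfolding bounded_iff by auto
  have "norm (y t) \<le> max R (M + 1)" if "0 \<le> t" "t < \<tau>" for t
    using R near[of t] that by (cases "t \<le> a") (auto simp: le_max_iff_disj)
  then show thesis by (rule that)
qed

text \<open>\<open>\<tau>\<close> is the supremum of the times up to which solutions exist, and
  uniqueness glues these solutions. If \<open>\<tau> < T\<close> and the norm does not tend to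
  infinity, \<open>y\<close> is bounded by some \<open>R\<close>. Instead of a restart at
  \<open>\<tau>\<close>, the truncated solution for the radius \<open>R + 1\<close> is used: it is a
  solution until it first reaches the norm \<open>R + 1\<close>, so this happens no later than
  \<open>\<tau>\<close>; yet before that time it agrees with \<open>y\<close> and has norm at most
  \<open>R\<close>, contrary to continuity.\<close>

lemma maximal_solution_exists:
  fixes f :: "real ^ 'n \<Rightarrow> real ^ 'd ^ 'n"
  assumes p: "1 \<le> p" "p < \<gamma>" "\<gamma> \<le> 2" and f: "C_rho \<gamma> f" and ctl: "control p T \<omega> x" and T: "0 < T"
  shows "\<exists>\<tau> y. maximal_solution f x y0 T \<tau> y"
proof -
  have \<gamma>: "1 < \<gamma>" "p < 2" using p by auto
  define A where "A = {t. 0 \<le> t \<and> t \<le> T \<and> (\<exists>y. solution_on f x y0 t y)}"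
  have A_down: "s \<in> A" if "t \<in> A" "0 \<le> s" "s \<le> t" for s t
    using that solution_on_subset unfolding A_def by (auto intro: order_trans) blast
  have trunc: "\<exists>Y. continuous_on {0..T} Y \<and> Y 0 = y0 \<and>
      (\<forall>t1\<le>T. (\<forall>s. 0 \<le> s \<and> s \<le> t1 \<longrightarrow> norm (Y s) \<le> R) \<longrightarrow> solution_on f x y0 t1 Y)" if "0 \<le> R" for R
  proof -
    obtain F \<Lambda> H where field: "lip_field (cball 0 R) f F \<Lambda>"
      using C_rho_field_bounds[OF \<gamma>(1) p(3) f] by blast
    show ?thesis by (rule truncated_solution[OF p(1) \<gamma>(2) field that ctl T, of y0]) blast
  qed
  obtain \<tau>0 where \<tau>0: "0 < \<tau>0" "\<tau>0 \<in> A"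
  proof -
    obtain Y where Y: "continuous_on {0..T} Y" "Y 0 = y0"
      "\<forall>t1\<le>T. (\<forall>s. 0 \<le> s \<and> s \<le> t1 \<longrightarrow> norm (Y s) \<le> norm y0 + 1) \<longrightarrow> solution_on f x y0 t1 Y"
      using trunc[of "norm y0 + 1"] by auto
    obtain d where d: "0 < d" "\<forall>s\<in>{0..T}. dist s 0 < d \<longrightarrow> dist (Y s) (Y 0) < 1"
      using Y(1) T unfolding continuous_on_iff by (metis atLeastAtMost_iff less_eq_real_def zero_less_one)
    define t where "t = min T (d / 2)"
    have "norm (Y s) \<le> norm y0 + 1" if "0 \<le> s \<and> s \<le> t" for s
    proof -
      have "dist (Y s) (Y 0) < 1" using d that by (auto simp: t_def)
      then show ?thesis using norm_triangle_sub[of "Y s" y0] Y(2) by (simp add: dist_norm)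
    qed
    then have "solution_on f x y0 t Y" using Y(3) by (simp add: t_def)
    then show thesis using that[of t] T d by (auto simp: A_def t_def)
  qed
  have A_bdd: "bdd_above A" by (rule bdd_aboveI[of _ T]) (simp add: A_def)
  define \<tau> where "\<tau> = Sup A"
  have A_le: "t \<le> \<tau>" if "t \<in> A" for t unfolding \<tau>_def using that A_bdd by (rule cSup_upper)
  have "\<tau> \<le> T" unfolding \<tau>_def by (rule cSup_least) (use \<tau>0 in \<open>auto simp: A_def\<close>)
  then have \<tau>: "0 < \<tau>" "\<tau> \<le> T" using A_le[OF \<tau>0(2)] \<tau>0 by auto
  have A_below: "t \<in> A" if "0 \<le> t" "t < \<tau>" for t
  proof -
    have "A \<noteq> {}" using \<tau>0 by blast
    then have "\<exists>s\<in>A. t < s" using that(2) A_bdd unfolding \<tau>_def by (simp add: less_cSup_iff)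
    then obtain s where "s \<in> A" "t < s" by blast
    then show ?thesis using A_down[of s t] that by simp
  qed
  define Z where "Z t = (SOME y. solution_on f x y0 t y)" for t
  have Z: "solution_on f x y0 t (Z t)" if "0 \<le> t" "t < \<tau>" for t
  proof -
    have "\<exists>y. solution_on f x y0 t y" using A_below[OF that] by (simp add: A_def)
    then show ?thesis unfolding Z_def by (rule someI_ex)
  qed
  \<comment> \<open>The choices \<open>Z t\<close> for different \<open>t\<close> are unrelated; by
    uniqueness the diagonal agrees with every solution before \<open>\<tau>\<close>.\<close>
  define y where "y t = Z t t" for t
  have y_eq: "y s = y' s" if "solution_on f x y0 t y'" "0 \<le> s" "s \<le> t" "s < \<tau>" for s t y'
    unfolding y_def using that \<tau> by (intro solution_unique[OF p f ctl Z[of s] that(1)]) auto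
  have ysol: "solution_on f x y0 t y" if "0 \<le> t" "t < \<tau>" for t
    using y_eq[OF Z[OF that]] that Z[OF that] solution_on_cong[of t y "Z t" f x y0] by auto
  then have before: "solution_before f x y0 \<tau> y" unfolding solution_before_def by blast
  moreover have "filterlim (\<lambda>t. norm (y t)) at_top (at_left \<tau>)" if "\<tau> < T"
  proof (rule ccontr)
    assume neg: "\<not> filterlim (\<lambda>t. norm (y t)) at_top (at_left \<tau>)"
    obtain R where R: "\<And>t. 0 \<le> t \<Longrightarrow> t < \<tau> \<Longrightarrow> norm (y t) \<le> R"
      by (rule solution_norm_at_top_or_bounded[OF p f ctl \<tau> before neg]) blast
    have y0: "y 0 = y0" using ysol[of 0] \<tau> by (simp add: solution_on_def)
    have R0: "norm y0 \<le> R" using R[of 0] \<tau> y0 by simp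
    then have R1: "0 \<le> R + 1" using norm_ge_zero[of y0] by linarith
    obtain Y where Y: "continuous_on {0..T} Y" "Y 0 = y0"
      "\<forall>t1\<le>T. (\<forall>s. 0 \<le> s \<and> s \<le> t1 \<longrightarrow> norm (Y s) \<le> R + 1) \<longrightarrow> solution_on f x y0 t1 Y"
      using trunc[OF R1] by blast
    \<comment> \<open>\<open>Y\<close> cannot stay in the ball up to \<open>T\<close>, as it would
      then be a solution beyond \<open>\<tau>\<close>.\<close>
    have "T \<notin> A" using A_le that by force
    then have "\<not> solution_on f x y0 T Y" using T by (auto simp: A_def)
    then obtain b where b: "0 \<le> b" "b \<le> T" "R + 1 \<le> norm (Y b)" using Y(3) by force
    have cY: "continuous_on {0..b} (\<lambda>s. norm (Y s))"
      by (rule continuous_on_norm, rule continuous_on_subset[OF Y(1)]) (use b in auto)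
    obtain v where v: "0 < v" "v \<le> b" "norm (Y v) = R + 1" "\<And>s. 0 \<le> s \<Longrightarrow> s < v \<Longrightarrow> norm (Y s) < R + 1"
      by (rule first_exit[OF cY b(1), of "R + 1"]) (use b R0 Y(2) in auto)
    have Yv: "solution_on f x y0 v Y"
    proof -
      have "norm (Y s) \<le> R + 1" if "0 \<le> s \<and> s \<le> v" for s
        using v(3) v(4)[of s] that by (cases "s = v") auto
      then show ?thesis using Y(3) v b by auto
    qed
    then have "v \<le> \<tau>" using v b by (intro A_le) (auto simp: A_def)
    then have less: "norm (Y s) \<le> R" if "0 \<le> s" "s < v" for s
      using y_eq[OF Yv, of s] R[of s] that by auto
    have "((\<lambda>s. norm (Y s)) \<longlongrightarrow> norm (Y v)) (at v within {0..v})"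
      using continuous_on_subset[OF cY, of "{0..v}"] v(1,2) unfolding continuous_on_def by simp
    then have lim: "((\<lambda>s. norm (Y s)) \<longlongrightarrow> norm (Y v)) (at_left v)"
      by (simp add: at_within_Icc_at_left[OF v(1)])
    have "\<forall>\<^sub>F s in at_left v. norm (Y s) \<le> R"
      unfolding eventually_at_left[OF v(1)] using v(1) less by (intro exI[of _ 0]) auto
    then have "norm (Y v) \<le> R" by (rule tendsto_upperbound[OF lim]) (rule trivial_limit_at_left_real)
    then show False using v(3) by simp
  qed
  ultimately show ?thesis using \<tau> unfolding maximal_solution_def by blast
qed

theorem theorem2p3:
  fixes p \<gamma> T :: real
    and x :: "real \<Rightarrow> real ^ 'd"
    and f :: "real ^ 'n \<Rightarrow> real ^ 'd ^ 'n"
    and y0 :: "real ^ 'n"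
  assumes "1 \<le> p" and "p < \<gamma>" and "\<gamma> \<le> 2" and "0 < T"
    and "continuous_on {0..T} x" and "finite_p_variation p T x"
    and "C_rho \<gamma> f"
  shows "(\<exists>\<tau> y. maximal_solution f x y0 T \<tau> y) \<and>
    (\<forall>\<tau> y. maximal_solution f x y0 T \<tau> y \<longrightarrow>
      (\<forall>t y'. 0 \<le> t \<and> t < \<tau> \<and> solution_on f x y0 t y' \<longrightarrow> (\<forall>s\<in>{0..t}. y' s = y s)) \<and>
      (\<forall>t \<epsilon>. 0 \<le> t \<and> t < \<tau> \<and> 0 < \<epsilon> \<longrightarrow>
        (\<exists>\<delta>>0. \<forall>K (u :: nat \<Rightarrow> real).
          u 0 = 0 \<and> u K = t \<and> (\<forall>k<K. u k < u (Suc k) \<and> u (Suc k) - u k < \<delta>) \<longrightarrow>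
          (\<forall>k\<le>K. norm (euler f x y0 u k - y (u k)) < \<epsilon>))))"
proof -
  have "0 < p" using assms(1) by simp
  then obtain \<omega> where ctl: "control p T \<omega> x"
    by (rule finite_p_variation_control[OF _ assms(5,6)])
  note p = assms(1-3) and f = assms(7)
  have maxD: "solution_on f x y0 t y \<and> t \<le> T" if "maximal_solution f x y0 T \<tau> y" "0 \<le> t" "t < \<tau>" for \<tau> y t
    using that unfolding maximal_solution_def solution_before_def by auto
  show ?thesis
  proof (intro conjI allI impI ballI)
    show "\<exists>\<tau> y. maximal_solution f x y0 T \<tau> y"
      by (rule maximal_solution_exists[OF p f ctl assms(4)])
  next
    fix \<tau> y t y' s
    assume y: "maximal_solution f x y0 T \<tau> y" and t: "0 \<le> t \<and> t < \<tau> \<and> solution_on f x y0 t y'" and s: "s \<in> {0..t}"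
    show "y' s = y s"
      using maxD[OF y, of t] t s by (intro solution_unique[OF p f ctl, of y0 t y' t y]) auto
  next
    fix \<tau> y t \<epsilon>
    assume y: "maximal_solution f x y0 T \<tau> y" and t: "0 \<le> t \<and> t < \<tau> \<and> 0 < (\<epsilon>::real)"
    have t': "0 \<le> t" "t \<le> T" "solution_on f x y0 t y" "0 < \<epsilon>" using maxD[OF y, of t] t by auto
    obtain \<delta> where \<delta>: "0 < \<delta>" "\<And>K (u :: nat \<Rightarrow> real) k. \<lbrakk>u 0 = 0; u K = t;
      \<And>k. k < K \<Longrightarrow> u k \<le> u (Suc k) \<and> u (Suc k) - u k < \<delta>; k \<le> K\<rbrakk>
      \<Longrightarrow> norm (euler f x y0 u k - y (u k)) < \<epsilon>"
      by (rule euler_convergence[OF p f ctl t']) blast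
    show "\<exists>\<delta>>0. \<forall>K (u :: nat \<Rightarrow> real).
          u 0 = 0 \<and> u K = t \<and> (\<forall>k<K. u k < u (Suc k) \<and> u (Suc k) - u k < \<delta>) \<longrightarrow>
          (\<forall>k\<le>K. norm (euler f x y0 u k - y (u k)) < \<epsilon>)"
      using \<delta>(1) by (intro exI[of _ \<delta>] conjI allI impI \<delta>(2)) (auto simp: less_imp_le)
  qed
qed

end
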